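(* Let $(T,f)$ be a Hubbard tree with kneading sequence $\nu$ and associated function $\rho=\rho_\nu$. For $m\ge1$, let $r\in\{1,2,\dots,m\}$ be congruent to $\rho(m)$ modulo $m$ and define $$q(m):=\begin{cases}\dfrac{\rho(m)-r}{m}+1 & \text{if } m\in\mathrm{orb}_\rho(r),\\[2mm] \dfrac{\rho(m)-r}{m}+2 & \text{if } m\notin\mathrm{orb}_\rho(r).\end{cases}$$ If $z_1\in T$ is a tame branch point of exact period $m$, then $m$ occurs in the internal address of $\nu$, and the number of arms at $z_1$ is $q(m)$. Conversely, for any entry $m$ in the internal address with $q(m)\ge 3$, there is a tame branch point of exact period $m$ with $q(m)$ arms (unless the critical orbit has period $m$).
   Context: Trees. A tree $T$ is a finite connected (topological) graph without loops. For $x\in T$, the (global) arms of $x$ are the connected components of $T\setminus\{x\}$; a local arm at $x$ is the intersection of a global arm with a sufficiently small neighborhood of $x$. The point $x$ is an endpoint if it has only one arm, a branch point if it has at least three arms. $[x,y]$ is the unique closed arc connecting $x$ and $y$. Hubbard trees. A Hubbard tree is a tree $T$ with a map $f\colon T\to T$ and a distinguished point, the critical point, such that: (1) $f$ is continuous and surjective; (2) every point has at most two inverse images under $f$; (3) at every point other than the critical point, $f$ is a local homeomorphism onto its image; (4) all endpoints of $T$ are on the critical orbit; (5) the critical point is periodic or preperiodic, but not fixed; (6) (expansivity) if $x\neq y$ are branch points or points on the critical orbit, then there is $n\ge 0$ such that $f^{\circ n}([x,y])$ contains the critical point. Write $c_0=0$ for the critical point, $c_k=f^{\circ k}(0)$;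 $c_1$ is the critical value and $c_1\ne c_0$. Kneading sequence. Let $T_{\mathtt 1}$ be the component of $T\setminus\{0\}$ containing $c_1$, $T_\star=\{0\}$, $T_{\mathtt 0}=T\setminus(T_{\mathtt 1}\cup\{0\})$ (possibly empty). The itinerary of $x\in T$ is the sequence $e_1e_2e_3\dots$ over $\{\mathtt 0,\star,\mathtt 1\}$ with $f^{\circ(j-1)}(x)\in T_{e_j}$. The kneading sequence $\nu$ of $(T,f)$ is the itinerary of $c_1$; it starts with $\mathtt 1$. Tame and evil. A periodic orbit of branch points (which never contains the critical point) is called tame if all its local arms are on the same cycle under the map induced by $f$ on local arms, and evil otherwise; a periodic branch point is tame if its orbit is tame. $\rho$-function. For $n\ge 1$ let $\rho(n)=\inf\{k>n:\nu_k\ne\nu_{k-n}\}\in\{1,2,\dots\}\cup\{\infty\}$. The $\rho$-orbit of $k$ is $\mathrm{orb}_\rho(k)= k\to\rho(k)\to\rho(\rho(k))\to\cdots$ (stopping before $\infty$ is reached). The internal address of $\nu$ is $\mathrm{orb}_\rho(1)$. (The quantity $q(m)$ is only considered when $\rho(m)<\infty$.) *)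

theory Defs
  imports "HOL-Analysis.Analysis" "HOL-Library.Extended_Nat"
begin

section \<open>Topological trees\<close>

text \<open>
  A finite topological graph has finitely many vertices and finitely many edges; an edge is an arc
  that meets the vertex set exactly in its two endpoints, and distinct edges meet only in vertices.
  This covers all finite graphs, since an edge that is a loop can be subdivided.
\<close>

definition finite_top_graph :: "'a::t2_space set \<Rightarrow> bool" where
  "finite_top_graph T \<longleftrightarrow>
    (\<exists>(V :: 'a set) (E :: (real \<Rightarrow> 'a) set).
      finite V \<and> finite E \<and>
      T = V \<union> (\<Union>g\<in>E. path_image g) \<and>
      (\<forall>g\<in>E. arc g \<and> path_image g \<inter> V = {pathstart g, pathfinish g}) \<and>
      (\<forall>g\<in>E. \<forall>h\<in>E. g \<noteq> h \<longrightarrow> path_image g \<inter> path_image h \<subseteq> V))"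

definition top_tree :: "'a::t2_space set \<Rightarrow> bool" where
  "top_tree T \<longleftrightarrow>
    finite_top_graph T \<and> connected T \<and>
    \<not> (\<exists>g. simple_path g \<and> pathfinish g = pathstart g \<and> path_image g \<subseteq> T)"

definition arms :: "'a::t2_space set \<Rightarrow> 'a \<Rightarrow> 'a set set" where
  "arms T x = components (T - {x})"

definition tree_endpoint :: "'a::t2_space set \<Rightarrow> 'a \<Rightarrow> bool" where
  "tree_endpoint T x \<longleftrightarrow> x \<in> T \<and> card (arms T x) = 1"

definition branch_point :: "'a::t2_space set \<Rightarrow> 'a \<Rightarrow> bool" where
  "branch_point T x \<longleftrightarrow> x \<in> T \<and> card (arms T x) \<ge> 3"

definition tree_arc :: "'a::t2_space set \<Rightarrow> 'a \<Rightarrow> 'a \<Rightarrow> 'a set" where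
  "tree_arc T x y =
    (if x = y then {x}
     else (THE A. A \<subseteq> T \<and>
            (\<exists>g. arc g \<and> pathstart g = x \<and> pathfinish g = y \<and> path_image g = A)))"


section \<open>Hubbard trees\<close>

definition orbit_of :: "('a \<Rightarrow> 'a) \<Rightarrow> 'a \<Rightarrow> 'a set" where
  "orbit_of f x = {(f ^^ n) x |n. True}"

definition exact_period :: "('a \<Rightarrow> 'a) \<Rightarrow> 'a \<Rightarrow> nat \<Rightarrow> bool" where
  "exact_period f x m \<longleftrightarrow>
    m > 0 \<and> (f ^^ m) x = x \<and> (\<forall>k. 0 < k \<and> k < m \<longrightarrow> (f ^^ k) x \<noteq> x)"

text \<open>
  The critical point is \<open>c\<close>. Only the values of \<open>f\<close> on \<open>T\<close> matter.
  In the third clause the image \<open>f ` U\<close> is not required to be open in \<open>T\<close>: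
  an endpoint of \<open>T\<close> may well be mapped to a point with several arms.
\<close>

definition hubbard_tree :: "'a::t2_space set \<Rightarrow> ('a \<Rightarrow> 'a) \<Rightarrow> 'a \<Rightarrow> bool" where
  "hubbard_tree T f c \<longleftrightarrow>
    top_tree T \<and> c \<in> T \<and>
    (continuous_on T f \<and> f ` T = T) \<and>
    (\<forall>y\<in>T. finite {x \<in> T. f x = y} \<and> card {x \<in> T. f x = y} \<le> 2) \<and>
    (\<forall>x\<in>T - {c}. \<exists>U. openin (top_of_set T) U \<and> x \<in> U \<and>
                    (\<exists>g. homeomorphism U (f ` U) f g)) \<and>
    (\<forall>x. tree_endpoint T x \<longrightarrow> x \<in> orbit_of f c) \<and>
    ((\<exists>i j. i < j \<and> (f ^^ i) c = (f ^^ j) c) \<and> f c \<noteq> c) \<and>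
    (\<forall>x y. x \<noteq> y \<and>
           (branch_point T x \<or> x \<in> orbit_of f c) \<and>
           (branch_point T y \<or> y \<in> orbit_of f c) \<longrightarrow>
           (\<exists>n. c \<in> (f ^^ n) ` tree_arc T x y))"


section \<open>Tame periodic branch points\<close>

text \<open>
  The local arms at \<open>x\<close> correspond bijectively to the global arms at \<open>x\<close>, so a local arm is
  represented by the pair of \<open>x\<close> and the global arm \<open>A\<close> that contains it. Its image is the local
  arm at \<open>f x\<close> whose global arm contains \<open>f y\<close> for all \<open>y \<in> A\<close> sufficiently close to \<open>x\<close>;
  it is well defined whenever \<open>f\<close> is injective near \<open>x\<close>.
\<close>

definition local_arm_map ::
    "'a::t2_space set \<Rightarrow> ('a \<Rightarrow> 'a) \<Rightarrow> 'a \<times> 'a set \<Rightarrow> 'a \<times> 'a set" where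
  "local_arm_map T f = (\<lambda>(x, A).
     (f x, THE B. B \<in> arms T (f x) \<and> (\<forall>\<^sub>F y in at x within A. f y \<in> B)))"

definition local_arms :: "'a::t2_space set \<Rightarrow> 'a set \<Rightarrow> ('a \<times> 'a set) set" where
  "local_arms T Z = Sigma Z (arms T)"

definition tame_orbit :: "'a::t2_space set \<Rightarrow> ('a \<Rightarrow> 'a) \<Rightarrow> 'a set \<Rightarrow> bool" where
  "tame_orbit T f Z \<longleftrightarrow>
    (\<exists>l\<in>local_arms T Z.
      (\<exists>n>0. (local_arm_map T f ^^ n) l = l) \<and>
      local_arms T Z \<subseteq> orbit_of (local_arm_map T f) l)"

definition tame_branch_point :: "'a::t2_space set \<Rightarrow> ('a \<Rightarrow> 'a) \<Rightarrow> 'a \<Rightarrow> bool" where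
  "tame_branch_point T f z \<longleftrightarrow>
    branch_point T z \<and> (\<exists>n>0. (f ^^ n) z = z) \<and> tame_orbit T f (orbit_of f z)"


section \<open>Kneading sequences and internal addresses\<close>

datatype symbol = Sym0 | SymStar | Sym1

text \<open>
  Sequences of symbols are indexed from 1; the entry at index 0 is never used.
\<close>

definition itinerary :: "'a::t2_space set \<Rightarrow> ('a \<Rightarrow> 'a) \<Rightarrow> 'a \<Rightarrow> 'a \<Rightarrow> nat \<Rightarrow> symbol" where
  "itinerary T f c x j =
    (let y = (f ^^ (j - 1)) x in
     if y = c then SymStar
     else if y \<in> connected_component_set (T - {c}) (f c) then Sym1
     else Sym0)"

definition kneading_sequence :: "'a::t2_space set \<Rightarrow> ('a \<Rightarrow> 'a) \<Rightarrow> 'a \<Rightarrow> nat \<Rightarrow> symbol" where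
  "kneading_sequence T f c = itinerary T f c (f c)"

text \<open>The infimum of the empty set is \<open>\<infinity>\<close>.\<close>

definition rho :: "(nat \<Rightarrow> symbol) \<Rightarrow> nat \<Rightarrow> enat" where
  "rho \<nu> n = (INF k\<in>{k. k > n \<and> \<nu> k \<noteq> \<nu> (k - n)}. enat k)"

inductive_set rho_orbit :: "(nat \<Rightarrow> symbol) \<Rightarrow> nat \<Rightarrow> nat set"
  for \<nu> :: "nat \<Rightarrow> symbol" and k :: nat where
  start: "k \<in> rho_orbit \<nu> k"
| step: "j \<in> rho_orbit \<nu> k \<Longrightarrow> rho \<nu> j = enat l \<Longrightarrow> l \<in> rho_orbit \<nu> k"

definition internal_address :: "(nat \<Rightarrow> symbol) \<Rightarrow> nat set" where
  "internal_address \<nu> = rho_orbit \<nu> 1"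

text \<open>
  The number \<open>q(m)\<close>, meaningful only for \<open>m \<ge> 1\<close> and \<open>rho \<nu> m \<noteq> \<infinity>\<close>. Both the subtraction and
  the division are then exact, as \<open>r \<le> m < \<rho>(m)\<close> and \<open>r\<close> is congruent to \<open>\<rho>(m)\<close> modulo \<open>m\<close>.
\<close>

definition q_num :: "(nat \<Rightarrow> symbol) \<Rightarrow> nat \<Rightarrow> nat" where
  "q_num \<nu> m =
    (let p = the_enat (rho \<nu> m);
         r = (THE r. r \<in> {1..m} \<and> r mod m = p mod m)
     in if m \<in> rho_orbit \<nu> r then (p - r) div m + 1 else (p - r) div m + 2)"

end

theory Submission
  imports Defs
begin

text \<open>
  Seen from a periodic branch point, a point of the critical orbit is a leg; whenever the critical
  point lies between the two, the leg may be cut off there without changing its direction, so that it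
  restarts at the critical value. Hence local arms move like legs, and the legs are governed by
  the \<open>\<rho>\<close>-function alone. For an entry \<open>m\<close> of the internal address, let \<open>\<tau>\<close> be the periodic
  continuation of \<open>\<nu>\<^sub>1 \<dots> \<nu>\<^sub>m\<close>. A leg that starts at the critical value returns to it for the first
  time after exactly \<open>q(m)\<close> periods, and two legs that start in different periods modulo \<open>q(m)\<close> are
  never cut at the same time. Therefore the center of a tripod spanned by three such legs has
  itinerary \<open>\<tau>\<close>, by majority vote. By expansivity there is only one branch point with this itinerary.
  So if \<open>q(m) \<ge> 3\<close>, the center is the desired branch point, and at a tame branch point \<open>z\<close> with
  itinerary \<open>\<tau>\<close>, two such legs lie in different arms, as they would otherwise span a tripod with \<open>z\<close>
  whose center is another branch point with itinerary \<open>\<tau>\<close>.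

  A tame orbit contains a characteristic point, which separates the critical value from the critical
  point and from the rest of the orbit. If its itinerary did not start with \<open>\<nu>\<^sub>1 \<dots> \<nu>\<^sub>m\<close>, the two arms
  towards the critical point and the critical value would form an invariant set; if \<open>m\<close> did not belong
  to the internal address, the arm towards the critical point would be fixed.
\<close>

subsection \<open>The \<open>\<rho>\<close>-function\<close>

text \<open>Write \<rho>(m) = a m + r with 1 \<le> r \<le> m. The leg that starts at the critical
  value is cut for the first time at \<rho>(m), after r steps of a period. It returns at the end of
  that period exactly if m lies in the \<rho>-orbit of r; otherwise it has to return at the end of
  the next one. Hence the two cases of q(m). If the first chance is missed, the leg found there has
  some index l, and \<open>\<nu>\<^sub>1 \<dots> \<nu>\<^sub>m\<close> ends with its own first l
  symbols. That such a border forces a cut one period later is a property of the word. As the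
  critical orbit of T need not have period m, it is proved in a formal tree: its points are the
  indices 1, ..., m, and a direction is the side of the critical point on which a leg finally
  arrives. The formal critical value is an endpoint, and membership of m in the internal address
  means that its only direction does not arrive on the side \<open>\<nu>\<^sub>m\<close>.\<close>

lemma rho_eq_enat_iff:
  "rho \<nu> n = enat l \<longleftrightarrow> n < l \<and> \<nu> l \<noteq> \<nu> (l - n) \<and> (\<forall>j. n < j \<and> j < l \<longrightarrow> \<nu> j = \<nu> (j - n))"
proof
  let ?S = "{k. k > n \<and> \<nu> k \<noteq> \<nu> (k - n)}"
  assume A: "rho \<nu> n = enat l"
  have ne: "?S \<noteq> {}"
  proof
    assume "?S = {}"
    then have "rho \<nu> n = Inf {}" unfolding rho_def by (metis image_empty)
    with A show False by (simp add: Inf_enat_def)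
  qed
  then have "Inf (enat ` ?S) \<in> enat ` ?S"
    by (metis (no_types, lifting) Inf_enat_def LeastI equals0I image_eqI image_is_empty)
  then have l: "l \<in> ?S" using A unfolding rho_def by auto
  have "l \<le> j" if "j \<in> ?S" for j
  proof -
    have "rho \<nu> n \<le> enat j" unfolding rho_def using that by (intro INF_lower) auto
    then show ?thesis using A by simp
  qed
  with l show "n < l \<and> \<nu> l \<noteq> \<nu> (l - n) \<and> (\<forall>j. n < j \<and> j < l \<longrightarrow> \<nu> j = \<nu> (j - n))"
    by (auto simp: not_le[symmetric])
next
  assume A: "n < l \<and> \<nu> l \<noteq> \<nu> (l - n) \<and> (\<forall>j. n < j \<and> j < l \<longrightarrow> \<nu> j = \<nu> (j - n))"
  show "rho \<nu> n = enat l"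
    unfolding rho_def
  proof (rule antisym)
    show "(INF k\<in>{k. n < k \<and> \<nu> k \<noteq> \<nu> (k - n)}. enat k) \<le> enat l"
      using A by (intro INF_lower) auto
    show "enat l \<le> (INF k\<in>{k. n < k \<and> \<nu> k \<noteq> \<nu> (k - n)}. enat k)"
    proof (intro INF_greatest)
      fix k assume "k \<in> {k. n < k \<and> \<nu> k \<noteq> \<nu> (k - n)}"
      then show "enat l \<le> enat k" using A by (auto simp: not_le[symmetric])
    qed
  qed
qed

subsection \<open>Chopped legs\<close>

text \<open>
  A leg is a point of the critical orbit that is watched from a reference point with itinerary
  \<open>\<tau>\<close>. It is encoded by the number \<open>x\<close> for which it equals \<open>f\<^sup>x(c\<^sub>1)\<close>, so that its symbol is
  \<open>\<nu> (x + 1)\<close>. As soon as the critical point separates the leg from the reference point, the leg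
  is cut off at the critical point, and its image is \<open>c\<^sub>1\<close>. The direction of the leg, as seen from the
  reference point, is not affected by the cut.
\<close>

primrec run :: "(nat \<Rightarrow> symbol) \<Rightarrow> (nat \<Rightarrow> symbol) \<Rightarrow> nat \<Rightarrow> nat \<Rightarrow> nat \<Rightarrow> nat" where
  "run \<nu> \<tau> t x 0 = x"
| "run \<nu> \<tau> t x (Suc n) =
     (if \<nu> (Suc (run \<nu> \<tau> t x n)) = \<tau> (Suc (t + n)) then Suc (run \<nu> \<tau> t x n) else 0)"

lemma run_add: "run \<nu> \<tau> t x (a + b) = run \<nu> \<tau> (t + a) (run \<nu> \<tau> t x a) b"
  by (induction b) (auto simp: add.assoc)

lemma run_le: "run \<nu> \<tau> t x n \<le> x + n"
  by (induction n) auto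

lemma run_cong:
  assumes "\<And>j. t < j \<Longrightarrow> j \<le> t + n \<Longrightarrow> \<tau> j = \<tau>' j"
    and "\<And>j. 0 < j \<Longrightarrow> j \<le> x + n \<Longrightarrow> \<nu> j = \<nu>' j"
  shows "run \<nu> \<tau> t x n = run \<nu>' \<tau>' t x n"
  using assms
proof (induction n)
  case (Suc n)
  have "run \<nu> \<tau> t x n \<le> x + n" by (rule run_le)
  moreover have "run \<nu> \<tau> t x n = run \<nu>' \<tau>' t x n" using Suc by auto
  ultimately show ?case using Suc.prems by auto
qed simp

lemma run_shift:
  assumes "\<And>j. t < j \<Longrightarrow> \<tau> (j + d) = \<tau> j"
  shows "run \<nu> \<tau> (t + d) x n = run \<nu> \<tau> t x n"
proof (induction n)
  case (Suc n)
  have "\<tau> (Suc (t + d + n)) = \<tau> (Suc (t + n))"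
    using assms[of "Suc (t + n)"] by (simp add: ac_simps)
  then show ?case using Suc by simp
qed simp

lemma run_agree:
  assumes "\<And>j. 0 < j \<Longrightarrow> j \<le> n \<Longrightarrow> \<nu> (x + j) = \<tau> (t + j)"
  shows "run \<nu> \<tau> t x n = x + n"
  using assms
proof (induction n)
  case (Suc n)
  then have "run \<nu> \<tau> t x n = x + n" by simp
  then show ?case using Suc.prems[of "Suc n"] by simp
qed simp

text \<open>\<open>i + n - y n\<close> is the time of the last cut, or \<open>i\<close> if there was
  none. From a cut at time \<open>j\<close> on, \<open>\<nu>\<close> is compared with its shift by
  \<open>j\<close>, so the next cut occurs at the first disagreement, which is
  \<open>rho \<nu> j\<close>.\<close>

lemma run_in_rho_orbit:
  fixes \<nu> :: "nat \<Rightarrow> symbol" and i n :: nat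
  defines "y \<equiv> \<lambda>n. run \<nu> \<nu> i 0 n"
  shows "i + n - y n \<in> rho_orbit \<nu> i \<and>
         (\<forall>j. i + n - y n < j \<and> j \<le> i + n \<longrightarrow> \<nu> j = \<nu> (j - (i + n - y n)))"
proof (induction n)
  case 0
  show ?case by (auto simp: y_def rho_orbit.start)
next
  case (Suc n)
  have le: "y n \<le> n" using run_le[of \<nu> \<nu> i 0 n] by (simp add: y_def)
  show ?case
  proof (cases "\<nu> (Suc (y n)) = \<nu> (Suc (i + n))")
    case True
    then have y: "y (Suc n) = Suc (y n)" by (simp add: y_def)
    have "\<nu> j = \<nu> (j - (i + n - y n))" if "i + n - y n < j" "j \<le> i + Suc n" for j
    proof (cases "j = Suc (i + n)")
      case True
      then have "j - (i + n - y n) = Suc (y n)" using le by simp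
      then show ?thesis using \<open>\<nu> (Suc (y n)) = \<nu> (Suc (i + n))\<close> True by simp
    next
      case False
      then show ?thesis using Suc that by simp
    qed
    then show ?thesis using Suc y by simp
  next
    case False
    then have y: "y (Suc n) = 0" by (simp add: y_def)
    have "rho \<nu> (i + n - y n) = enat (Suc (i + n))"
      unfolding rho_eq_enat_iff
    proof (intro conjI allI impI)
      have "Suc (i + n) - (i + n - y n) = Suc (y n)" using le by simp
      then show "\<nu> (Suc (i + n)) \<noteq> \<nu> (Suc (i + n) - (i + n - y n))" using False by simp
    qed (use Suc in auto)
    then have "Suc (i + n) \<in> rho_orbit \<nu> i" using Suc rho_orbit.step by blast
    then show ?thesis using y by auto
  qed
qed

text \<open>Conversely, a leg cut at time \<open>j\<close> agrees with the reference sequence until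
  just before \<open>rho \<nu> j\<close>, so every element of the \<rho>-orbit is the time of a
  cut.\<close>

lemma run_zero_if_rho_orbit:
  assumes "j \<in> rho_orbit \<nu> i"
  shows "i \<le> j \<and> run \<nu> \<nu> i 0 (j - i) = 0"
  using assms
proof induction
  case (step j l)
  then have l: "j < l" "\<nu> l \<noteq> \<nu> (l - j)" "\<And>k. j < k \<Longrightarrow> k < l \<Longrightarrow> \<nu> k = \<nu> (k - j)"
    by (auto simp: rho_eq_enat_iff)
  obtain n where n: "l = Suc (j + n)" using l(1) less_iff_Suc_add by blast
  have "run \<nu> \<nu> i 0 ((j - i) + Suc n) = run \<nu> \<nu> j 0 (Suc n)"
    unfolding run_add using step by simp
  also have "\<dots> = 0"
  proof -
    have "\<nu> p = \<nu> (j + p)" if "0 < p" "p \<le> n" for p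
      using l(3)[of "j + p"] that n by simp
    then have "run \<nu> \<nu> j 0 n = n" by (subst run_agree) auto
    then show ?thesis using l(2) n by auto
  qed
  also have "(j - i) + Suc n = l - i" using step by (simp add: n Suc_diff_le)
  finally show ?case using step n by simp
qed simp

lemma rho_orbit_iff_run:
  "i \<le> m \<Longrightarrow> m \<in> rho_orbit \<nu> i \<longleftrightarrow> run \<nu> \<nu> i 0 (m - i) = 0"
  using run_in_rho_orbit[of i "m - i" \<nu>] run_zero_if_rho_orbit[of m \<nu> i] by auto

text \<open>
  Formal directions in the tree whose critical orbit is periodic with period \<open>m\<close> and whose kneading
  sequence is \<open>\<nu>\<^sub>1 \<dots> \<nu>\<^sub>m\<^sub>-\<^sub>1\<star>\<close>, repeated: \<open>dirn \<nu> m (m - i) j\<close> is the side of the critical point on which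
  the leg \<open>c\<^sub>j\<close>, watched from \<open>c\<^sub>i\<close>, arrives when \<open>c\<^sub>i\<close> arrives at the critical point \<open>c\<^sub>m\<close>.
\<close>

primrec dirn :: "(nat \<Rightarrow> symbol) \<Rightarrow> nat \<Rightarrow> nat \<Rightarrow> nat \<Rightarrow> symbol" where
  "dirn \<nu> m 0 j = \<nu> j"
| "dirn \<nu> m (Suc n) j =
     (if j < m \<and> \<nu> (m - Suc n) = \<nu> j then dirn \<nu> m n (Suc j) else dirn \<nu> m n 1)"

section \<open>Directions in the formal tree of an internal address entry\<close>

locale address_entry =
  fixes \<nu> :: "nat \<Rightarrow> symbol" and m :: nat
  assumes entry: "m \<in> internal_address \<nu>"
begin

definition D :: "nat \<Rightarrow> nat \<Rightarrow> symbol" where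
  "D i j = dirn \<nu> m (m - i) j"

lemma D_end: "D m j = \<nu> j"
  by (simp add: D_def)

text \<open>A leg that ends at \<open>c_m\<close>, the formal critical point, has the image
  \<open>c_1\<close> just like a leg that is cut; hence \<open>j = m\<close> falls under the second
  case.\<close>

lemma D_step:
  assumes "i < m"
  shows "D i j = (if j < m \<and> \<nu> i = \<nu> j then D (Suc i) (Suc j) else D (Suc i) 1)"
proof -
  have "m - i = Suc (m - Suc i)" "m - Suc (m - Suc i) = i" using assms by auto
  then show ?thesis unfolding D_def by (metis dirn.simps(2))
qed

text \<open>Of three formal points, at most one lies between the other two.\<close>

lemma D_between:
  assumes "{a, b, e} \<subseteq> {1..m}" "a \<noteq> b" "e \<noteq> b" "a \<noteq> e" "D b a \<noteq> D b e"
  shows "D a b = D a e"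
  using assms
proof (induction "m - b" arbitrary: a b e)
  case 0
  then have "b = m" "a < m" "e < m" by auto
  with 0 show ?case using D_step[of a b] D_step[of a e] by (auto simp: D_end)
next
  case (Suc n)
  then have b: "b < m" by auto
  have n: "n = m - Suc b" using Suc by simp
  show ?case
  proof (cases "a = m")
    case True
    then show ?thesis
      using Suc.prems D_step[OF b, of a] D_step[OF b, of e] by (auto simp: D_end split: if_splits)
  next
    case False
    then have a: "a < m" using Suc.prems by auto
    \<comment> \<open>If the critical point separates \<open>a\<close> from \<open>b\<close>, it
      does not separate \<open>b\<close> from \<open>e\<close>, since otherwise both legs at
      \<open>b\<close> would be cut; so \<open>a\<close> sees \<open>b\<close> and \<open>e\<close>
      behind the critical point. If not, all indices move on by one, where \<open>e\<close> is
      replaced by 1 if its leg is cut.\<close>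
    show ?thesis
    proof (cases "\<nu> a = \<nu> b")
      case False
      then have "D b a = D (Suc b) 1" using D_step[OF b, of a] by simp
      then have "\<nu> e = \<nu> b" using D_step[OF b, of e] Suc.prems by (auto split: if_splits)
      then show ?thesis using D_step[OF a, of b] D_step[OF a, of e] False by simp
    next
      case True
      then have ba: "D b a = D (Suc b) (Suc a)" "D a b = D (Suc a) (Suc b)"
        using D_step[OF b, of a] D_step[OF a, of b] a b by auto
      show ?thesis
      proof (cases "e < m \<and> \<nu> b = \<nu> e")
        case t: True
        then have be: "D b e = D (Suc b) (Suc e)" "D a e = D (Suc a) (Suc e)"
          using D_step[OF b, of e] D_step[OF a, of e] True by auto
        have "D (Suc a) (Suc b) = D (Suc a) (Suc e)"
          using Suc.prems t a b ba be by (intro Suc.hyps(1)[OF n]) auto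
        then show ?thesis using ba be by simp
      next
        case f: False
        then have be: "D b e = D (Suc b) 1" "D a e = D (Suc a) 1"
          using D_step[OF b, of e] D_step[OF a, of e] True by auto
        have "D (Suc a) (Suc b) = D (Suc a) 1"
          using Suc.prems a b ba be by (intro Suc.hyps(1)[OF n]) auto
        then show ?thesis using ba be by simp
      qed
    qed
  qed
qed

text \<open>The image \<open>s k\<close> of a leg to \<open>c_k\<close> has at
  \<open>c_(i+1)\<close> the same formal direction as \<open>c_k\<close> at \<open>c_i\<close>, so
  different directions remain different.\<close>

lemma D_differ_step:
  assumes "i < m" "D i j \<noteq> D i l" "{j, l} \<subseteq> {1..m} - {i}" "1 \<le> i"
  shows "\<exists>j' l'. {j', l'} \<subseteq> {1..m} - {Suc i} \<and> D (Suc i) j' \<noteq> D (Suc i) l'"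
proof -
  define s where "s = (\<lambda>j. if j < m \<and> \<nu> i = \<nu> j then Suc j else 1)"
  have "D i k = D (Suc i) (s k)" for k using D_step[OF assms(1)] by (auto simp: s_def)
  moreover have "s k \<in> {1..m} - {Suc i}" if "k \<in> {1..m} - {i}" for k
    using that assms by (auto simp: s_def)
  ultimately show ?thesis using assms(2,3) by (metis insert_subset empty_subsetI)
qed

text \<open>Take 1 as a root; \<open>below y\<close> collects the points between the root and
  \<open>y\<close>. If \<open>y\<close> has the largest number of them and still a direction other
  than that of the root, then a point in this direction has \<open>y\<close> below it in
  addition.\<close>

lemma D_has_endpoint:
  assumes "2 \<le> m"
  shows "\<exists>i\<in>{1..m}. \<forall>j\<in>{1..m} - {i}. \<forall>l\<in>{1..m} - {i}. D i j = D i l"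
proof (rule ccontr)
  assume "\<not> ?thesis"
  then have N: "\<And>i. i \<in> {1..m} \<Longrightarrow> \<exists>j\<in>{1..m} - {i}. \<exists>l\<in>{1..m} - {i}. D i j \<noteq> D i l" by blast
  define below where "below = (\<lambda>y. {x \<in> {1..m}. x \<noteq> 1 \<and> x \<noteq> y \<and> y \<noteq> 1 \<and> D x 1 \<noteq> D x y})"
  have "Max ((card \<circ> below) ` {2..m}) \<in> (card \<circ> below) ` {2..m}"
    using assms by (intro Max_in) auto
  then obtain y where y: "y \<in> {2..m}" "card (below y) = Max ((card \<circ> below) ` {2..m})" by auto
  have y_max: "card (below z) \<le> card (below y)" if "z \<in> {2..m}" for z
    unfolding y(2) using that by (intro Max_ge) auto
  have "y \<in> {1..m}" "y \<noteq> 1" using y by auto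
  then have "\<exists>z\<in>{1..m} - {y}. D y z \<noteq> D y 1" using N[of y] by metis
  then obtain z where z: "z \<in> {1..m}" "z \<noteq> y" "D y 1 \<noteq> D y z" "z \<noteq> 1" by force
  have sub: "x \<in> below z" if "x \<in> below y" for x
  proof -
    have x: "x \<in> {1..m}" "x \<noteq> 1" "x \<noteq> y" "y \<noteq> 1" "D x 1 \<noteq> D x y" using that by (auto simp: below_def)
    have yx: "D y 1 = D y x"
      using D_between[of 1 x y] D_between[of y x 1] x y z by auto
    then have zx: "z \<noteq> x" using z by auto
    have "D y x \<noteq> D y z" using yx z by simp
    then have "D x y = D x z" using D_between[of x y z] x y z zx by auto
    then show ?thesis using x zx z by (auto simp: below_def)
  qed
  have "y \<in> below z" "y \<notin> below y" using y z by (auto simp: below_def)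
  then have "below y \<subset> below z" using sub by (metis psubsetI subsetI)
  moreover have "finite (below z)" by (auto simp: below_def)
  ultimately have "card (below y) < card (below z)" by (simp add: psubset_card_mono)
  moreover have "z \<in> {2..m}" using z by auto
  ultimately show False using y_max[of z] by simp
qed

text \<open>The formal critical value is an endpoint: the number of directions does not decrease along the
  critical orbit from \<open>c\<^sub>1\<close> to \<open>c\<^sub>m\<close>, and some point of it is an endpoint.\<close>

lemma D_one_const:
  assumes "j \<in> {2..m}" "l \<in> {2..m}"
  shows "D 1 j = D 1 l"
proof (rule ccontr)
  assume N: "D 1 j \<noteq> D 1 l"
  have "i \<in> {1..m} \<Longrightarrow> \<exists>j l. {j, l} \<subseteq> {1..m} - {i} \<and> D i j \<noteq> D i l" for i
  proof (induction i)
    case (Suc i)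
    show ?case
    proof (cases "i = 0")
      case True
      then show ?thesis using N assms by (intro exI[of _ j] exI[of _ l]) auto
    next
      case False
      then have "i \<in> {1..m}" using Suc.prems by simp
      then obtain j l where "{j, l} \<subseteq> {1..m} - {i}" "D i j \<noteq> D i l" using Suc.IH by blast
      then show ?thesis using D_differ_step[of i j l] Suc.prems \<open>i \<in> {1..m}\<close> by simp
    qed
  qed simp
  moreover have "2 \<le> m" using assms(1) by simp
  then obtain i where i: "i \<in> {1..m}" "\<forall>j\<in>{1..m} - {i}. \<forall>l\<in>{1..m} - {i}. D i j = D i l"
    using D_has_endpoint by blast
  ultimately obtain j l where "{j, l} \<subseteq> {1..m} - {i}" "D i j \<noteq> D i l" by blast
  then show False using i(2) by simp
qed

text \<open>For \<open>j < i\<close> the leg stays behind the reference point, which is thus the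
  first to reach the critical point. The case \<open>j = m\<close> of the formal map never occurs,
  and formal legs are runs along \<open>\<nu>\<close>.\<close>

lemma D_eq_run:
  assumes "1 \<le> j" "j < i" "i \<le> m"
  shows "D i j = \<nu> (Suc (run \<nu> \<nu> (i - 1) (j - 1) (m - i)))"
  using assms
proof (induction "m - i" arbitrary: i j)
  case 0
  then have i: "i = m" by simp
  show ?case using 0(2) unfolding i by (simp add: D_end)
next
  case (Suc n)
  have im: "i < m" "m - i = 1 + (m - Suc i)" using Suc by auto
  have "run \<nu> \<nu> (i - 1) (j - 1) (m - i) = run \<nu> \<nu> i (run \<nu> \<nu> (i - 1) (j - 1) 1) (m - Suc i)"
    unfolding im(2) run_add using Suc.prems by simp
  moreover have "run \<nu> \<nu> (i - 1) (j - 1) 1 = (if \<nu> i = \<nu> j then j else 0)"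
    using Suc.prems by simp
  moreover have "D i j = (if \<nu> i = \<nu> j then D (Suc i) (Suc j) else D (Suc i) 1)"
    using D_step[OF im(1), of j] Suc.prems im by simp
  moreover have "D (Suc i) (Suc j) = \<nu> (Suc (run \<nu> \<nu> i j (m - Suc i)))"
    using Suc.hyps(1)[of "Suc i" "Suc j"] Suc.hyps(2) Suc.prems im by simp
  moreover have "D (Suc i) 1 = \<nu> (Suc (run \<nu> \<nu> i 0 (m - Suc i)))"
    using Suc.hyps(1)[of "Suc i" 1] Suc.hyps(2) Suc.prems im by simp
  ultimately show ?case by simp
qed

lemma entry_pos: "1 \<le> m"
  using entry run_zero_if_rho_orbit unfolding internal_address_def by blast

text \<open>The formal critical value being an endpoint, \<open>D 1 j\<close> is the direction of
  \<open>c_m\<close>, which one step later is a leg that starts at \<open>c_1\<close> at time 1. As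
  \<open>m\<close> lies in the \<rho>-orbit of 1, this leg is cut at time \<open>m\<close>, where
  its symbol must differ from \<open>\<nu> m\<close>.\<close>

lemma D_one_neq:
  assumes "j \<in> {2..m}"
  shows "D 1 j \<noteq> \<nu> m"
proof -
  have m2: "2 \<le> m" using assms by auto
  have "D 1 j = D 1 m" using assms m2 by (intro D_one_const) auto
  also have "\<dots> = D 2 1" using D_step[of 1 m] m2 by (simp add: numeral_2_eq_2)
  also have "\<dots> = \<nu> (Suc (run \<nu> \<nu> 1 0 (m - 2)))" using D_eq_run[of 1 2] m2 by simp
  finally have D1: "D 1 j = \<nu> (Suc (run \<nu> \<nu> 1 0 (m - 2)))" .
  have "run \<nu> \<nu> 1 0 (m - 1) = 0"
    using run_zero_if_rho_orbit[of m \<nu> 1] entry unfolding internal_address_def by simp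
  moreover have "m - 1 = Suc (m - 2)" using m2 by simp
  ultimately have "run \<nu> \<nu> 1 0 (Suc (m - 2)) = 0" by simp
  then have "\<nu> (Suc (run \<nu> \<nu> 1 0 (m - 2))) \<noteq> \<nu> (Suc (1 + (m - 2)))"
    unfolding run.simps(2) by (auto split: if_splits)
  moreover have "Suc (1 + (m - 2)) = m" using m2 by simp
  ultimately show ?thesis using D1 by simp
qed

text \<open>By hypothesis the word ends with its own first \<open>l\<close> symbols. Without a
  mismatch, the leg from \<open>c_1\<close> to \<open>c_(l+1)\<close> would remain uncut until its
  end reaches \<open>c_m\<close>; restarted at \<open>c_1\<close>, it would follow the border and
  arrive on the side \<open>\<nu> l = \<nu> m\<close>, against \<open>D_one_neq\<close>.\<close>

lemma border_mismatch:
  assumes l: "1 \<le> l" "l < m" and per: "\<And>j. m - l < j \<Longrightarrow> j \<le> m \<Longrightarrow> \<nu> j = \<nu> (j - (m - l))"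
  obtains i where "1 \<le> i" "i < m - l" "\<nu> (l + i) \<noteq> \<nu> i" "\<forall>j. 1 \<le> j \<and> j < i \<longrightarrow> \<nu> (l + j) = \<nu> j"
proof -
  let ?n = "m - l"
  have shift: "D i j = D (i + d) (j + d)"
    if "\<And>k. k < d \<Longrightarrow> \<nu> (i + k) = \<nu> (j + k)" "i + d \<le> m" "j + d \<le> m" for i j d
    using that
  proof (induction d)
    case (Suc d)
    then have "D i j = D (i + d) (j + d)" by simp
    also have "\<dots> = D (i + Suc d) (j + Suc d)" using D_step[of "i + d" "j + d"] Suc.prems by simp
    finally show ?case .
  qed simp
  have "\<exists>i. 1 \<le> i \<and> i < ?n \<and> \<nu> (l + i) \<noteq> \<nu> i"
  proof (rule ccontr)
    assume "\<not> ?thesis"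
    then have eq: "\<And>i. 1 \<le> i \<Longrightarrow> i < ?n \<Longrightarrow> \<nu> (l + i) = \<nu> i" by blast
    have "D 1 (1 + l) = D (1 + (?n - 1)) (1 + l + (?n - 1))"
    proof (rule shift)
      fix k assume "k < ?n - 1"
      then show "\<nu> (1 + k) = \<nu> (1 + l + k)" using eq[of "Suc k"] by (simp add: add.commute)
    qed (use l in auto)
    also have "\<dots> = D ?n m" using l by (simp add: Suc_diff_Suc)
    also have "\<dots> = D (Suc ?n) 1" using D_step[of ?n m] l by simp
    also have "\<dots> = D (Suc ?n + (l - 1)) (1 + (l - 1))"
    proof (rule shift)
      fix k assume "k < l - 1"
      then show "\<nu> (Suc ?n + k) = \<nu> (1 + k)" using per[of "Suc ?n + k"] l by simp
    qed (use l in auto)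
    also have "\<dots> = \<nu> l" using l by (simp add: D_end)
    also have "\<dots> = \<nu> m" using per[of m] l by simp
    finally show False using D_one_neq[of "1 + l"] l by simp
  qed
  then obtain i0 where i0: "1 \<le> i0 \<and> i0 < ?n \<and> \<nu> (l + i0) \<noteq> \<nu> i0" by blast
  define i where "i = (LEAST i. 1 \<le> i \<and> i < ?n \<and> \<nu> (l + i) \<noteq> \<nu> i)"
  have i: "1 \<le> i \<and> i < ?n \<and> \<nu> (l + i) \<noteq> \<nu> i" unfolding i_def using i0 by (rule LeastI)
  moreover have "\<nu> (l + j) = \<nu> j" if "1 \<le> j" "j < i" for j
    using not_less_Least[of j "\<lambda>i. 1 \<le> i \<and> i < ?n \<and> \<nu> (l + i) \<noteq> \<nu> i"] that i
    unfolding i_def[symmetric] by simp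
  ultimately show ?thesis by (intro that[of i] allI impI) simp_all
qed

text \<open>After the cut at the first mismatch, the leg represents the formal direction of
  \<open>c_(l+1)\<close> at \<open>c_1\<close>. This does not arrive on the side
  \<open>\<nu> m\<close>, so the leg is cut in the last step.\<close>

lemma run_border:
  assumes l: "1 \<le> l" "l < m" and per: "\<And>j. m - l < j \<Longrightarrow> j \<le> m \<Longrightarrow> \<nu> j = \<nu> (j - (m - l))"
  shows "run \<nu> \<nu> 0 l m = 0"
proof -
  obtain i where i: "1 \<le> i" "i < m - l" "\<nu> (l + i) \<noteq> \<nu> i"
    "\<forall>j. 1 \<le> j \<and> j < i \<longrightarrow> \<nu> (l + j) = \<nu> j"
    by (rule border_mismatch[OF assms])
  have shift: "k < i \<Longrightarrow> D 1 (1 + l) = D (1 + k) (1 + l + k)" for k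
  proof (induction k)
    case (Suc k)
    then have "D 1 (1 + l) = D (1 + k) (1 + l + k)" by simp
    moreover have "1 + l + k < m" using Suc.prems i(2) by simp
    then have "D (1 + k) (1 + l + k) = D (1 + Suc k) (1 + l + Suc k)"
      using D_step[of "1 + k" "1 + l + k"] Suc.prems i(2) i(4)[rule_format, of "1 + k"] l by (simp add: add_ac)
    ultimately show ?case by simp
  qed simp
  have "D 1 (1 + l) = D i (l + i)" using shift[of "i - 1"] i(1) by (simp add: add.commute)
  also have "\<dots> = D (Suc i) 1" using D_step[of i "l + i"] i by (auto simp: eq_commute)
  also have "\<dots> = \<nu> (Suc (run \<nu> \<nu> i 0 (m - Suc i)))" using D_eq_run[of 1 "Suc i"] i by simp
  finally have neq: "\<nu> (Suc (run \<nu> \<nu> i 0 (m - Suc i))) \<noteq> \<nu> m" using D_one_neq[of "1 + l"] l by simp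
  have "run \<nu> \<nu> 0 l (i - 1) = l + (i - 1)" using i by (intro run_agree) auto
  moreover have "Suc (l + (i - 1)) = l + i" "Suc (i - 1) = i" using i(1) by auto
  ultimately have "run \<nu> \<nu> 0 l (Suc (i - 1)) = 0" using i(3) unfolding run.simps(2) by auto
  then have z: "run \<nu> \<nu> 0 l i = 0" using i(1) by simp
  have "run \<nu> \<nu> 0 l (i + Suc (m - Suc i)) = run \<nu> \<nu> i 0 (Suc (m - Suc i))"
    unfolding run_add z by simp
  also have "\<dots> = 0" using neq i by auto
  finally show ?thesis using i by simp
qed

section \<open>Periodic continuation and returns to the critical value\<close>

definition per :: "nat \<Rightarrow> symbol" where
  "per j = \<nu> (Suc ((j - 1) mod m))"

lemma per_initial: "1 \<le> j \<Longrightarrow> j \<le> m \<Longrightarrow> per j = \<nu> j"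
  by (simp add: per_def)

lemma per_add: "1 \<le> j \<Longrightarrow> per (j + m) = per j"
  unfolding per_def by (metis Nat.diff_add_assoc2 mod_add_self2)

lemma per_add_mult: "1 \<le> j \<Longrightarrow> per (j + q * m) = per j"
proof (induction q)
  case (Suc q)
  have "per (j + Suc q * m) = per ((j + q * m) + m)" by (simp add: ac_simps)
  also have "\<dots> = per (j + q * m)" using Suc by (intro per_add) simp
  finally show ?case using Suc by simp
qed simp

lemma run_per_initial: "t + n \<le> m \<Longrightarrow> run \<nu> per t x n = run \<nu> \<nu> t x n"
  by (rule run_cong) (auto simp: per_initial)

lemma run_per_shift: "run \<nu> per (t + q * m) x n = run \<nu> per t x n"
  by (rule run_shift) (simp add: per_add_mult)

text \<open>A leg with index \<open>l > 0\<close> at the end of the period was last cut, or started,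
  \<open>l\<close> steps before. Hence the last \<open>l\<close> symbols of the word repeat the
  first \<open>l\<close>, and \<open>run_border\<close> applies to the next period.\<close>

lemma run_returns:
  assumes i: "1 \<le> i" "i \<le> m"
  shows "run \<nu> per i 0 (m - i) = 0 \<or> run \<nu> per i 0 (m - i + m) = 0"
proof (cases "run \<nu> per i 0 (m - i) = 0")
  case False
  define l where "l = run \<nu> \<nu> i 0 (m - i)"
  have l: "l = run \<nu> per i 0 (m - i)" using i by (simp add: l_def run_per_initial)
  have "l \<le> m - i" unfolding l_def using run_le[of \<nu> \<nu> i 0 "m - i"] by simp
  then have lm: "1 \<le> l" "l < m" using False l i by auto
  have "\<nu> j = \<nu> (j - (m - l))" if "m - l < j" "j \<le> m" for j
    using run_in_rho_orbit[of i "m - i" \<nu>] that i unfolding l_def[symmetric] by simp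
  then have z: "run \<nu> \<nu> 0 l m = 0" using run_border lm by blast
  have "run \<nu> per i 0 (m - i + m) = run \<nu> per m l m"
    unfolding run_add using l i by simp
  also have "\<dots> = run \<nu> per 0 l m" using run_per_shift[of 0 1 l m] by simp
  also have "\<dots> = 0" using z by (simp add: run_per_initial)
  finally show ?thesis by simp
qed simp

text \<open>A proper power of a word of length \<open>d\<close> has a border of length
  \<open>m - d\<close>, whose mismatch contradicts the period \<open>d\<close>. This later fixes the
  exact period of the constructed branch point.\<close>

lemma entry_primitive:
  assumes "0 < d" "d dvd m" and per: "\<And>j. d < j \<Longrightarrow> j \<le> m \<Longrightarrow> \<nu> j = \<nu> (j - d)"
  shows "d = m"
proof (rule ccontr)
  assume "d \<noteq> m"
  then have dm: "d < m" using assms entry_pos by (meson dvd_imp_le le_neq_implies_less less_le_trans zero_less_one)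
  then obtain q where q: "m = d * q" using assms by (auto elim: dvdE)
  define l where "l = m - d"
  have l: "1 \<le> l" "l < m" "m - l = d" using dm assms by (auto simp: l_def)
  obtain i where i: "1 \<le> i" "i < d" "\<nu> (l + i) \<noteq> \<nu> i"
    using border_mismatch[of l] l per by metis
  have "\<nu> (k * d + i) = \<nu> i" if "k * d + i \<le> m" for k
    using that
  proof (induction k)
    case (Suc k)
    have "\<nu> (Suc k * d + i) = \<nu> (Suc k * d + i - d)" using Suc.prems i by (intro per) auto
    then show ?case using Suc by simp
  qed simp
  moreover have "l = (q - 1) * d" using q by (simp add: l_def diff_mult_distrib2 mult.commute)
  moreover have "l + i \<le> m" using i dm by (simp add: l_def)
  ultimately show False using i(3) by simp
qed

end

section \<open>First return of the leg that starts at the critical value\<close>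

locale address_entry_finite = address_entry +
  fixes k :: nat
  assumes rho_entry: "rho \<nu> m = enat k"
begin

abbreviation R :: "nat \<Rightarrow> nat" where
  "R t \<equiv> run \<nu> per 0 0 t"

lemma k_gt: "m < k" and k_mismatch: "\<nu> k \<noteq> per k"
  and agree_below: "\<And>j. 1 \<le> j \<Longrightarrow> j < k \<Longrightarrow> \<nu> j = per j"
proof -
  have A: "m < k" "\<nu> k \<noteq> \<nu> (k - m)" "\<And>j. m < j \<Longrightarrow> j < k \<Longrightarrow> \<nu> j = \<nu> (j - m)"
    using rho_entry by (auto simp: rho_eq_enat_iff)
  show "m < k" by fact
  show B: "\<nu> j = per j" if "1 \<le> j" "j < k" for j
    using that
  proof (induction j rule: less_induct)
    case (less j)
    show ?case
    proof (cases "j \<le> m")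
      case False
      then have "\<nu> j = \<nu> (j - m)" using A less by simp
      also have "\<dots> = per (j - m)" using less False entry_pos by simp
      also have "\<dots> = per j" using per_add[of "j - m"] False by simp
      finally show ?thesis .
    qed (use less per_initial in auto)
  qed
  have "per k = per (k - m)" using per_add[of "k - m"] A(1) by simp
  also have "\<dots> = \<nu> (k - m)" using B[of "k - m"] A(1) entry_pos by simp
  finally show "\<nu> k \<noteq> per k" using A(2) by simp
qed

lemma R_below: "t < k \<Longrightarrow> R t = t"
  using run_agree[of t \<nu> 0 per 0] agree_below by simp

lemma R_k: "R k = 0"
proof -
  obtain j where j: "k = Suc j" using k_gt by (cases k) auto
  then have "R j = j" by (simp add: R_below)
  then show ?thesis unfolding j run.simps(2) using k_mismatch j by simp
qed

lemma R_from_k: "R (k + n) = run \<nu> per k 0 n"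
  using run_add[of \<nu> per 0 0 k n] R_k by simp

lemma R_add: "R (q * m + n) = run \<nu> per 0 (R (q * m)) n"
  using run_add[of \<nu> per 0 0 "q * m" n] run_per_shift[of 0 q _ n] by simp

lemma q_num_return:
  shows "R (q_num \<nu> m * m) = 0" and "0 < q_num \<nu> m"
    and "\<And>i. 0 < i \<Longrightarrow> i < q_num \<nu> m \<Longrightarrow> R (i * m) \<noteq> 0"
proof -
  \<comment> \<open>Shifting by one before the division makes \<open>r\<close> range over 1, ...,
    \<open>m\<close> instead of 0, ..., \<open>m - 1\<close>.\<close>
  define a r where "a = (k - 1) div m" and "r = Suc ((k - 1) mod m)"
  have k: "k = a * m + r" using k_gt by (simp add: a_def r_def)
  have r: "1 \<le> r" "r \<le> m" using entry_pos by (auto simp: r_def Suc_le_eq)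
  have the: "(THE r. r \<in> {1..m} \<and> r mod m = k mod m) = r"
  proof (rule the_equality)
    show "r \<in> {1..m} \<and> r mod m = k mod m" using r by (simp add: k)
    fix r' assume r': "r' \<in> {1..m} \<and> r' mod m = k mod m"
    then have "r' mod m = r mod m" by (simp add: k)
    then show "r' = r" using r r'
      by (metis atLeastAtMost_iff le_neq_implies_less mod_less mod_self not_one_le_zero)
  qed
  have div: "(k - r) div m = a" using k entry_pos by simp
  have q: "q_num \<nu> m = (if m \<in> rho_orbit \<nu> r then a + 1 else a + 2)"
    unfolding q_num_def Let_def rho_entry the_enat.simps the div ..
  have small: "R (i * m) \<noteq> 0" if "0 < i" "i \<le> a" for i
  proof -
    have "i * m < k" using k r that by (metis add.commute add_strict_increasing less_eq_Suc_le mult_le_mono1 nat_less_le One_nat_def not_less_eq_eq)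
    then show ?thesis using R_below[of "i * m"] that entry_pos by simp
  qed
  have "(a + 1) * m = k + (m - r)" using k r by simp
  then have "R ((a + 1) * m) = run \<nu> per (r + a * m) 0 (m - r)"
    using R_from_k[of "m - r"] k by (simp add: add.commute)
  also have "\<dots> = run \<nu> per r 0 (m - r)" by (rule run_per_shift)
  finally have next0: "R ((a + 1) * m) = run \<nu> per r 0 (m - r)" .
  \<comment> \<open>The rest of the period lies within the first \<open>m\<close> symbols, where
    \<open>per\<close> is \<open>\<nu>\<close>; so the \<rho>-orbit of \<open>r\<close> decides
    about this return.\<close>
  also have "\<dots> = run \<nu> \<nu> r 0 (m - r)" using r by (simp add: run_per_initial)
  finally have orb: "R ((a + 1) * m) = 0 \<longleftrightarrow> m \<in> rho_orbit \<nu> r"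
    using rho_orbit_iff_run[of r m \<nu>] r by simp
  have "(a + 2) * m = k + (m - r + m)" using k r by simp
  then have "R ((a + 2) * m) = run \<nu> per (r + a * m) 0 (m - r + m)"
    using R_from_k[of "m - r + m"] k by (simp add: add.commute)
  also have "\<dots> = run \<nu> per r 0 (m - r + m)" by (rule run_per_shift)
  finally have two: "R ((a + 2) * m) = run \<nu> per r 0 (m - r + m)" .
  show "R (q_num \<nu> m * m) = 0"
    using orb run_returns[OF r] q two next0 by auto
  show "0 < q_num \<nu> m" using q by simp
  fix i assume "0 < i" "i < q_num \<nu> m"
  then have "i \<le> a \<or> i = a + 1 \<and> m \<notin> rho_orbit \<nu> r" using q by (auto split: if_splits)
  then show "R (i * m) \<noteq> 0" using small orb \<open>0 < i\<close> by auto
qed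

lemma R_periodic: "R (n + q_num \<nu> m * m) = R n"
  using R_add[of "q_num \<nu> m" n] q_num_return(1) by (simp add: add.commute)

lemma R_periodic_mult: "R (n + j * (q_num \<nu> m * m)) = R n"
proof (induction j)
  case (Suc j)
  have "n + Suc j * (q_num \<nu> m * m) = n + j * (q_num \<nu> m * m) + q_num \<nu> m * m" by simp
  then show ?case using Suc R_periodic[of "n + j * (q_num \<nu> m * m)"] by metis
qed simp

lemma R_mult_zero_iff: "R (i * m) = 0 \<longleftrightarrow> q_num \<nu> m dvd i"
proof -
  let ?q = "q_num \<nu> m"
  have "i * m = (i mod ?q) * m + (i div ?q) * (?q * m)"
    by (metis add.commute add_mult_distrib div_mult_mod_eq mult.assoc)
  then have "R (i * m) = R ((i mod ?q) * m)" using R_periodic_mult by metis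
  then show ?thesis
    using q_num_return(3)[of "i mod ?q"] q_num_return(2) by (cases "i mod ?q = 0") auto
qed

text \<open>Two legs that are cut at the same phase of the period coincide from then on. When the
  first one returns after a multiple of \<open>q_num \<nu> m\<close> periods, so does the other,
  which by \<open>R_mult_zero_iff\<close> determines their distance.\<close>

lemma never_both_cut:
  assumes "R s = 0" "R (s + u * m) = 0"
  shows "q_num \<nu> m dvd u"
proof -
  let ?q = "q_num \<nu> m"
  \<comment> \<open>\<open>s * (?q * m)\<close> merely serves as a return time that is not before
    \<open>s\<close>.\<close>
  have "s \<le> s * (?q * m)" using q_num_return(2) entry_pos by simp
  then obtain n where n: "s + n = s * (?q * m)" using le_Suc_ex by metis
  have "R (s + u * m + n) = run \<nu> per (s + u * m) 0 n"
    using run_add[of \<nu> per 0 0 "s + u * m" n] assms by simp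
  also have "\<dots> = run \<nu> per s 0 n" by (rule run_per_shift)
  also have "\<dots> = R (s + n)" using run_add[of \<nu> per 0 0 s n] assms by simp
  also have "\<dots> = R 0" using n R_periodic_mult[of 0 s] by simp
  finally have "R (s + u * m + n) = 0" by simp
  moreover have "s + u * m + n = u * m + s * (?q * m)" using n by simp
  ultimately have "R (u * m) = 0" using R_periodic_mult by simp
  then show ?thesis by (simp add: R_mult_zero_iff)
qed

end

subsection \<open>Arcs in Hausdorff spaces\<close>

text \<open>For \<open>b < a\<close> the path is traversed backwards; this supplies the way back
  when a loop is closed along a second arc.\<close>

definition piece :: "real \<Rightarrow> real \<Rightarrow> (real \<Rightarrow> 'a) \<Rightarrow> real \<Rightarrow> 'a" where
  "piece a b g = g \<circ> linepath a b"

lemma piece_ends [simp]: "pathstart (piece a b g) = g a" "pathfinish (piece a b g) = g b"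
  by (simp_all add: piece_def pathstart_def pathfinish_def linepath_def)

lemma path_image_piece:
  fixes g :: "real \<Rightarrow> 'a::topological_space"
  shows "a \<le> b \<Longrightarrow> path_image (piece a b g) = g ` {a..b}"
proof -
  assume "a \<le> b"
  have "path_image (piece a b g) = g ` path_image (linepath a b)"
    by (simp add: piece_def path_image_def image_comp)
  then show ?thesis using \<open>a \<le> b\<close> by (simp add: closed_segment_eq_real_ivl)
qed

lemma piece_range:
  fixes a b :: real
  assumes "a \<in> {0..1}" "b \<in> {0..1}"
  shows "path_image (linepath a b) \<subseteq> {0..1}"
  using closed_segment_subset[of a "{0..1}" b] assms by simp

lemma path_piece:
  fixes g :: "real \<Rightarrow> 'a::topological_space"
  assumes "path g" "a \<in> {0..1}" "b \<in> {0..1}"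
  shows "path (piece a b g)"
  unfolding piece_def using assms piece_range[OF assms(2,3)]
  by (intro path_continuous_image) (auto simp: path_def intro: continuous_on_subset)

lemma path_image_piece_subset:
  fixes g :: "real \<Rightarrow> 'a::topological_space"
  assumes "a \<in> {0..1}" "b \<in> {0..1}"
  shows "path_image (piece a b g) \<subseteq> path_image g"
proof -
  have "path_image (piece a b g) = g ` path_image (linepath a b)"
    by (simp add: piece_def path_image_def image_comp)
  then show ?thesis using piece_range[OF assms] by (simp add: path_image_def image_mono)
qed

lemma arc_piece:
  fixes g :: "real \<Rightarrow> 'a::topological_space"
  assumes "arc g" "a \<in> {0..1}" "b \<in> {0..1}" "a \<noteq> b"
  shows "arc (piece a b g)"
proof -
  have "inj_on (linepath a b) {0..1}" using assms(4) arc_linepath by (auto simp: arc_def)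
  moreover have "inj_on g (linepath a b ` {0..1})"
    using assms(1) piece_range[OF assms(2,3)] by (auto simp: arc_def path_image_def intro: inj_on_subset)
  ultimately have "inj_on (piece a b g) {0..1}" unfolding piece_def by (rule comp_inj_on)
  then show ?thesis using assms path_piece by (auto simp: arc_def)
qed

text \<open>Follow \<open>g\<close> until it first meets \<open>h\<close> and continue on
  \<open>h\<close>: the two pieces share only that point. One of them may degenerate to a point,
  which is treated separately.\<close>

lemma arc_join_exists:
  fixes g h :: "real \<Rightarrow> 'a::t2_space"
  assumes "arc g" "arc h" "pathfinish g = pathstart h" "pathstart g \<noteq> pathfinish h"
  obtains k where "arc k" "pathstart k = pathstart g" "pathfinish k = pathfinish h"
    "path_image k \<subseteq> path_image g \<union> path_image h"
proof -
  let ?S = "{0..1} \<inter> g -` path_image h"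
  have cg: "continuous_on {0..1} g" using assms(1) by (simp add: arc_def path_def)
  have "closed ?S"
    using cg assms(2) by (intro continuous_closed_preimage closed_path_image arc_imp_path compact_imp_closed) auto
  then have S: "compact ?S"
    by (metis compact_Icc inf.idem inf_assoc compact_Int_closed)
  have "pathfinish g \<in> path_image h" using assms(3) pathstart_in_path_image by metis
  then have "1 \<in> ?S" by (auto simp: pathfinish_def)
  then obtain t where t: "t \<in> ?S" and t_min: "\<And>s. s \<in> ?S \<Longrightarrow> t \<le> s"
    using compact_attains_inf[OF S] by blast
  then obtain s where s: "s \<in> {0..1}" "h s = g t" by (auto simp: path_image_def)
  show ?thesis
  proof (cases "t = 0 \<or> s = 1")
    case True
    show ?thesis
    proof (cases "t = 0")
      case True
      then have "s \<noteq> 1" using s assms(4) by (auto simp: pathstart_def pathfinish_def)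
      then have "arc (piece s 1 h)" using s assms(2) by (intro arc_piece) auto
      moreover have "path_image (piece s 1 h) \<subseteq> path_image h"
        using s by (intro path_image_piece_subset) auto
      ultimately show ?thesis
        using s True by (intro that[of "piece s 1 h"]) (auto simp: pathstart_def[of g] pathfinish_def[of h])
    next
      case False
      then have "arc (piece 0 t g)" using t assms(1) by (intro arc_piece) auto
      moreover have "path_image (piece 0 t g) \<subseteq> path_image g"
        using t by (intro path_image_piece_subset) auto
      moreover have "s = 1" using False \<open>t = 0 \<or> s = 1\<close> by simp
      ultimately show ?thesis
        using s by (intro that[of "piece 0 t g"]) (auto simp: pathstart_def[of g] pathfinish_def[of h])
    qed
  next
    case False
    have im: "path_image (piece 0 t g) = g ` {0..t}" "path_image (piece s 1 h) = h ` {s..1}"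
      using t s by (simp_all add: path_image_piece)
    have "arc (piece 0 t g +++ piece s 1 h)"
    proof (rule arc_join)
      show "arc (piece 0 t g)" "arc (piece s 1 h)"
        using False t s assms by (auto intro!: arc_piece)
      show "path_image (piece 0 t g) \<inter> path_image (piece s 1 h) \<subseteq> {pathstart (piece s 1 h)}"
      proof
        fix z assume "z \<in> path_image (piece 0 t g) \<inter> path_image (piece s 1 h)"
        then obtain r where r: "r \<in> {0..t}" "z = g r" and "z \<in> path_image h"
          using s im by (auto simp: path_image_def)
        then have "r \<in> ?S" using t by auto
        then have "r = t" using t_min r by (simp add: antisym)
        then show "z \<in> {pathstart (piece s 1 h)}" using r s by simp
      qed
    qed (use s in simp)
    then show ?thesis
      using s t im by (intro that[of "piece 0 t g +++ piece s 1 h"])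
        (auto simp: path_image_join pathstart_def[of g] pathfinish_def[of h] path_image_def[of g] path_image_def[of h])
  qed
qed

text \<open>If \<open>g\<close> is away from \<open>h\<close> at time \<open>r\<close>, the maximal
  interval around \<open>r\<close> on which it stays away yields a piece of \<open>g\<close> that,
  closed up by the piece of \<open>h\<close> between its ends, is a simple loop.\<close>

lemma arc_images_eq_if_no_loop:
  fixes g h :: "real \<Rightarrow> 'a::t2_space"
  assumes no_loop: "\<not> (\<exists>k. simple_path k \<and> pathfinish k = pathstart k \<and> path_image k \<subseteq> T)"
    and "arc g" "arc h" "pathstart g = pathstart h" "pathfinish g = pathfinish h"
    and "path_image g \<subseteq> T" "path_image h \<subseteq> T"
  shows "path_image g \<subseteq> path_image h"
proof (rule ccontr)
  assume "\<not> ?thesis"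
  then obtain r where r: "r \<in> {0..1}" "g r \<notin> path_image h" unfolding path_image_def[of g] by blast
  have cg: "continuous_on {0..1} g" using assms(2) by (simp add: arc_def path_def)
  have ch: "closed (path_image h)" using assms(3) by (simp add: compact_imp_closed compact_arc_image)
  have cl: "compact ({a..b} \<inter> g -` path_image h)" if "{a..b} \<subseteq> {0..1}" for a b
  proof -
    have "closed ({a..b} \<inter> g -` path_image h)"
      using continuous_on_subset[OF cg that] ch by (intro continuous_closed_preimage) auto
    then show ?thesis by (metis compact_Icc inf.idem inf_assoc compact_Int_closed)
  qed
  have ends: "g 0 \<in> path_image h" "g 1 \<in> path_image h"
    using assms(4,5) pathstart_in_path_image[of h] pathfinish_in_path_image[of h]
    by (auto simp: pathstart_def pathfinish_def)
  obtain s where s: "s \<in> {0..r}" "g s \<in> path_image h"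
    and s_max: "\<And>t. t \<in> {0..r} \<Longrightarrow> g t \<in> path_image h \<Longrightarrow> t \<le> s"
    using compact_attains_sup[OF cl[of 0 r]] r ends by fastforce
  obtain u where u: "u \<in> {r..1}" "g u \<in> path_image h"
    and u_min: "\<And>t. t \<in> {r..1} \<Longrightarrow> g t \<in> path_image h \<Longrightarrow> u \<le> t"
    using compact_attains_inf[OF cl[of r 1]] r ends by fastforce
  have su: "s < r" "r < u" using r s u by (auto simp: less_le)
  obtain a b where ab: "a \<in> {0..1}" "h a = g s" "b \<in> {0..1}" "h b = g u"
    using s u by (auto simp: path_image_def)
  have "g s \<noteq> g u" using arcD[OF assms(2), of s u] s u su r by auto
  then have "a \<noteq> b" using ab by auto
  have "simple_path (piece s u g +++ piece b a h)"
  proof (rule simple_path_join_loop)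
    show "arc (piece s u g)" "arc (piece b a h)"
      using s u su ab r \<open>a \<noteq> b\<close> assms by (auto intro!: arc_piece)
    show "path_image (piece s u g) \<inter> path_image (piece b a h)
        \<subseteq> {pathstart (piece s u g), pathstart (piece b a h)}"
    proof
      fix z assume z: "z \<in> path_image (piece s u g) \<inter> path_image (piece b a h)"
      moreover have "path_image (piece b a h) \<subseteq> path_image h"
        using ab assms by (intro path_image_piece_subset) (auto simp: arc_imp_path)
      ultimately obtain t where t: "t \<in> {s..u}" "z = g t" "z \<in> path_image h"
        using su by (auto simp: path_image_piece)
      have "t = s \<or> t = u"
      proof (cases "t \<le> r")
        case True
        then show ?thesis using s_max[of t] t s by auto
      next
        case False
        then show ?thesis using u_min[of t] t u by auto
      qed
      then show "z \<in> {pathstart (piece s u g), pathstart (piece b a h)}" using t ab by auto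
    qed
  qed (use ab in auto)
  moreover have "path_image (piece s u g +++ piece b a h) \<subseteq> T"
  proof -
    have "path_image (piece s u g) \<subseteq> path_image g" "path_image (piece b a h) \<subseteq> path_image h"
      using s u r ab by (simp_all add: path_image_piece_subset)
    then show ?thesis using assms(6,7) ab by (auto simp: path_image_join)
  qed
  ultimately show False using no_loop ab by fastforce
qed

text \<open>Both \<open>K\<close> and its complement are finite unions of closed pieces. The pieces
  will be vertices and edges, or half-open arcs issuing from a point.\<close>

lemma clopen_if_union_of_pieces:
  assumes "finite \<P>" "\<Union>\<P> = S" "\<And>P. P \<in> \<P> \<Longrightarrow> closedin (top_of_set S) P"
    and "K \<subseteq> S" "\<And>P. P \<in> \<P> \<Longrightarrow> P \<inter> K \<noteq> {} \<Longrightarrow> P \<subseteq> K"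
  shows "openin (top_of_set S) K" "closedin (top_of_set S) K"
proof -
  have piece: "\<exists>P\<in>\<P>. x \<in> P" if "x \<in> S" for x using that assms(2) by auto
  have "K \<subseteq> \<Union>{P \<in> \<P>. P \<inter> K \<noteq> {}}" using piece assms(4) by fast
  moreover have "\<Union>{P \<in> \<P>. P \<inter> K \<noteq> {}} \<subseteq> K" using assms(5) by (intro Union_least) simp
  ultimately have "K = \<Union>{P \<in> \<P>. P \<inter> K \<noteq> {}}" by (rule equalityI)
  moreover have "closedin (top_of_set S) (\<Union>{P \<in> \<P>. P \<inter> K \<noteq> {}})"
    using assms(1,3) by (intro closedin_Union) auto
  ultimately show "closedin (top_of_set S) K" by simp
  have "S - K \<subseteq> \<Union>{P \<in> \<P>. P \<inter> K = {}}"
  proof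
    fix x assume x: "x \<in> S - K"
    then obtain P where P: "P \<in> \<P>" "x \<in> P" using piece by auto
    then have "P \<inter> K = {}" using assms(5)[OF P(1)] x by auto
    then show "x \<in> \<Union>{P \<in> \<P>. P \<inter> K = {}}" using P by auto
  qed
  moreover have "\<Union>{P \<in> \<P>. P \<inter> K = {}} \<subseteq> S - K" using assms(2) by auto
  ultimately have "S - K = \<Union>{P \<in> \<P>. P \<inter> K = {}}" by (rule equalityI)
  moreover have "closedin (top_of_set S) (\<Union>{P \<in> \<P>. P \<inter> K = {}})"
    using assms(1,3) by (intro closedin_Union) auto
  ultimately show "openin (top_of_set S) K" using assms(4) by (simp add: openin_closedin_eq)
qed

lemma connected_subset_clopen:
  assumes "openin (top_of_set S) K" "closedin (top_of_set S) K" "connected C" "C \<subseteq> S" "C \<inter> K \<noteq> {}"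
  shows "C \<subseteq> K"
proof -
  obtain A B where AB: "open A" "K = S \<inter> A" "closed B" "K = S \<inter> B"
    using assms(1,2) by (metis openin_open closedin_closed)
  then have "C \<inter> K = C \<inter> A" "C \<inter> K = C \<inter> B" using assms(4) by auto
  then have "openin (top_of_set C) (C \<inter> K)" "closedin (top_of_set C) (C \<inter> K)"
    using AB by (metis openin_open_Int, metis closedin_closed_Int)
  then have "C \<inter> K = C" using assms(3,5) unfolding connected_clopen by blast
  then show ?thesis by blast
qed


subsection \<open>Betweenness in a topological tree\<close>

locale tree =
  fixes T :: "'a::t2_space set"
  assumes top_tree: "top_tree T"
begin

abbreviation seg :: "'a \<Rightarrow> 'a \<Rightarrow> 'a set" where
  "seg x y \<equiv> tree_arc T x y"

lemma no_loop: "\<not> (\<exists>k. simple_path k \<and> pathfinish k = pathstart k \<and> path_image k \<subseteq> T)"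
  and conn: "connected T"
  using top_tree by (auto simp: top_tree_def)

lemma graph:
  obtains V :: "'a set" and E :: "(real \<Rightarrow> 'a) set" where "finite V" "finite E"
    "T = V \<union> (\<Union>g\<in>E. path_image g)"
    "\<forall>g\<in>E. arc g \<and> pathstart g \<in> V \<and> pathfinish g \<in> V"
proof -
  from top_tree obtain V :: "'a set" and E :: "(real \<Rightarrow> 'a) set" where VE: "finite V" "finite E"
    "T = V \<union> (\<Union>g\<in>E. path_image g)"
    and arcs: "\<forall>g\<in>E. arc g \<and> path_image g \<inter> V = {pathstart g, pathfinish g}"
    unfolding top_tree_def finite_top_graph_def by (elim exE conjE) (rule that)
  have "\<forall>g\<in>E. arc g \<and> pathstart g \<in> V \<and> pathfinish g \<in> V"
  proof
    fix g assume "g \<in> E"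
    with arcs have "arc g" "path_image g \<inter> V = {pathstart g, pathfinish g}" by simp_all
    moreover from this(2) have "{pathstart g, pathfinish g} \<subseteq> V" using Int_lower2 by metis
    ultimately show "arc g \<and> pathstart g \<in> V \<and> pathfinish g \<in> V" by simp
  qed
  with VE show ?thesis by (rule that)
qed

definition joined :: "'a \<Rightarrow> 'a \<Rightarrow> bool" where
  "joined x y \<longleftrightarrow> x = y \<or>
     (\<exists>g. arc g \<and> pathstart g = x \<and> pathfinish g = y \<and> path_image g \<subseteq> T)"

lemma joined_refl [simp]: "joined x x"
  by (simp add: joined_def)

lemma joinedI:
  "arc g \<Longrightarrow> pathstart g = x \<Longrightarrow> pathfinish g = y \<Longrightarrow> path_image g \<subseteq> T \<Longrightarrow> joined x y"
  unfolding joined_def by (intro disjI2 exI[of _ g] conjI)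

lemma joined_arc:
  "joined x y \<Longrightarrow> x \<noteq> y \<Longrightarrow>
    \<exists>g. arc g \<and> pathstart g = x \<and> pathfinish g = y \<and> path_image g \<subseteq> T"
  unfolding joined_def by (elim disjE) simp_all

lemma joined_trans:
  assumes "joined x y" "joined y z"
  shows "joined x z"
proof (cases "x = y \<or> y = z \<or> x = z")
  case False
  then have ne: "x \<noteq> y" "y \<noteq> z" "x \<noteq> z" by auto
  obtain g where g: "arc g" "pathstart g = x" "pathfinish g = y" "path_image g \<subseteq> T"
    using joined_arc[OF assms(1) ne(1)] by (elim exE conjE)
  obtain h where h: "arc h" "pathstart h = y" "pathfinish h = z" "path_image h \<subseteq> T"
    using joined_arc[OF assms(2) ne(2)] by (elim exE conjE)
  have "pathfinish g = pathstart h" "pathstart g \<noteq> pathfinish h" using g h ne by simp_all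
  then obtain k where "arc k" "pathstart k = pathstart g" "pathfinish k = pathfinish h"
    "path_image k \<subseteq> path_image g \<union> path_image h" by (rule arc_join_exists[OF g(1) h(1)])
  then show ?thesis using g h by (intro joinedI[of k]) auto
next
  case True
  then consider "x = y" | "y = z" | "x = z" by argo
  then show ?thesis using assms by cases simp_all
qed

lemma joined_on_arc:
  assumes "arc g" "path_image g \<subseteq> T" "x \<in> path_image g" "y \<in> path_image g"
  shows "joined x y"
proof (cases "x = y")
  case False
  obtain s t where st: "s \<in> {0..1}" "t \<in> {0..1}" "x = g s" "y = g t"
    using assms(3,4) unfolding path_image_def by (metis imageE)
  have "s \<noteq> t" using st False by auto
  then have "arc (piece s t g)" using assms(1) st by (intro arc_piece)
  moreover have "path_image (piece s t g) \<subseteq> T"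
    using path_image_piece_subset[OF st(1,2)] assms(2) by (rule order_trans)
  ultimately show ?thesis using st by (intro joinedI[of "piece s t g"]) simp_all
qed (simp add: joined_def)

text \<open>The points joined to \<open>x\<close> form a union of vertices and edges, hence a clopen
  subset of the connected set \<open>T\<close>.\<close>

lemma joined_all:
  assumes "x \<in> T" "y \<in> T"
  shows "joined x y"
proof -
  obtain V E where VE: "finite V" "finite E" "T = V \<union> (\<Union>g\<in>E. path_image g)"
    "\<forall>g\<in>E. arc g \<and> pathstart g \<in> V \<and> pathfinish g \<in> V" by (rule graph)
  define \<P> where "\<P> = (\<lambda>v. {v}) ` V \<union> path_image ` E"
  define K where "K = {z \<in> T. joined x z}"
  have P: "finite \<P>" "\<Union>\<P> = T" unfolding \<P>_def VE(3) using VE(1,2) by auto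
  have cases: "(\<exists>v. P = {v}) \<or> (\<exists>g. arc g \<and> P = path_image g)" if "P \<in> \<P>" for P
  proof -
    have "P \<in> (\<lambda>v. {v}) ` V \<or> P \<in> path_image ` E" using that by (simp add: \<P>_def)
    then show ?thesis
    proof
      assume "P \<in> path_image ` E"
      then obtain g where "g \<in> E" "P = path_image g" by (rule imageE)
      then show ?thesis using VE(4) by metis
    qed auto
  qed
  have PT: "P \<subseteq> T" if "P \<in> \<P>" for P using Union_upper[OF that] P(2) by simp
  have closedin: "closedin (top_of_set T) P" if "P \<in> \<P>" for P
  proof (rule closed_subset)
    show "P \<subseteq> T" by (rule PT[OF that])
    from cases[OF that] show "closed P"
      by (elim disjE exE conjE) (simp_all add: compact_arc_image compact_imp_closed)
  qed
  have pieces: "P \<subseteq> K" if P: "P \<in> \<P>" "P \<inter> K \<noteq> {}" for P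
  proof
    fix b assume "b \<in> P"
    obtain p where p: "p \<in> P" "joined x p" using P(2) by (auto simp: K_def)
    have "joined p b"
      using cases[OF P(1)]
    proof
      assume "\<exists>g. arc g \<and> P = path_image g"
      then obtain g where g: "arc g" "P = path_image g" by auto
      then show ?thesis using joined_on_arc[OF g(1), of p b] PT[OF P(1)] p(1) \<open>b \<in> P\<close> by simp
    qed (use p \<open>b \<in> P\<close> in auto)
    then show "b \<in> K" using joined_trans[OF p(2)] PT[OF P(1)] \<open>b \<in> P\<close> by (auto simp: K_def)
  qed
  have KT: "K \<subseteq> T" by (auto simp: K_def)
  have "openin (top_of_set T) K"
    using P closedin KT pieces by (rule clopen_if_union_of_pieces(1))
  moreover have "closedin (top_of_set T) K"
    using P closedin KT pieces by (rule clopen_if_union_of_pieces(2))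
  moreover have "T \<inter> K \<noteq> {}" using assms(1) by (auto simp: K_def)
  ultimately have "T \<subseteq> K" using connected_subset_clopen[OF _ _ conn subset_refl] by simp
  then show ?thesis using assms(2) by (auto simp: K_def)
qed

lemma seg_eq_path_image:
  assumes "arc g" "pathstart g = x" "pathfinish g = y" "path_image g \<subseteq> T"
  shows "seg x y = path_image g"
proof -
  have "x \<noteq> y" using assms arc_distinct_ends by metis
  have "(THE A. A \<subseteq> T \<and> (\<exists>g. arc g \<and> pathstart g = x \<and> pathfinish g = y \<and> path_image g = A)) = path_image g"
  proof (rule the_equality)
    fix A assume "A \<subseteq> T \<and> (\<exists>g. arc g \<and> pathstart g = x \<and> pathfinish g = y \<and> path_image g = A)"
    then obtain h where "path_image h \<subseteq> T" "arc h" "pathstart h = x" "pathfinish h = y" "path_image h = A"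
      by blast
    then show "A = path_image g"
      using arc_images_eq_if_no_loop[OF no_loop, of g h] arc_images_eq_if_no_loop[OF no_loop, of h g] assms
      by auto
  qed (use assms in blast)
  then show ?thesis using \<open>x \<noteq> y\<close> by (simp add: tree_arc_def)
qed

lemma seg_arc:
  assumes "x \<in> T" "y \<in> T" "x \<noteq> y"
  obtains g where "arc g" "pathstart g = x" "pathfinish g = y" "path_image g = seg x y" "seg x y \<subseteq> T"
proof -
  obtain g where g: "arc g" "pathstart g = x" "pathfinish g = y" "path_image g \<subseteq> T"
    using joined_arc[OF joined_all[OF assms(1,2)] assms(3)] by (elim exE conjE)
  then show ?thesis using seg_eq_path_image[OF g] by (intro that[of g]) simp_all
qed

lemma seg_on_arc:
  assumes g: "arc g" "path_image g \<subseteq> T" and "0 \<le> a" "a \<le> b" "b \<le> 1"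
  shows "seg (g a) (g b) = g ` {a..b}"
proof (cases "a = b")
  case True
  then show ?thesis by (simp add: tree_arc_def)
next
  case False
  then have "g a \<noteq> g b" using arcD[OF g(1), of a b] assms by auto
  have "seg (g a) (g b) = path_image (piece a b g)"
  proof (rule seg_eq_path_image)
    show "arc (piece a b g)" using \<open>g a \<noteq> g b\<close> assms by (intro arc_piece) auto
    show "path_image (piece a b g) \<subseteq> T"
      using assms path_image_piece_subset[of a b g] by (auto simp: arc_imp_path)
  qed auto
  then show ?thesis using assms by (simp add: path_image_piece)
qed

lemma seg_refl [simp]: "seg x x = {x}"
  by (simp add: tree_arc_def)

lemma seg_subset: "x \<in> T \<Longrightarrow> y \<in> T \<Longrightarrow> seg x y \<subseteq> T"
  by (cases "x = y") (simp, metis seg_arc)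

lemma seg_commute:
  assumes "x \<in> T" "y \<in> T"
  shows "seg x y = seg y x"
proof (cases "x = y")
  case False
  then obtain g where g: "arc g" "pathstart g = x" "pathfinish g = y" "path_image g = seg x y" "seg x y \<subseteq> T"
    using assms seg_arc by metis
  then have "seg y x = path_image (reversepath g)"
    by (intro seg_eq_path_image) (auto simp: arc_reversepath)
  then show ?thesis using g by simp
qed simp

lemma ends_in_seg:
  assumes "x \<in> T" "y \<in> T"
  shows "x \<in> seg x y" "y \<in> seg x y"
proof -
  have x: "x \<in> seg x y" if "x \<in> T" "y \<in> T" for x y
    using that by (cases "x = y") (simp, metis seg_arc pathstart_in_path_image)
  show "x \<in> seg x y" using x assms by blast
  show "y \<in> seg x y" using x[of y x] seg_commute assms by simp
qed

lemma compact_seg: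
  assumes "x \<in> T" "y \<in> T"
  shows "compact (seg x y)" "connected (seg x y)"
  using assms by (cases "x = y"; simp; metis seg_arc compact_arc_image connected_arc_image)+

lemma seg_split:
  assumes "x \<in> T" "y \<in> T" "z \<in> seg x y"
  shows "seg x y = seg x z \<union> seg z y" "seg x z \<inter> seg z y = {z}"
proof -
  have "seg x y = seg x z \<union> seg z y \<and> seg x z \<inter> seg z y = {z}"
  proof (cases "x = y")
    case False
    then obtain g where g: "arc g" "pathstart g = x" "pathfinish g = y" "path_image g = seg x y" "seg x y \<subseteq> T"
      using assms seg_arc by metis
    then obtain t where t: "t \<in> {0..1}" "z = g t" using assms(3) by (metis imageE path_image_def)
    have T: "path_image g \<subseteq> T" using g by simp
    have 1: "seg x z = g ` {0..t}" "seg z y = g ` {t..1}"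
      using seg_on_arc[OF g(1) T, of 0 t] seg_on_arc[OF g(1) T, of t 1] t g
      by (auto simp: pathstart_def pathfinish_def)
    have "seg x y = g ` ({0..t} \<union> {t..1})"
      using t g(4) by (auto simp: path_image_def ivl_disj_un_two_touch)
    moreover have "g ` {0..t} \<inter> g ` {t..1} = g ` ({0..t} \<inter> {t..1})"
      using t g(1) by (intro inj_on_image_Int[symmetric, of g "{0..1}"]) (auto simp: arc_def)
    moreover have "{0..t} \<inter> {t..1} = {t}" using t by auto
    ultimately show ?thesis using 1 t by (auto simp: image_Un)
  qed (use assms in auto)
  then show "seg x y = seg x z \<union> seg z y" "seg x z \<inter> seg z y = {z}" by auto
qed

lemma seg_triangle:
  assumes "x \<in> T" "y \<in> T" "w \<in> T"
  shows "seg x y \<subseteq> seg x w \<union> seg w y"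
proof (cases "x = w \<or> w = y \<or> x = y")
  case True
  then show ?thesis using ends_in_seg assms by auto
next
  case False
  obtain g where g: "arc g" "pathstart g = x" "pathfinish g = w" "path_image g = seg x w" "seg x w \<subseteq> T"
    using assms False seg_arc by metis
  obtain h where h: "arc h" "pathstart h = w" "pathfinish h = y" "path_image h = seg w y" "seg w y \<subseteq> T"
    using assms False seg_arc by metis
  have "pathfinish g = pathstart h" "pathstart g \<noteq> pathfinish h" using g h False by auto
  from arc_join_exists[OF g(1) h(1) this] obtain k where k: "arc k" "pathstart k = pathstart g"
    "pathfinish k = pathfinish h" "path_image k \<subseteq> path_image g \<union> path_image h" by blast
  then have "seg x y = path_image k" using g h by (intro seg_eq_path_image) auto
  then show ?thesis using k g h by simp
qed

text \<open>Let \<open>b\<close> be the first point of \<open>[x,y]\<close> on the way from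
  \<open>w\<close> to \<open>x\<close>. The way up to \<open>b\<close> meets \<open>[b,y]\<close>
  only in \<open>b\<close>, so together they form the arc from \<open>w\<close> to
  \<open>y\<close>.\<close>

lemma median:
  assumes "x \<in> T" "y \<in> T" "w \<in> T"
  obtains b where "b \<in> seg x y" "b \<in> seg y w" "b \<in> seg x w"
proof (cases "w \<in> seg x y")
  case True
  then show ?thesis using that ends_in_seg assms by blast
next
  case False
  then have "w \<noteq> x" using ends_in_seg assms by blast
  then obtain g where g: "arc g" "pathstart g = w" "pathfinish g = x" "path_image g = seg w x" "seg w x \<subseteq> T"
    using assms seg_arc by metis
  have T: "path_image g \<subseteq> T" using g by simp
  let ?S = "{0..1} \<inter> g -` seg x y"
  have "closed ?S"
    using g(1) compact_seg(1)[OF assms(1,2)]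
    by (intro continuous_closed_preimage compact_imp_closed) (auto simp: arc_def path_def)
  then have S: "compact ?S" by (metis compact_Icc inf.idem inf_assoc compact_Int_closed)
  have "1 \<in> ?S" using g ends_in_seg assms by (auto simp: pathfinish_def)
  then obtain t where t: "t \<in> ?S" and t_min: "\<And>s. s \<in> ?S \<Longrightarrow> t \<le> s"
    using compact_attains_inf[OF S] by blast
  define b where "b = g t"
  have b: "b \<in> seg x y" "b \<in> seg w x" using t g by (auto simp: b_def path_image_def)
  have bT: "b \<in> T" using b seg_subset assms by blast
  have "b \<in> seg w y"
  proof (cases "b = y")
    case True
    then show ?thesis using ends_in_seg assms by simp
  next
    case False
    then obtain h where h: "arc h" "pathstart h = b" "pathfinish h = y" "path_image h = seg b y" "seg b y \<subseteq> T"
      using assms bT seg_arc by metis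
    have t0: "t \<noteq> 0" using g t \<open>w \<notin> seg x y\<close> by (auto simp: pathstart_def)
    have im: "path_image (piece 0 t g) = g ` {0..t}" using t by (simp add: path_image_piece)
    have "arc (piece 0 t g +++ h)"
    proof (rule arc_join)
      have "g 0 \<noteq> g t" using arcD[OF g(1), of 0 t] t t0 by auto
      then show "arc (piece 0 t g)" using t g by (intro arc_piece) auto
      show "path_image (piece 0 t g) \<inter> path_image h \<subseteq> {pathstart h}"
      proof
        fix z assume "z \<in> path_image (piece 0 t g) \<inter> path_image h"
        then obtain r where r: "r \<in> {0..t}" "z = g r" and "z \<in> seg b y" using im h by auto
        then have "r \<in> ?S" using t seg_split[OF assms(1,2) b(1)] by auto
        then have "r = t" using t_min r by (simp add: antisym)
        then show "z \<in> {pathstart h}" using r h by (simp add: b_def)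
      qed
    qed (use h b_def in auto)
    moreover have "path_image (piece 0 t g +++ h) = g ` {0..t} \<union> seg b y"
      using h im b_def by (simp add: path_image_join)
    moreover have "g ` {0..t} \<subseteq> T" using t T by (auto simp: path_image_def)
    ultimately have "seg w y = g ` {0..t} \<union> seg b y"
      using g h by (subst seg_eq_path_image[of "piece 0 t g +++ h"]) (auto simp: pathstart_def[of g])
    then show ?thesis using ends_in_seg assms bT by blast
  qed
  then show ?thesis using that b seg_commute assms by metis
qed

end

section \<open>Arms as directions seen from a point\<close>

context tree
begin

lemma seg_in_T: "z \<in> seg x y \<Longrightarrow> x \<in> T \<Longrightarrow> y \<in> T \<Longrightarrow> z \<in> T"
  using seg_subset by blast

lemma seg_mono:
  assumes "x \<in> T" "y \<in> T" "z \<in> seg x y"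
  shows "seg x z \<subseteq> seg x y" "seg z y \<subseteq> seg x y"
  using seg_split(1)[OF assms] by simp_all

lemma between_antisym:
  assumes "x \<in> T" "y \<in> T" "z \<in> seg x y" "x \<in> seg z y"
  shows "x = z"
proof -
  have "z \<in> T" using assms seg_in_T by metis
  then have "x \<in> seg x z \<inter> seg z y" using assms ends_in_seg by simp
  then show ?thesis using seg_split(2)[OF assms(1-3)] by simp
qed

lemma between_trans:
  assumes T: "x \<in> T" "y \<in> T" and z: "z \<in> seg x y" and w: "w \<in> seg x z"
  shows "w \<in> seg x y" "z \<in> seg w y"
proof -
  have zT: "z \<in> T" using z T seg_in_T by metis
  have wT: "w \<in> T" using w T zT seg_in_T by metis
  show wy: "w \<in> seg x y" using seg_mono(1)[OF T z] w by auto
  have "z \<in> seg x w \<or> z \<in> seg w y" using seg_split(1)[OF T wy] z by auto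
  then show "z \<in> seg w y"
  proof
    assume "z \<in> seg x w"
    then have "w = z"
      using between_antisym[OF wT T(1), of z] seg_commute[OF T(1) wT] seg_commute[OF T(1) zT] w by simp
    then show ?thesis using ends_in_seg(1)[OF wT T(2)] by simp
  qed
qed

definition dir :: "'a \<Rightarrow> 'a \<Rightarrow> 'a set" where
  "dir y x = connected_component_set (T - {y}) x"

text \<open>A point on an edge lies on the arc from \<open>x\<close> to one of the two ends of this
  edge. So finitely many arcs issuing from any \<open>x\<close> cover the tree.\<close>

lemma vertices:
  obtains V where "finite V" "V \<subseteq> T" "\<forall>x\<in>T. \<forall>y\<in>T. \<exists>v\<in>V. y \<in> seg x v"
proof -
  obtain V E where VE: "finite V" "finite E" "T = V \<union> (\<Union>g\<in>E. path_image g)"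
    "\<forall>g\<in>E. arc g \<and> pathstart g \<in> V \<and> pathfinish g \<in> V" by (rule graph)
  have "\<exists>v\<in>V. y \<in> seg x v" if xT: "x \<in> T" and yT: "y \<in> T" for x y
  proof (cases "y \<in> V")
    case True
    then show ?thesis using ends_in_seg(2)[OF xT yT] by blast
  next
    case False
    then obtain g where g: "g \<in> E" "y \<in> path_image g" using yT VE(3) by auto
    then have a: "arc g" "pathstart g \<in> V" "pathfinish g \<in> V" "path_image g \<subseteq> T"
      using VE(3,4) by auto
    then have pq: "pathstart g \<in> T" "pathfinish g \<in> T" using VE(3) by auto
    have "y \<in> seg (pathstart g) (pathfinish g)"
      using seg_eq_path_image[OF a(1) refl refl a(4)] g(2) by simp
    then have "y \<in> seg (pathstart g) x \<or> y \<in> seg x (pathfinish g)"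
      using seg_triangle[OF pq xT] by auto
    then show ?thesis using a(2,3) seg_commute[OF pq(1) xT] by auto
  qed
  then show ?thesis using VE(1,3) by (intro that[of V]) auto
qed

text \<open>\<open>T - {y}\<close> is the union of finitely many half-open arcs issuing from
  \<open>y\<close>, which are closed in it, and \<open>y\<close> does not separate two points of the
  same one.\<close>

lemma dir_clopen:
  assumes yT: "y \<in> T" and x: "x \<in> T - {y}"
  defines "K \<equiv> {w \<in> T - {y}. y \<notin> seg x w}"
  shows "openin (top_of_set (T - {y})) K" "closedin (top_of_set (T - {y})) K"
proof -
  obtain V where V: "finite V" "V \<subseteq> T" "\<forall>x\<in>T. \<forall>w\<in>T. \<exists>v\<in>V. w \<in> seg x v" by (rule vertices)
  define \<P> where "\<P> = (\<lambda>v. seg y v - {y}) ` V"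
  have fin: "finite \<P>" unfolding \<P>_def using V(1) by simp
  have un: "\<Union>\<P> = T - {y}"
  proof
    show "\<Union>\<P> \<subseteq> T - {y}" using seg_subset[OF yT] V(2) by (auto simp: \<P>_def)
    show "T - {y} \<subseteq> \<Union>\<P>"
    proof
      fix w assume w: "w \<in> T - {y}"
      then obtain v where "v \<in> V" "w \<in> seg y v" using V(3) yT by auto
      then show "w \<in> \<Union>\<P>" using w by (auto simp: \<P>_def)
    qed
  qed
  have cl: "closedin (top_of_set (T - {y})) P" if "P \<in> \<P>" for P
  proof -
    obtain v where v: "v \<in> V" "P = seg y v - {y}" using \<open>P \<in> \<P>\<close> by (auto simp: \<P>_def)
    have vT: "v \<in> T" using v V(2) by auto
    have "P = (T - {y}) \<inter> seg y v" using v seg_subset[OF yT vT] by auto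
    moreover have "closed (seg y v)" using compact_seg(1)[OF yT vT] by (rule compact_imp_closed)
    ultimately show ?thesis by (simp add: closedin_closed_Int)
  qed
  have pc: "P \<subseteq> K" if "P \<in> \<P>" "P \<inter> K \<noteq> {}" for P
  proof
    fix b assume b: "b \<in> P"
    obtain v where v: "v \<in> V" "P = seg y v - {y}" using \<open>P \<in> \<P>\<close> by (auto simp: \<P>_def)
    obtain p where p: "p \<in> P" "p \<in> K" using \<open>P \<inter> K \<noteq> {}\<close> by auto
    have vT: "v \<in> T" using v V(2) by auto
    have bs: "b \<in> seg y v" "b \<noteq> y" and ps: "p \<in> seg y v" "p \<noteq> y" using b p v by auto
    have bT: "b \<in> T" and pT: "p \<in> T" using bs ps seg_in_T[OF _ yT vT] by auto
    have xT: "x \<in> T" using x by simp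
    have "y \<notin> seg p b"
    proof
      assume y: "y \<in> seg p b"
      have "b \<in> seg y p \<or> b \<in> seg p v" using seg_split(1)[OF yT vT ps(1)] bs(1) by auto
      then show False
      proof
        assume "b \<in> seg y p"
        then show False
          using between_antisym[OF yT pT, of b] y bs(2) seg_commute[OF pT bT] by simp
      next
        assume "b \<in> seg p v"
        then have "y \<in> seg p v" using seg_mono(1)[OF pT vT] y by auto
        then show False using between_antisym[OF yT vT ps(1)] ps(2) by simp
      qed
    qed
    moreover have "y \<notin> seg x p" using p by (simp add: K_def)
    ultimately have "y \<notin> seg x b" using seg_triangle[OF xT bT pT] by auto
    then show "b \<in> K" using bT bs(2) by (simp add: K_def)
  qed
  have KT: "K \<subseteq> T - {y}" by (auto simp: K_def)
  show "openin (top_of_set (T - {y})) K"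
    using fin un cl KT pc by (rule clopen_if_union_of_pieces(1))
  show "closedin (top_of_set (T - {y})) K"
    using fin un cl KT pc by (rule clopen_if_union_of_pieces(2))
qed

lemma dir_conv:
  assumes yT: "y \<in> T" and x: "x \<in> T - {y}"
  shows "dir y x = {w \<in> T - {y}. y \<notin> seg x w}"
proof
  show "dir y x \<subseteq> {w \<in> T - {y}. y \<notin> seg x w}"
    unfolding dir_def
  proof (rule connected_subset_clopen[OF dir_clopen[OF assms]])
    show "connected (connected_component_set (T - {y}) x)" by simp
    show "connected_component_set (T - {y}) x \<subseteq> T - {y}" by (rule connected_component_subset)
    have "x \<in> connected_component_set (T - {y}) x" using x by simp
    moreover have "x \<in> {w \<in> T - {y}. y \<notin> seg x w}" using x by auto
    ultimately show "connected_component_set (T - {y}) x \<inter> {w \<in> T - {y}. y \<notin> seg x w} \<noteq> {}"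
      by (metis IntI empty_iff)
  qed
  show "{w \<in> T - {y}. y \<notin> seg x w} \<subseteq> dir y x"
  proof
    fix w assume w: "w \<in> {w \<in> T - {y}. y \<notin> seg x w}"
    then have "connected_component (T - {y}) x w"
      using compact_seg(2)[of x w] seg_subset[of x w] x ends_in_seg[of x w]
      by (intro connected_componentI[of "seg x w"]) auto
    then show "w \<in> dir y x" by (simp add: dir_def)
  qed
qed

lemma dir_eq_iff:
  assumes "y \<in> T" "x \<in> T - {y}" "w \<in> T - {y}"
  shows "dir y x = dir y w \<longleftrightarrow> y \<notin> seg x w"
proof -
  have "dir y x = dir y w \<longleftrightarrow> connected_component (T - {y}) x w"
    unfolding dir_def connected_component_eq_eq using assms by simp
  also have "\<dots> \<longleftrightarrow> w \<in> dir y x" by (simp add: dir_def)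
  also have "\<dots> \<longleftrightarrow> y \<notin> seg x w" using dir_conv[OF assms(1,2)] assms(3) by simp
  finally show ?thesis .
qed

lemma in_dir_iff:
  assumes "y \<in> T" "x \<in> T - {y}"
  shows "w \<in> dir y x \<longleftrightarrow> w \<in> T - {y} \<and> dir y w = dir y x"
proof -
  have "w \<in> dir y x \<longleftrightarrow> w \<in> T - {y} \<and> y \<notin> seg x w" using dir_conv[OF assms] by simp
  then show ?thesis using dir_eq_iff[OF assms, of w] by metis
qed

lemma arms_eq: "arms T y = dir y ` (T - {y})"
  by (simp add: arms_def components_def dir_def[abs_def])

lemma dir_in_arms: "x \<in> T - {y} \<Longrightarrow> dir y x \<in> arms T y"
  by (simp add: arms_eq)

lemma finite_arms:
  assumes "y \<in> T"
  shows "finite (arms T y)"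
proof -
  obtain V where V: "finite V" "V \<subseteq> T" "\<forall>x\<in>T. \<forall>w\<in>T. \<exists>v\<in>V. w \<in> seg x v" by (rule vertices)
  have "arms T y \<subseteq> dir y ` V"
  proof
    fix A assume "A \<in> arms T y"
    then obtain w where w: "w \<in> T - {y}" "A = dir y w" unfolding arms_eq by (rule imageE)
    then obtain v where v: "v \<in> V" "w \<in> seg y v" using V(3) assms by auto
    then have vT: "v \<in> T" using V(2) by auto
    have "v \<noteq> y" using v w by auto
    moreover have "y \<notin> seg w v" using between_antisym[OF assms vT v(2)] w by auto
    ultimately have "A = dir y v" using dir_eq_iff[OF assms w(1), of v] w(2) vT by simp
    then show "A \<in> dir y ` V" using v by simp
  qed
  then show ?thesis using V(1) finite_surj by blast
qed

lemma openin_dir: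
  assumes "y \<in> T" "x \<in> T - {y}"
  shows "openin (top_of_set T) (dir y x)"
proof -
  have "openin (top_of_set (T - {y})) (dir y x)"
    unfolding dir_conv[OF assms] by (rule dir_clopen(1)[OF assms])
  moreover have "openin (top_of_set T) (T - {y})"
    by (simp add: openin_delete)
  ultimately show ?thesis by (rule openin_trans)
qed

text \<open>This prevents the eventuality in \<open>local_arm_map\<close> from being vacuous, so
  that it determines the image arm uniquely.\<close>

lemma at_within_dir_nontrivial:
  assumes "y \<in> T" "x \<in> T - {y}"
  shows "at y within dir y x \<noteq> bot"
proof
  assume "at y within dir y x = bot"
  then have "\<not> y islimpt dir y x" using trivial_limit_within by blast
  then obtain U where U: "open U" "y \<in> U" "\<And>w. w \<in> dir y x \<Longrightarrow> w \<in> U \<Longrightarrow> w = y"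
    unfolding islimpt_def by auto
  have xT: "x \<in> T" using assms by simp
  have sub: "seg y x - {y} \<subseteq> dir y x"
  proof
    fix w assume w: "w \<in> seg y x - {y}"
    then have "w \<in> T" using seg_in_T assms(1) xT by auto
    moreover have "y \<notin> seg w x" using between_antisym[OF assms(1) xT, of w] w by auto
    ultimately show "w \<in> dir y x"
      using dir_conv[OF assms] w seg_commute[of w x] xT by auto
  qed
  have y: "y \<in> seg y x" "x \<in> seg y x" using ends_in_seg assms(1) xT by auto
  have "seg y x \<inter> U = {y}" using U sub y assms by auto
  then have "openin (top_of_set (seg y x)) {y}" using U(1) by (metis openin_open_Int)
  moreover have "closedin (top_of_set (seg y x)) {y}" using y by (simp add: closed_subset)
  ultimately have "{y} = seg y x"
    using compact_seg(2)[OF assms(1) xT] unfolding connected_clopen by (metis insert_not_empty)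
  then show False using y assms by auto
qed

text \<open>Choose \<open>v\<close> among the vertices in the arm with the largest number of these
  vertices on \<open>[x,v]\<close>. A point beyond \<open>v\<close> would lead to a vertex with a
  larger number.\<close>

lemma endpoint_in_arm:
  assumes xT: "x \<in> T" and y: "y \<in> T - {x}"
  obtains e where "tree_endpoint T e" "e \<in> dir x y"
proof -
  obtain V where V: "finite V" "V \<subseteq> T" "\<forall>x\<in>T. \<forall>w\<in>T. \<exists>v\<in>V. w \<in> seg x v" by (rule vertices)
  define A where "A = V \<inter> dir x y"
  have next_in_A: "\<exists>u\<in>A. w \<in> seg x u" if w: "w \<in> dir x y" for w
  proof -
    have wT: "w \<in> T - {x}" "dir x w = dir x y" using in_dir_iff[OF xT y, of w] w by auto
    then have "\<exists>u\<in>V. w \<in> seg x u" using V(3) xT by simp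
    then obtain u where u: "u \<in> V" "w \<in> seg x u" by auto
    then have uT: "u \<in> T" using V(2) by auto
    have "x \<notin> seg w u" using between_antisym[OF xT uT u(2)] wT by auto
    moreover have "u \<noteq> x" using u wT by auto
    ultimately have "dir x w = dir x u" using dir_eq_iff[OF xT wT(1), of u] uT by simp
    then have "u \<in> dir x y" using in_dir_iff[OF xT y, of u] wT(2) uT \<open>u \<noteq> x\<close> by simp
    then show ?thesis using u by (auto simp: A_def)
  qed
  have "y \<in> dir x y" using in_dir_iff[OF xT y, of y] y by simp
  then have "A \<noteq> {}" using next_in_A by auto
  moreover have finA: "finite A" using V(1) by (simp add: A_def)
  ultimately have "Max ((\<lambda>v. card (A \<inter> seg x v)) ` A) \<in> (\<lambda>v. card (A \<inter> seg x v)) ` A"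
    by (intro Max_in) auto
  then obtain v where v: "v \<in> A" "card (A \<inter> seg x v) = Max ((\<lambda>v. card (A \<inter> seg x v)) ` A)" by auto
  have v_max: "card (A \<inter> seg x u) \<le> card (A \<inter> seg x v)" if "u \<in> A" for u
    unfolding v(2) using that finA by (intro Max_ge) auto
  have vT: "v \<in> T" "v \<noteq> x" "v \<in> dir x y"
    using v in_dir_iff[OF xT y, of v] by (auto simp: A_def)
  have xv: "x \<in> T - {v}" using xT vT by simp
  have single: "dir v w = dir v x" if w: "w \<in> T - {v}" for w
  proof (rule ccontr)
    assume "dir v w \<noteq> dir v x"
    then have vs: "v \<in> seg x w" using dir_eq_iff[OF vT(1) w xv] w xT seg_commute by auto
    have wx: "w \<noteq> x" using vs vT by auto
    have wT: "w \<in> T" using w by simp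
    have "x \<notin> seg v w" using between_antisym[OF xT wT vs] vT by auto
    then have "dir x w = dir x v" using dir_eq_iff[OF xT, of v w] vT wT wx by simp
    then have "w \<in> dir x y"
      using in_dir_iff[OF xT y, of w] in_dir_iff[OF xT y, of v] vT(3) wT wx by simp
    then obtain u where u: "u \<in> A" "w \<in> seg x u" using next_in_A by auto
    then have uT: "u \<in> T" using V(2) by (auto simp: A_def)
    have vu: "v \<in> seg x u" using between_trans(1)[OF xT uT u(2) vs] .
    have "u \<notin> seg x v"
    proof
      assume "u \<in> seg x v"
      then have "u = v"
        using between_antisym[OF uT xT, of v] vu seg_commute[OF xT uT] seg_commute[OF xT vT(1)] by simp
      then have "w = v"
        using between_antisym[OF vT(1) xT, of w] u(2) vs seg_commute[OF xT wT] seg_commute[OF xT vT(1)]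
        by simp
      then show False using w by simp
    qed
    then have "A \<inter> seg x v \<subset> A \<inter> seg x u"
      using seg_mono(1)[OF xT uT vu] u(1) ends_in_seg(2)[OF xT uT] by auto
    then have "card (A \<inter> seg x v) < card (A \<inter> seg x u)" using finA by (intro psubset_card_mono) auto
    then show False using v_max[OF u(1)] by simp
  qed
  have "dir v ` (T - {v}) = {dir v x}"
  proof
    show "dir v ` (T - {v}) \<subseteq> {dir v x}"
    proof (rule image_subsetI)
      fix w assume "w \<in> T - {v}"
      from single[OF this] show "dir v w \<in> {dir v x}" by simp
    qed
    show "{dir v x} \<subseteq> dir v ` (T - {v})" using xv by (intro subsetI) (metis imageI singletonD)
  qed
  then have "arms T v = {dir v x}" unfolding arms_eq .
  then have "tree_endpoint T v" using vT by (simp add: tree_endpoint_def)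
  then show ?thesis using that vT by simp
qed

text \<open>A coincidence \<open>h s = h u\<close> of least distance bounds a simple loop. It exists
  by compactness, as local injectivity keeps coincidences in the interior away from the diagonal.
  Nothing is assumed at 0 and 1, because the critical point may sit there; the ends are treated
  last.\<close>

lemma inj_if_locally_inj:
  fixes h :: "real \<Rightarrow> 'a"
  assumes path: "path h" and im: "path_image h \<subseteq> T"
    and loc: "\<And>t. 0 < t \<Longrightarrow> t < 1 \<Longrightarrow> \<exists>U. open U \<and> t \<in> U \<and> inj_on h (U \<inter> {0..1})"
  shows "inj_on h {0..1}"
proof -
  have no_pair: False if su: "0 \<le> s" "s < u" "u \<le> 1" "h s = h u" and inj: "inj_on h {s..<u}" for s u
  proof -
    have "linepath s u ` {0..1} = {s..u}" using su by (simp add: path_image_def[symmetric] closed_segment_eq_real_ivl)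
    then have rng: "linepath s u t \<in> {s..u}" if "t \<in> {0..1}" for t using that by blast
    have val: "linepath s u t = s + (u - s) * t" for t by (simp add: linepath_def algebra_simps)
    have "simple_path (piece s u h)"
    proof (rule simple_pathI)
      show "path (piece s u h)" using path su by (intro path_piece) auto
      fix x y :: real assume xy: "0 \<le> x" "x < y" "y \<le> 1" "piece s u h x = piece s u h y"
      let ?x = "linepath s u x" and ?y = "linepath s u y"
      have h: "h ?x = h ?y" using xy by (simp add: piece_def)
      have lt: "?x < ?y" using xy su by (simp add: val)
      have "?x \<in> {s..<u}" "?y \<in> {s..u}" using rng[of x] rng[of y] xy lt by auto
      then consider "?y \<in> {s..<u}" | "?y = u" by fastforce
      then show "x = 0 \<and> y = 1"
      proof cases
        case 1
        then show ?thesis using inj_onD[OF inj h \<open>?x \<in> {s..<u}\<close>] lt by simp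
      next
        case 2
        then have "?x = s" using inj_onD[OF inj _ \<open>?x \<in> {s..<u}\<close>, of s] h su by simp
        then have "(u - s) * x = 0" "(u - s) * (y - 1) = 0" using 2 by (simp_all add: val algebra_simps)
        then show ?thesis using su by simp
      qed
    qed
    moreover have "path_image (piece s u h) \<subseteq> T"
      using path_image_piece_subset[of s u h] su im by auto
    ultimately show False using no_loop su by (metis piece_ends)
  qed
  have interior: False if su: "0 < s" "s < u" "u < 1" "h s = h u" for s u
  proof -
    define h' where "h' = (\<lambda>t. h (max 0 (min 1 t)))"
    have h': "h' t = h t" if "t \<in> {0..1}" for t using that by (simp add: h'_def)
    have ch: "continuous_on UNIV h'"
    proof -
      have "continuous_on UNIV (\<lambda>t::real. max 0 (min 1 t))" by (intro continuous_intros)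
      moreover have "continuous_on ((\<lambda>t::real. max 0 (min 1 t)) ` UNIV) h"
        by (rule continuous_on_subset[OF path[unfolded path_def]]) auto
      ultimately show ?thesis
        unfolding h'_def using continuous_on_compose[of UNIV "\<lambda>t::real. max 0 (min 1 t)" h]
        by (simp only: comp_def)
    qed
    \<comment> \<open>\<open>N\<close> is an open neighbourhood of the diagonal over the open unit
      interval and contains no coincidence of two different parameters; removing it leaves a compact
      set of coincidences.\<close>
    define N where "N = \<Union>{U \<times> U | U. open U \<and> inj_on h (U \<inter> {0..1})}"
    define D where "D = (({s..u} \<times> {s..u}) \<inter> {p. h' (fst p) = h' (snd p)}) - N"
    have "open N" unfolding N_def by (intro open_Union) (auto intro: open_Times)
    moreover have "closed {p. h' (fst p) = h' (snd p)}"
      by (intro closed_Collect_eq continuous_on_compose2[OF ch] continuous_intros) auto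
    ultimately have "compact D" unfolding D_def
      by (intro compact_diff compact_Int_closed compact_Times compact_Icc)
    have D_iff: "(a, b) \<in> D \<longleftrightarrow> a \<in> {s..u} \<and> b \<in> {s..u} \<and> h a = h b \<and> a \<noteq> b" for a b
    proof
      assume ab: "(a, b) \<in> D"
      then have ab': "a \<in> {s..u}" "b \<in> {s..u}" "h a = h b" "(a, b) \<notin> N"
        using su h'[of a] h'[of b] by (auto simp: D_def)
      moreover have "a \<noteq> b"
      proof
        assume "a = b"
        obtain U where "open U" "a \<in> U" "inj_on h (U \<inter> {0..1})" using loc[of a] ab' su by auto
        then have "U \<times> U \<in> {U \<times> U | U. open U \<and> inj_on h (U \<inter> {0..1})}" by blast
        then have "(a, b) \<in> N" using \<open>a = b\<close> \<open>a \<in> U\<close> unfolding N_def by (intro UnionI) auto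
        then show False using ab' by simp
      qed
      ultimately show "a \<in> {s..u} \<and> b \<in> {s..u} \<and> h a = h b \<and> a \<noteq> b" by simp
    next
      assume ab: "a \<in> {s..u} \<and> b \<in> {s..u} \<and> h a = h b \<and> a \<noteq> b"
      have "(a, b) \<notin> N"
      proof
        assume "(a, b) \<in> N"
        then obtain W where "W \<in> {U \<times> U | U. open U \<and> inj_on h (U \<inter> {0..1})}" "(a, b) \<in> W"
          unfolding N_def by (rule UnionE)
        then obtain U where U: "a \<in> U" "b \<in> U" "inj_on h (U \<inter> {0..1})" by auto
        then have "a = b" using inj_onD[OF U(3), of a b] ab su by auto
        then show False using ab by simp
      qed
      then show "(a, b) \<in> D" using ab su h'[of a] h'[of b] by (auto simp: D_def)
    qed
    have "D \<noteq> {}" using D_iff[of s u] su by auto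
    moreover have "continuous_on D (\<lambda>p. \<bar>snd p - fst p\<bar>)" by (intro continuous_intros)
    ultimately obtain p where p: "p \<in> D" "\<And>p'. p' \<in> D \<Longrightarrow> \<bar>snd p - fst p\<bar> \<le> \<bar>snd p' - fst p'\<bar>"
      using continuous_attains_inf[OF \<open>compact D\<close>, of "\<lambda>p. \<bar>snd p - fst p\<bar>"] by auto
    define a where "a = min (fst p) (snd p)"
    define b where "b = max (fst p) (snd p)"
    have "(fst p, snd p) \<in> D" using p(1) by simp
    then have ab: "a \<in> {s..u}" "b \<in> {s..u}" "h a = h b" "a < b"
      unfolding D_iff by (auto simp: a_def b_def min_def max_def)
    have dist: "\<bar>snd p - fst p\<bar> = b - a" by (simp add: a_def b_def)
    have "inj_on h {a..<b}"
    proof (rule inj_onI)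
      fix x y assume xy: "x \<in> {a..<b}" "y \<in> {a..<b}" "h x = h y"
      show "x = y"
      proof (rule ccontr)
        assume "x \<noteq> y"
        then have "(x, y) \<in> D" unfolding D_iff using xy ab by auto
        then show False using p(2)[of "(x, y)"] xy dist by auto
      qed
    qed
    then show False using no_pair[of a b] ab su by auto
  qed
  have open_inj: "x = y" if "0 < x" "x < 1" "0 < y" "y < 1" "h x = h y" for x y
    using interior[of x y] interior[of y x] that by (metis linorder_neqE_linordered_idom)
  have left: False if "0 < b" "b < 1" "h 0 = h b" for b
  proof (rule no_pair[of 0 b])
    show "inj_on h {0..<b}"
    proof (rule inj_onI)
      fix x y assume "x \<in> {0..<b}" "y \<in> {0..<b}" "h x = h y"
      then show "x = y" using open_inj[of x y] open_inj[of x b] open_inj[of y b] that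
        by (cases "x = 0"; cases "y = 0") auto
    qed
  qed (use that in auto)
  have right: False if "0 < a" "a < 1" "h a = h 1" for a
  proof (rule no_pair[of a 1])
    show "inj_on h {a..<1}" using open_inj that by (intro inj_onI) auto
  qed (use that in auto)
  have ends: "h 0 \<noteq> h 1"
  proof
    assume "h 0 = h 1"
    show False
    proof (rule no_pair[of 0 1])
      show "inj_on h {0..<1}"
      proof (rule inj_onI)
        fix x y :: real assume "x \<in> {0..<1}" "y \<in> {0..<1}" "h x = h y"
        then show "x = y" using open_inj[of x y] left[of x] left[of y]
          by (cases "x = 0"; cases "y = 0") auto
      qed
    qed (use \<open>h 0 = h 1\<close> in auto)
  qed
  have "x = y" if "x \<in> {0..1}" "y \<in> {0..1}" "h x = h y" "x \<le> y" for x y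
  proof (rule ccontr)
    assume "x \<noteq> y"
    then show False
      using that ends left[of y] right[of x] open_inj[of x y] by (cases "x = 0"; cases "y = 1") auto
  qed
  then show ?thesis by (intro inj_onI) (metis linear)
qed

end

subsection \<open>Dynamics on Hubbard trees\<close>

context tree
begin

lemma dir_seg:
  assumes "y \<in> T" "x \<in> T" "w \<in> seg y x" "w \<noteq> y"
  shows "dir y w = dir y x" "w \<in> T - {y}" "x \<in> T - {y}"
proof -
  have wT: "w \<in> T" using assms seg_in_T by metis
  have "y \<notin> seg w x" using between_antisym[OF assms(1-3)] assms(4) by auto
  moreover have xy: "x \<noteq> y" using assms by auto
  ultimately show "dir y w = dir y x" using dir_eq_iff[of y w x] assms wT by simp
  show "w \<in> T - {y}" "x \<in> T - {y}" using wT xy assms by simp_all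
qed

end

locale hubbard = tree T for T :: "'a::t2_space set" +
  fixes f :: "'a \<Rightarrow> 'a" and c :: 'a
  assumes hubbard_tree: "hubbard_tree T f c"
begin

lemma c_in_T: "c \<in> T"
  and f_cont: "continuous_on T f"
  and f_image: "f ` T = T"
  and two_to_one: "y \<in> T \<Longrightarrow> finite {x \<in> T. f x = y} \<and> card {x \<in> T. f x = y} \<le> 2"
  and endpoint_in_orbit: "tree_endpoint T x \<Longrightarrow> x \<in> orbit_of f c"
  and fc_neq: "f c \<noteq> c"
  using hubbard_tree unfolding hubbard_tree_def by simp_all

lemma local_homeo:
  assumes "x \<in> T - {c}"
  obtains U where "openin (top_of_set T) U" "x \<in> U" "inj_on f U"
proof -
  have "\<exists>U. openin (top_of_set T) U \<and> x \<in> U \<and> (\<exists>g. homeomorphism U (f ` U) f g)"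
    using hubbard_tree assms unfolding hubbard_tree_def by simp
  then obtain U g where U: "openin (top_of_set T) U" "x \<in> U" "homeomorphism U (f ` U) f g" by auto
  from U(3) have "inj_on f U" unfolding homeomorphism_def by (metis inj_on_inverseI)
  then show ?thesis using that U by simp
qed

definition vertex :: "'a \<Rightarrow> bool" where
  "vertex x \<longleftrightarrow> branch_point T x \<or> x \<in> orbit_of f c"

lemma expansive:
  assumes "vertex x" "vertex y" "x \<noteq> y"
  shows "\<exists>n. c \<in> (f ^^ n) ` seg x y"
  using hubbard_tree assms unfolding hubbard_tree_def vertex_def by simp

lemma f_in_T: "x \<in> T \<Longrightarrow> f x \<in> T"
  using f_image by auto

lemma iter_in_T: "x \<in> T \<Longrightarrow> (f ^^ n) x \<in> T"
  by (induction n) (auto simp: f_in_T)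

lemma vertex_in_T: "vertex x \<Longrightarrow> x \<in> T"
  using iter_in_T[OF c_in_T] by (auto simp: vertex_def branch_point_def orbit_of_def)

text \<open>The critical point can only be an end of the arc, so \<open>f\<close> is locally
  injective along the interior; in a tree this suffices.\<close>

lemma seg_image:
  assumes xT: "x \<in> T" and yT: "y \<in> T" and c: "c \<in> seg x y \<Longrightarrow> c = x \<or> c = y"
  shows "inj_on f (seg x y)" "f ` seg x y = seg (f x) (f y)"
proof -
  have "inj_on f (seg x y) \<and> f ` seg x y = seg (f x) (f y)"
  proof (cases "x = y")
    case False
    obtain g where g: "arc g" "pathstart g = x" "pathfinish g = y" "path_image g = seg x y" "seg x y \<subseteq> T"
      using xT yT False by (rule seg_arc)
    have inj: "inj_on g {0..1}" and cg: "continuous_on {0..1} g" using g(1) by (auto simp: arc_def path_def)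
    have im: "path_image (f \<circ> g) = f ` seg x y" using g(4) unfolding path_image_def by (metis image_comp)
    have imT: "path_image (f \<circ> g) \<subseteq> T" using im g(5) f_image by auto
    have path: "path (f \<circ> g)"
      using g f_cont by (intro path_continuous_image) (auto simp: arc_imp_path intro: continuous_on_subset)
    have "inj_on (f \<circ> g) {0..1}"
    proof (rule inj_if_locally_inj[OF path imT])
      fix t :: real assume t: "0 < t" "t < 1"
      have "g t \<noteq> g 0" "g t \<noteq> g 1" using inj_onD[OF inj, of t 0] inj_onD[OF inj, of t 1] t by auto
      then have "g t \<noteq> x" "g t \<noteq> y" using g by (auto simp: pathstart_def pathfinish_def)
      moreover have gt: "g t \<in> seg x y" using g(4) t by (auto simp: path_image_def)
      ultimately have "g t \<in> T - {c}" using c g(5) by auto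
      then obtain U where U: "openin (top_of_set T) U" "g t \<in> U" "inj_on f U" by (rule local_homeo)
      then obtain O' where O': "open O'" "U = T \<inter> O'" by (auto simp: openin_open)
      obtain W where W: "open W" "W \<inter> {0..1} = g -` O' \<inter> {0..1}"
        using cg O'(1) unfolding continuous_on_open_invariant by metis
      have gW: "g ` (W \<inter> {0..1}) \<subseteq> U"
        using W(2) O' g(4,5) by (auto simp: path_image_def)
      have "inj_on (f \<circ> g) (W \<inter> {0..1})"
        by (intro comp_inj_on inj_on_subset[OF inj] inj_on_subset[OF U(3) gW]) simp
      moreover have "t \<in> W" using W(2) U(2) O' t by auto
      ultimately show "\<exists>U. open U \<and> t \<in> U \<and> inj_on (f \<circ> g) (U \<inter> {0..1})" using W(1) by auto
    qed
    then have "arc (f \<circ> g)" "inj_on f (g ` {0..1})"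
      using path by (auto simp: arc_def intro: inj_on_imageI)
    moreover from this(1) have "seg (f x) (f y) = path_image (f \<circ> g)"
      using g imT by (intro seg_eq_path_image) (auto simp: pathstart_def pathfinish_def)
    ultimately show ?thesis using g(4) im by (simp add: path_image_def)
  qed simp
  then show "inj_on f (seg x y)" "f ` seg x y = seg (f x) (f y)" by auto
qed

lemma dir_image:
  assumes yT: "y \<in> T" and xT: "x \<in> T" and c: "c \<in> seg y x \<Longrightarrow> c = y \<or> c = x"
    and w: "w \<in> seg y x" "w \<noteq> y"
  shows "f w \<noteq> f y" "dir (f y) (f w) = dir (f y) (f x)" "f x \<noteq> f y"
proof -
  note im = seg_image[OF yT xT c]
  have y: "y \<in> seg y x" "x \<in> seg y x" using ends_in_seg[OF yT xT] by auto
  show neq: "f w \<noteq> f y" using inj_onD[OF im(1) _ w(1) y(1)] w(2) by auto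
  have "f w \<in> seg (f y) (f x)" using im(2) w(1) by auto
  then show "dir (f y) (f w) = dir (f y) (f x)" "f x \<noteq> f y"
    using dir_seg[OF f_in_T[OF yT] f_in_T[OF xT]] neq by auto
qed

text \<open>The initial part of \<open>[y,x]\<close> on which \<open>f\<close> is injective ends at \<open>cut y x\<close>.\<close>

definition cut :: "'a \<Rightarrow> 'a \<Rightarrow> 'a" where
  "cut y x = (if c \<in> seg y x then c else x)"

lemma cut:
  assumes "y \<in> T - {c}" "x \<in> T - {y}"
  shows "cut y x \<in> T - {y}" "cut y x \<in> seg y x" "c \<in> seg y (cut y x) \<Longrightarrow> c = cut y x"
  using assms c_in_T ends_in_seg[of y x] by (auto simp: cut_def split: if_splits)

text \<open>A point \<open>u\<close> of the arm near \<open>y\<close> is not separated from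
  \<open>y\<close> by the critical point, and \<open>[y,u]\<close> shares an initial arc
  \<open>[y,w]\<close> with \<open>[y, cut y x]\<close>. Since \<open>f\<close> is injective on
  both, their images leave \<open>f y\<close> in the direction of \<open>f w\<close>.\<close>

lemma local_arm_map_dir:
  assumes y: "y \<in> T - {c}" and x: "x \<in> T - {y}"
  shows "local_arm_map T f (y, dir y x) = (f y, dir (f y) (f (cut y x)))"
    and "f (cut y x) \<in> T - {f y}"
proof -
  define p where "p = cut y x"
  have yT: "y \<in> T" and xT: "x \<in> T" using y x by auto
  have p: "p \<in> T - {y}" "p \<in> seg y x" "c \<in> seg y p \<Longrightarrow> c = y \<or> c = p"
    using cut[OF y x] by (auto simp: p_def)
  have pT: "p \<in> T" "p \<noteq> y" using p by auto
  have p_end: "p \<in> seg y p" using ends_in_seg[OF yT pT(1)] by simp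
  have fp: "f p \<noteq> f y" using dir_image(1)[OF yT pT(1) p(3) p_end pT(2)] .
  show "f (cut y x) \<in> T - {f y}" using fp f_in_T[OF pT(1)] by (simp add: p_def)
  have fyT: "f y \<in> T" "f p \<in> T - {f y}" using f_in_T yT pT fp by auto
  have dir_p: "dir y p = dir y x" using dir_seg(1)[OF yT xT p(2) pT(2)] .
  let ?B = "dir (f y) (f p)"
  have ev: "\<forall>\<^sub>F u in at y within dir y x. f u \<in> ?B"
  proof -
    have yc: "y \<in> T - {c}" using y .
    obtain O' where O': "open O'" "dir c y = T \<inter> O'"
      using openin_dir[OF c_in_T yc] by (auto simp: openin_open)
    have "y \<in> dir c y" using in_dir_iff[OF c_in_T yc, of y] yc by simp
    then have yO: "y \<in> O'" using O' by auto
    have "f u \<in> ?B" if u: "u \<in> O'" "u \<in> dir y x" for u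
    proof -
      have u': "u \<in> T - {y}" "dir y u = dir y x" using in_dir_iff[OF yT x, of u] u(2) by auto
      then have uT: "u \<in> T" "u \<noteq> y" by auto
      have "u \<in> dir c y" using O'(2) u(1) uT by simp
      then have cu: "c \<notin> seg y u" using dir_conv[OF c_in_T yc] by simp
      obtain w where w: "w \<in> seg y u" "w \<in> seg u p" "w \<in> seg y p"
        using yT uT(1) pT(1) by (rule median)
      have "y \<notin> seg u p" using dir_eq_iff[OF yT u'(1) p(1)] u'(2) dir_p by simp
      then have wy: "w \<noteq> y" using w(2) by auto
      have "dir (f y) (f w) = dir (f y) (f u)" "f u \<noteq> f y"
        using dir_image[OF yT uT(1) _ w(1) wy] cu by auto
      moreover have "dir (f y) (f w) = ?B" using dir_image(2)[OF yT pT(1) p(3) w(3) wy] .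
      ultimately show ?thesis using in_dir_iff[OF fyT, of "f u"] f_in_T[OF uT(1)] by simp
    qed
    then show ?thesis unfolding eventually_at_topological using O'(1) yO by auto
  qed
  have "(THE B. B \<in> arms T (f y) \<and> (\<forall>\<^sub>F u in at y within dir y x. f u \<in> B)) = ?B"
  proof (rule the_equality)
    show "?B \<in> arms T (f y) \<and> (\<forall>\<^sub>F u in at y within dir y x. f u \<in> ?B)"
      using ev dir_in_arms[OF fyT(2)] by simp
    fix B assume B: "B \<in> arms T (f y) \<and> (\<forall>\<^sub>F u in at y within dir y x. f u \<in> B)"
    then have "\<forall>\<^sub>F u in at y within dir y x. f u \<in> ?B \<and> f u \<in> B" using ev by (auto intro: eventually_conj)
    then obtain u where u: "f u \<in> ?B" "f u \<in> B"
      using eventually_happens'[OF at_within_dir_nontrivial[OF yT x]] by auto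
    obtain q where q: "q \<in> T - {f y}" "B = dir (f y) q" using B unfolding arms_eq by auto
    then show "B = ?B" using u in_dir_iff[OF fyT(1) q(1), of "f u"] in_dir_iff[OF fyT, of "f u"] by simp
  qed
  then show "local_arm_map T f (y, dir y x) = (f y, dir (f y) (f (cut y x)))"
    by (simp add: local_arm_map_def p_def)
qed

text \<open>The arc between the two cut points passes through \<open>y\<close> and contains the
  critical point at most as an end; so its image is an arc through \<open>f y\<close>.\<close>

lemma dir_cut_inj:
  assumes y: "y \<in> T - {c}" and x: "x \<in> T - {y}" and w: "w \<in> T - {y}" and neq: "dir y x \<noteq> dir y w"
  shows "dir (f y) (f (cut y x)) \<noteq> dir (f y) (f (cut y w))"
proof -
  define p q where "p = cut y x" and "q = cut y w"
  have yT: "y \<in> T" and xT: "x \<in> T" and wT: "w \<in> T" using y x w by auto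
  have p: "p \<in> T - {y}" "p \<in> seg y x" "c \<in> seg y p \<Longrightarrow> c = p"
    using cut[OF y x] by (auto simp: p_def)
  have q: "q \<in> T - {y}" "q \<in> seg y w" "c \<in> seg y q \<Longrightarrow> c = q"
    using cut[OF y w] by (auto simp: q_def)
  have pT: "p \<in> T" "p \<noteq> y" and qT: "q \<in> T" "q \<noteq> y" using p q by auto
  have "dir y p \<noteq> dir y q"
    using dir_seg(1)[OF yT xT p(2) pT(2)] dir_seg(1)[OF yT wT q(2) qT(2)] neq by simp
  then have ypq: "y \<in> seg p q" using dir_eq_iff[OF yT p(1) q(1)] by simp
  have "seg p q = seg y p \<union> seg y q" using seg_split(1)[OF pT(1) qT(1) ypq] seg_commute[OF pT(1) yT] by simp
  then have "c \<in> seg p q \<Longrightarrow> c = p \<or> c = q" using p(3) q(3) by auto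
  then have "f ` seg p q = seg (f p) (f q)" using seg_image(2)[OF pT(1) qT(1)] by simp
  then have "f y \<in> seg (f p) (f q)" using ypq by auto
  moreover have "f p \<in> T - {f y}" "f q \<in> T - {f y}"
    using local_arm_map_dir(2)[OF y x] local_arm_map_dir(2)[OF y w] by (auto simp: p_def q_def)
  ultimately show ?thesis
    using dir_eq_iff[OF f_in_T[OF yT], of "f p" "f q"] by (simp add: p_def q_def)
qed

section \<open>Arms along the critical orbit\<close>

abbreviation lam :: "'a \<times> 'a set \<Rightarrow> 'a \<times> 'a set" where
  "lam \<equiv> local_arm_map T f"

lemma lam_arm:
  assumes "y \<in> T - {c}" "A \<in> arms T y"
  shows "fst (lam (y, A)) = f y" "snd (lam (y, A)) \<in> arms T (f y)"
proof -
  obtain x where x: "x \<in> T - {y}" "A = dir y x" using assms(2) unfolding arms_eq by auto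
  show "fst (lam (y, A)) = f y" "snd (lam (y, A)) \<in> arms T (f y)"
    using local_arm_map_dir[OF assms(1) x(1)] x(2) by (auto intro: dir_in_arms)
qed

lemma lam_inj:
  assumes "y \<in> T - {c}"
  shows "inj_on (\<lambda>A. snd (lam (y, A))) (arms T y)"
proof (rule inj_onI)
  fix A B assume A: "A \<in> arms T y" and B: "B \<in> arms T y" and eq: "snd (lam (y, A)) = snd (lam (y, B))"
  obtain x where x: "x \<in> T - {y}" "A = dir y x" using A unfolding arms_eq by auto
  obtain w where w: "w \<in> T - {y}" "B = dir y w" using B unfolding arms_eq by auto
  show "A = B"
    using dir_cut_inj[OF assms x(1) w(1)] eq x w local_arm_map_dir(1)[OF assms x(1)]
      local_arm_map_dir(1)[OF assms w(1)] by auto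
qed

lemma card_arms_le:
  assumes "y \<in> T - {c}"
  shows "card (arms T y) \<le> card (arms T (f y))"
proof -
  have fin: "finite (arms T (f y))" using assms by (intro finite_arms f_in_T) simp
  have "(\<lambda>A. snd (lam (y, A))) ` arms T y \<subseteq> arms T (f y)" using lam_arm(2)[OF assms] by auto
  then show ?thesis using card_inj_on_le[OF lam_inj[OF assms] _ fin] by simp
qed

text \<open>The number of arms does not decrease along the orbit of the critical value until it hits
  the critical point, where the orbit starts over. With two arms at the critical value there would
  be no endpoint on this orbit, but the arm at \<open>c\<close> towards \<open>f c\<close> contains
  one.\<close>

lemma critical_value_endpoint: "card (arms T (f c)) = 1"
proof (rule ccontr)
  assume neq: "card (arms T (f c)) \<noteq> 1"
  have fcT: "f c \<in> T - {c}" "c \<in> T - {f c}" using f_in_T[OF c_in_T] c_in_T fc_neq by auto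
  then have "arms T (f c) \<noteq> {}" using dir_in_arms by auto
  then have ge: "2 \<le> card (arms T (f c))"
    using neq finite_arms[of "f c"] fcT by (metis DiffD1 One_nat_def Suc_1 Suc_leI card_gt_0_iff le_neq_implies_less)
  have orbit: "2 \<le> card (arms T ((f ^^ Suc n) c))" for n
  proof (induction n)
    case 0
    then show ?case using ge by simp
  next
    case (Suc n)
    show ?case
    proof (cases "(f ^^ Suc n) c = c")
      case True
      then have "(f ^^ Suc (Suc n)) c = f c" by simp
      then show ?thesis using ge by metis
    next
      case False
      then have "(f ^^ Suc n) c \<in> T - {c}" using iter_in_T[OF c_in_T] by blast
      from card_arms_le[OF this] Suc show ?thesis by simp
    qed
  qed
  obtain e where e: "tree_endpoint T e" "e \<in> dir c (f c)" using c_in_T fcT(1) by (rule endpoint_in_arm)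
  then have ec: "e \<noteq> c" using in_dir_iff[OF c_in_T fcT(1), of e] by simp
  obtain n where n: "e = (f ^^ n) c" using endpoint_in_orbit[OF e(1)] by (auto simp: orbit_of_def)
  then obtain n' where "n = Suc n'" using ec by (cases n) auto
  then show False using orbit[of n'] e(1) n by (simp add: tree_endpoint_def)
qed

lemma dir_critical_value:
  assumes "x \<in> T - {f c}" "y \<in> T - {f c}"
  shows "dir (f c) x = dir (f c) y"
proof -
  obtain A where "arms T (f c) = {A}" using critical_value_endpoint card_1_singletonE by metis
  then show ?thesis using dir_in_arms[OF assms(1)] dir_in_arms[OF assms(2)] by simp
qed

text \<open>The critical value being an endpoint, the images of three arcs that leave
  \<open>c\<close> in different directions share an initial arc. A point of it other than
  \<open>f c\<close> has three preimages.\<close>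

lemma at_most_two_arms_at_c:
  assumes x: "x \<in> T - {c}" "y \<in> T - {c}" "w \<in> T - {c}"
    and neq: "dir c x \<noteq> dir c y" "dir c x \<noteq> dir c w" "dir c y \<noteq> dir c w"
  shows False
proof -
  have T: "x \<in> T" "y \<in> T" "w \<in> T" "x \<noteq> c" "y \<noteq> c" "w \<noteq> c" using x by auto
  have fcT: "f c \<in> T" using c_in_T f_in_T by simp
  have im: "f ` seg c p = seg (f c) (f p)" "f p \<noteq> f c" "f p \<in> T" if "p \<in> T" "p \<noteq> c" for p
  proof -
    show "f ` seg c p = seg (f c) (f p)" using seg_image(2)[OF c_in_T that(1)] by simp
    show "f p \<noteq> f c"
      using dir_image(3)[OF c_in_T that(1) _ ends_in_seg(2)[OF c_in_T that(1)] that(2)] by simp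
    show "f p \<in> T" using that f_in_T by simp
  qed
  obtain u where u: "u \<in> seg (f c) (f x)" "u \<in> seg (f x) (f y)" "u \<in> seg (f c) (f y)"
    using fcT im(3)[OF T(1,4)] im(3)[OF T(2,5)] by (rule median)
  have uT: "u \<in> T" using seg_in_T[OF u(1)] fcT im(3) T by simp
  have "f c \<notin> seg (f x) (f y)"
    using dir_eq_iff[OF fcT, of "f x" "f y"] dir_critical_value[of "f x" "f y"] im T by simp
  then have ufc: "u \<noteq> f c" using u(2) by auto
  obtain v where v: "v \<in> seg (f c) u" "v \<in> seg u (f w)" "v \<in> seg (f c) (f w)"
    using fcT uT im(3)[OF T(3,6)] by (rule median)
  have "f c \<notin> seg u (f w)"
    using dir_eq_iff[OF fcT, of u "f w"] dir_critical_value[of u "f w"] im T uT ufc by simp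
  then have vfc: "v \<noteq> f c" using v(2) by auto
  have v3: "v \<in> seg (f c) (f x)" "v \<in> seg (f c) (f y)" "v \<in> seg (f c) (f w)"
    using seg_mono(1)[OF fcT im(3)[OF T(1,4)] u(1)] seg_mono(1)[OF fcT im(3)[OF T(2,5)] u(3)] v by auto
  have pre: "\<exists>q\<in>T. f q = v \<and> dir c q = dir c p" if p: "v \<in> seg (f c) (f p)" "p \<in> T" "p \<noteq> c" for p
  proof -
    obtain q where q: "q \<in> seg c p" "v = f q" using im(1)[OF p(2,3)] p(1) by auto
    then have "q \<noteq> c" using vfc by auto
    then show ?thesis using dir_seg[OF c_in_T p(2) q(1)] q(2) by auto
  qed
  obtain q1 where q1: "q1 \<in> T" "f q1 = v" "dir c q1 = dir c x" using pre[OF v3(1) T(1,4)] by auto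
  obtain q2 where q2: "q2 \<in> T" "f q2 = v" "dir c q2 = dir c y" using pre[OF v3(2) T(2,5)] by auto
  obtain q3 where q3: "q3 \<in> T" "f q3 = v" "dir c q3 = dir c w" using pre[OF v3(3) T(3,6)] by auto
  have "q1 \<noteq> q2" "q1 \<noteq> q3" "q2 \<noteq> q3" using q1(3) q2(3) q3(3) neq by auto
  then have "card {q1, q2, q3} = 3" by simp
  moreover have vT: "v \<in> T" using q1 f_in_T by auto
  have "card {q1, q2, q3} \<le> card {q \<in> T. f q = v}"
    using two_to_one[OF vT] q1 q2 q3 by (intro card_mono) auto
  ultimately show False using two_to_one[OF vT] by simp
qed

lemma c_not_branch: "\<not> branch_point T c"
proof
  assume "branch_point T c"
  then have "3 \<le> card (arms T c)" by (simp add: branch_point_def)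
  then obtain B where B: "B \<subseteq> arms T c" "card B = 3" using obtain_subset_with_card_n by metis
  then obtain A1 A2 A3 where A: "B = {A1, A2, A3}" "A1 \<noteq> A2" "A1 \<noteq> A3" "A2 \<noteq> A3"
    by (auto simp: card_3_iff)
  then have "A1 \<in> arms T c" "A2 \<in> arms T c" "A3 \<in> arms T c" using B by auto
  then obtain x y w where "x \<in> T - {c}" "A1 = dir c x" "y \<in> T - {c}" "A2 = dir c y"
    "w \<in> T - {c}" "A3 = dir c w" unfolding arms_eq by auto
  then show False using at_most_two_arms_at_c[of x y w] A by simp
qed

section \<open>Symbols, itineraries and legs\<close>

definition sy :: "'a \<Rightarrow> symbol" where
  "sy x = itinerary T f c x 1"

lemma itinerary_Suc: "itinerary T f c x (Suc n) = sy ((f ^^ n) x)"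
  by (simp add: sy_def itinerary_def)

lemma sy_eq_star_iff: "sy x = SymStar \<longleftrightarrow> x = c"
  by (simp add: sy_def itinerary_def)

text \<open>As the critical point has at most two arms, all points with the symbol
  \<open>Sym0\<close> lie in the same one.\<close>

lemma c_between_iff:
  assumes y: "y \<in> T" "y \<noteq> c" and x: "x \<in> T"
  shows "c \<in> seg y x \<longleftrightarrow> sy x \<noteq> sy y"
proof (cases "x = c")
  case True
  then show ?thesis using ends_in_seg[OF y(1) x] y(2) sy_eq_star_iff[of x] sy_eq_star_iff[of y] by auto
next
  case False
  have fcT: "f c \<in> T - {c}" using f_in_T[OF c_in_T] fc_neq by simp
  have yx: "y \<in> T - {c}" "x \<in> T - {c}" using y x False by auto
  have sy: "sy w = (if dir c w = dir c (f c) then Sym1 else Sym0)" if "w \<in> T - {c}" for w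
    using in_dir_iff[OF c_in_T fcT, of w] that by (simp add: sy_def itinerary_def dir_def)
  have "c \<in> seg y x \<longleftrightarrow> dir c y \<noteq> dir c x" using dir_eq_iff[OF c_in_T yx] by simp
  moreover have "dir c y = dir c x" if "dir c x \<noteq> dir c (f c)" "dir c y \<noteq> dir c (f c)"
    using at_most_two_arms_at_c[OF yx fcT] that by auto
  ultimately show ?thesis using sy[OF yx(1)] sy[OF yx(2)] by auto
qed

lemma seg_iterate:
  assumes "x \<in> T" "y \<in> T" "x \<noteq> y" "\<And>j. j < n \<Longrightarrow> sy ((f ^^ j) x) = sy ((f ^^ j) y)"
  shows "(f ^^ n) x \<noteq> (f ^^ n) y \<and> (f ^^ n) ` seg x y = seg ((f ^^ n) x) ((f ^^ n) y)"
  using assms(4)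
proof (induction n)
  case (Suc n)
  let ?x = "(f ^^ n) x" and ?y = "(f ^^ n) y"
  have IH: "?x \<noteq> ?y" "(f ^^ n) ` seg x y = seg ?x ?y" using Suc by auto
  have T: "?x \<in> T" "?y \<in> T" using iter_in_T assms by auto
  have sy: "sy ?x = sy ?y" using Suc.prems by simp
  have "?x \<noteq> c" using IH(1) sy sy_eq_star_iff[of ?x] sy_eq_star_iff[of ?y] by auto
  then have c: "c \<notin> seg ?x ?y" using c_between_iff[OF T(1) _ T(2)] sy by simp
  then have im: "inj_on f (seg ?x ?y)" "f ` seg ?x ?y = seg (f ?x) (f ?y)"
    using seg_image[OF T] by auto
  have "f ?x \<noteq> f ?y" using inj_onD[OF im(1)] ends_in_seg[OF T] IH(1) by auto
  moreover have "(f ^^ Suc n) ` seg x y = f ` ((f ^^ n) ` seg x y)" by (simp add: image_comp)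
  ultimately show ?case using IH(2) im(2) by simp
qed (use assms in simp)

text \<open>With equal itineraries, all iterates of \<open>[x,y]\<close> would be arcs between
  points on the same side of the critical point and never contain it, against expansivity.\<close>

lemma itineraries_differ:
  assumes "vertex x" "vertex y" "x \<noteq> y"
  obtains n where "sy ((f ^^ n) x) \<noteq> sy ((f ^^ n) y)"
    "\<forall>j<n. sy ((f ^^ j) x) = sy ((f ^^ j) y)"
proof -
  have T: "x \<in> T" "y \<in> T" using assms vertex_in_T by auto
  have "\<exists>n. sy ((f ^^ n) x) \<noteq> sy ((f ^^ n) y)"
  proof (rule ccontr)
    assume "\<not> ?thesis"
    then have eq: "sy ((f ^^ n) x) = sy ((f ^^ n) y)" for n by simp
    obtain n where n: "c \<in> (f ^^ n) ` seg x y" using expansive[OF assms] by auto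
    have it: "(f ^^ n) x \<noteq> (f ^^ n) y" "c \<in> seg ((f ^^ n) x) ((f ^^ n) y)"
      using seg_iterate[OF T assms(3) eq, of n] n by auto
    then have "(f ^^ n) x \<noteq> c" using eq[of n] sy_eq_star_iff[of "(f ^^ n) x"] sy_eq_star_iff[of "(f ^^ n) y"] by auto
    then show False using c_between_iff[OF iter_in_T[OF T(1)] _ iter_in_T[OF T(2)], of n n] it(2) eq[of n] by simp
  qed
  then obtain n where "sy ((f ^^ n) x) \<noteq> sy ((f ^^ n) y)" "\<forall>j<n. \<not> sy ((f ^^ j) x) \<noteq> sy ((f ^^ j) y)"
    using exists_least_iff[of "\<lambda>n. sy ((f ^^ n) x) \<noteq> sy ((f ^^ n) y)"] by auto
  then show ?thesis using that by simp
qed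

lemma f_cut:
  assumes "y \<in> T - {c}" "x \<in> T"
  shows "f (cut y x) = (if sy x = sy y then f x else f c)"
  using c_between_iff[of y x] assms by (simp add: cut_def)

definition \<nu> :: "nat \<Rightarrow> symbol" where
  "\<nu> = kneading_sequence T f c"

definition leg :: "nat \<Rightarrow> 'a" where
  "leg x = (f ^^ x) (f c)"

lemma sy_leg: "sy (leg x) = \<nu> (Suc x)"
  by (simp add: \<nu>_def leg_def kneading_sequence_def itinerary_Suc)

lemma leg_0 [simp]: "leg 0 = f c" and leg_Suc [simp]: "leg (Suc x) = f (leg x)"
  by (simp_all add: leg_def)

lemma leg_in_T: "leg x \<in> T"
  unfolding leg_def by (intro iter_in_T f_in_T c_in_T)

lemma leg_vertex: "vertex (leg x)"
proof -
  have "leg x = (f ^^ Suc x) c" by (simp add: leg_def funpow_swap1)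
  then show ?thesis unfolding vertex_def orbit_of_def by blast
qed

text \<open>Different symbols mean that the leg is cut at the critical point and restarts with index
  0, as in \<open>run\<close>. The inequality is part of the induction, since a direction requires
  two different points.\<close>

lemma lam_leg:
  assumes z: "z \<in> T" "\<And>n. (f ^^ n) z \<noteq> c" and neq: "(f ^^ t) z \<noteq> leg x"
  defines "\<tau> \<equiv> itinerary T f c z"
  shows "(lam ^^ n) ((f ^^ t) z, dir ((f ^^ t) z) (leg x)) =
      ((f ^^ (t + n)) z, dir ((f ^^ (t + n)) z) (leg (run \<nu> \<tau> t x n))) \<and>
    (f ^^ (t + n)) z \<noteq> leg (run \<nu> \<tau> t x n)"
proof (induction n)
  case (Suc n)
  let ?y = "(f ^^ (t + n)) z" and ?r = "run \<nu> \<tau> t x n"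
  have y: "?y \<in> T - {c}" using z iter_in_T by auto
  have l: "leg ?r \<in> T - {?y}" using Suc leg_in_T by auto
  have "f (cut ?y (leg ?r)) = leg (run \<nu> \<tau> t x (Suc n))"
    using f_cut[OF y leg_in_T, of ?r] sy_leg[of ?r] itinerary_Suc[of z "t + n"] by (simp add: \<tau>_def)
  then show ?case using Suc local_arm_map_dir[OF y l] by (auto simp del: run.simps)
qed (use neq in simp)

end

context hubbard
begin

subsection \<open>Tripods\<close>

definition tripod :: "'a \<Rightarrow> 'a \<Rightarrow> 'a \<Rightarrow> 'a \<Rightarrow> bool" where
  "tripod b x y w \<longleftrightarrow> x \<in> T \<and> y \<in> T \<and> w \<in> T \<and> b \<in> seg x y \<and> b \<in> seg y w \<and> b \<in> seg x w"

definition chop :: "symbol \<Rightarrow> 'a \<Rightarrow> 'a" where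
  "chop s p = (if sy p = s then f p else f c)"

lemma chop_in_T: "p \<in> T \<Longrightarrow> chop s p \<in> T"
  by (simp add: chop_def f_in_T c_in_T)

text \<open>If \<open>q\<close> lies on the other side, the critical point lies between
  \<open>b\<close> and \<open>q\<close>. Then \<open>b\<close> belongs to \<open>[c,p]\<close>, on
  which \<open>f\<close> is injective.\<close>

lemma seg_chop:
  assumes p: "p \<in> T" "sy p = s" and q: "q \<in> T" and b: "b \<in> seg p q" "sy b = s" and s: "s \<noteq> SymStar"
  shows "f b \<in> seg (chop s p) (chop s q)" "f b \<in> seg (chop s q) (chop s p)"
proof -
  have pc: "p \<noteq> c" using p(2) s sy_eq_star_iff[of p] by auto
  have bT: "b \<in> T" using seg_in_T[OF b(1) p(1) q] .
  have "f b \<in> seg (f p) (chop s q)"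
  proof (cases "sy q = s")
    case True
    then have "c \<notin> seg p q" using c_between_iff[OF p(1) pc q] p(2) by simp
    then have "f ` seg p q = seg (f p) (f q)" using seg_image(2)[OF p(1) q] by simp
    then show ?thesis using b(1) True by (auto simp: chop_def)
  next
    case False
    then have "c \<in> seg p q" using c_between_iff[OF p(1) pc q] p(2) by simp
    moreover have "c \<notin> seg p b" using c_between_iff[OF p(1) pc bT] p(2) b(2) by simp
    ultimately have "c \<in> seg b q" using seg_split(1)[OF p(1) q b(1)] by auto
    then have "b \<in> seg c p"
      using between_trans(2)[OF q p(1), of b c] b(1) seg_commute[OF q p(1)] seg_commute[OF q bT] by simp
    moreover have "f ` seg c p = seg (f c) (f p)" using seg_image(2)[OF c_in_T p(1)] by simp
    ultimately have "f b \<in> seg (f c) (f p)" by auto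
    then show ?thesis
      using False seg_commute[OF f_in_T[OF c_in_T] f_in_T[OF p(1)]] by (simp add: chop_def)
  qed
  then show "f b \<in> seg (chop s p) (chop s q)" using p(2) by (simp add: chop_def)
  then show "f b \<in> seg (chop s q) (chop s p)"
    using seg_commute[OF chop_in_T[OF p(1)] chop_in_T[OF q]] by simp
qed

lemma sy_between:
  assumes "p \<in> T" "q \<in> T" "sy p = s" "sy q = s" "s \<noteq> SymStar" "b \<in> seg p q"
  shows "sy b = s"
proof -
  have pc: "p \<noteq> c" using assms sy_eq_star_iff[of p] by auto
  then have "c \<notin> seg p q" using c_between_iff[OF assms(1) _ assms(2)] assms by simp
  then have "c \<notin> seg p b" using seg_mono(1)[OF assms(1,2,6)] by auto
  then show ?thesis
    using c_between_iff[OF assms(1) pc seg_in_T[OF assms(6,1,2)]] assms(3) by simp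
qed

text \<open>Two legs with the symbol \<open>s\<close> force it upon the center. Every pair of legs
  contains one of these two, so no pair is cut at both ends and the center stays between
  them.\<close>

lemma tripod_step:
  assumes t: "tripod b x y w" and s: "s \<noteq> SymStar"
    and two: "sy x = s \<and> sy y = s \<or> sy x = s \<and> sy w = s \<or> sy y = s \<and> sy w = s"
  shows "sy b = s \<and> tripod (f b) (chop s x) (chop s y) (chop s w)"
proof -
  have T: "x \<in> T" "y \<in> T" "w \<in> T" and b: "b \<in> seg x y" "b \<in> seg y w" "b \<in> seg x w"
    using t by (auto simp: tripod_def)
  have sb: "sy b = s"
    using two sy_between[OF T(1,2) _ _ s b(1)] sy_between[OF T(2,3) _ _ s b(2)]
      sy_between[OF T(1,3) _ _ s b(3)] by auto
  have pair: "f b \<in> seg (chop s p) (chop s q)"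
    if "p \<in> T" "q \<in> T" "b \<in> seg p q" "sy p = s \<or> sy q = s" for p q
  proof (cases "sy p = s")
    case True
    then show ?thesis using seg_chop(1)[OF that(1) True that(2,3) sb s] by simp
  next
    case False
    then have "sy q = s" using that(4) by simp
    then show ?thesis
      using seg_chop(2)[OF that(2) _ that(1) _ sb s] that(3) seg_commute[OF that(1,2)] by simp
  qed
  show ?thesis
    using pair[OF T(1,2) b(1)] pair[OF T(2,3) b(2)] pair[OF T(1,3) b(3)] two sb T
    by (auto simp: tripod_def chop_in_T)
qed

primrec proc :: "(nat \<Rightarrow> symbol) \<Rightarrow> 'a \<Rightarrow> nat \<Rightarrow> 'a" where
  "proc \<tau> x 0 = x"
| "proc \<tau> x (Suc t) = chop (\<tau> (Suc t)) (proc \<tau> x t)"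

text \<open>Majority vote: at each time two of the legs have the symbol prescribed by \<open>\<tau>\<close>, and the center
  lies between them.\<close>

lemma tripod_itinerary:
  assumes "tripod b x y w" and star: "\<And>t. \<tau> (Suc t) \<noteq> SymStar"
    and two: "\<And>t. sy (proc \<tau> x t) = \<tau> (Suc t) \<and> sy (proc \<tau> y t) = \<tau> (Suc t) \<or>
      sy (proc \<tau> x t) = \<tau> (Suc t) \<and> sy (proc \<tau> w t) = \<tau> (Suc t) \<or>
      sy (proc \<tau> y t) = \<tau> (Suc t) \<and> sy (proc \<tau> w t) = \<tau> (Suc t)"
  shows "sy ((f ^^ t) b) = \<tau> (Suc t)"
proof -
  have tri: "tripod ((f ^^ t) b) (proc \<tau> x t) (proc \<tau> y t) (proc \<tau> w t)" for t
  proof (induction t)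
    case (Suc t)
    from tripod_step[OF this star two] show ?case by simp
  qed (use assms in simp)
  show ?thesis using tripod_step[OF tri star two] by simp
qed

lemma tripod_exists:
  assumes "x \<in> T" "y \<in> T" "w \<in> T"
  obtains b where "tripod b x y w"
proof -
  obtain b where "b \<in> seg x y" "b \<in> seg y w" "b \<in> seg x w" using assms by (rule median)
  then show ?thesis using that assms by (simp add: tripod_def)
qed

lemma tripod_branch:
  assumes t: "tripod b x y w" and neq: "b \<noteq> x" "b \<noteq> y" "b \<noteq> w"
  shows "branch_point T b"
proof -
  have T: "x \<in> T" "y \<in> T" "w \<in> T" and b: "b \<in> seg x y" "b \<in> seg y w" "b \<in> seg x w"
    using t by (auto simp: tripod_def)
  have bT: "b \<in> T" using seg_in_T[OF b(1) T(1,2)] .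
  have m: "x \<in> T - {b}" "y \<in> T - {b}" "w \<in> T - {b}" using T neq by auto
  have "dir b x \<noteq> dir b y" "dir b y \<noteq> dir b w" "dir b x \<noteq> dir b w"
    using dir_eq_iff[OF bT m(1,2)] dir_eq_iff[OF bT m(2,3)] dir_eq_iff[OF bT m(1,3)] b by auto
  then have "card {dir b x, dir b y, dir b w} = 3" by simp
  moreover have "{dir b x, dir b y, dir b w} \<subseteq> arms T b" using m dir_in_arms by auto
  ultimately have "3 \<le> card (arms T b)" using card_mono[OF finite_arms[OF bT]] by metis
  then show ?thesis using bT by (simp add: branch_point_def)
qed

lemma proc_self: "(\<And>t. sy ((f ^^ t) b) = \<tau> (Suc t)) \<Longrightarrow> proc \<tau> b t = (f ^^ t) b"
  by (induction t) (simp_all add: chop_def)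

lemma proc_leg: "proc \<tau> (leg x) t = leg (run \<nu> \<tau> 0 x t)"
  by (induction t) (auto simp: chop_def sy_leg)


subsection \<open>Periodic branch points\<close>

lemma branch_iterate:
  assumes "branch_point T z"
  shows "branch_point T ((f ^^ n) z)" "(f ^^ n) z \<in> T - {c}" "(f ^^ n) z \<noteq> f c" "vertex ((f ^^ n) z)"
    "card (arms T z) \<le> card (arms T ((f ^^ n) z))"
proof -
  have "branch_point T ((f ^^ n) z) \<and> card (arms T z) \<le> card (arms T ((f ^^ n) z))"
  proof (induction n)
    case (Suc n)
    then have "(f ^^ n) z \<in> T - {c}" using c_not_branch by (auto simp: branch_point_def)
    from card_arms_le[OF this] f_in_T[of "(f ^^ n) z"] this Suc show ?case
      by (auto simp: branch_point_def)
  qed (use assms in simp)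
  then show b: "branch_point T ((f ^^ n) z)" "card (arms T z) \<le> card (arms T ((f ^^ n) z))" by auto
  then show "(f ^^ n) z \<in> T - {c}" using c_not_branch by (auto simp: branch_point_def)
  show "(f ^^ n) z \<noteq> f c" using b(1) critical_value_endpoint by (auto simp: branch_point_def)
  show "vertex ((f ^^ n) z)" using b(1) by (simp add: vertex_def)
qed

lemma leg_neq_branch_0: "branch_point T z \<Longrightarrow> (f ^^ n) z \<noteq> leg 0"
  using branch_iterate(3) by simp

lemma branch_eq_if_itineraries_eq:
  assumes "branch_point T z" "branch_point T b" "\<And>t. sy ((f ^^ t) z) = sy ((f ^^ t) b)"
  shows "z = b"
proof (rule ccontr)
  assume "z \<noteq> b"
  then obtain n where "sy ((f ^^ n) z) \<noteq> sy ((f ^^ n) b)"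
    using itineraries_differ[of z b] assms by (auto simp: vertex_def)
  then show False using assms(3) by simp
qed

lemma lam_iterate_arm:
  assumes z: "branch_point T z" and A: "A \<in> arms T z"
  shows "fst ((lam ^^ n) (z, A)) = (f ^^ n) z" "snd ((lam ^^ n) (z, A)) \<in> arms T ((f ^^ n) z)"
proof -
  have "fst ((lam ^^ n) (z, A)) = (f ^^ n) z \<and> snd ((lam ^^ n) (z, A)) \<in> arms T ((f ^^ n) z)"
  proof (induction n)
    case (Suc n)
    let ?p = "(lam ^^ n) (z, A)"
    have p: "?p = ((f ^^ n) z, snd ?p)" using Suc by (metis prod.collapse)
    have "lam ?p = lam ((f ^^ n) z, snd ?p)" using p by simp
    then show ?case using lam_arm[OF branch_iterate(2)[OF z, of n], of "snd ?p"] Suc by simp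
  qed (use A in simp)
  then show "fst ((lam ^^ n) (z, A)) = (f ^^ n) z" "snd ((lam ^^ n) (z, A)) \<in> arms T ((f ^^ n) z)" by auto
qed

end

section \<open>Periods and cycles of iterated maps\<close>

lemma funpow_fixed_mult:
  assumes "(g ^^ m) z = z"
  shows "(g ^^ (m * q)) z = z"
proof (induction q)
  case (Suc q)
  have "(g ^^ (m * Suc q)) z = (g ^^ m) ((g ^^ (m * q)) z)" by (simp add: funpow_add)
  then show ?case using Suc assms by simp
qed simp

lemma exact_period_dvd:
  assumes "exact_period g z m" "(g ^^ n) z = z"
  shows "m dvd n"
proof -
  have m: "0 < m" "(g ^^ m) z = z" "\<And>k. 0 < k \<Longrightarrow> k < m \<Longrightarrow> (g ^^ k) z \<noteq> z"
    using assms(1) by (auto simp: exact_period_def)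
  have "(g ^^ n) z = (g ^^ (n mod m)) ((g ^^ (m * (n div m))) z)"
    by (metis add.commute comp_apply funpow_add mod_mult_div_eq mult.commute)
  then have "(g ^^ (n mod m)) z = z" using funpow_fixed_mult[OF m(2)] assms(2) by simp
  then have "n mod m = 0" using m(3)[of "n mod m"] m(1) by auto
  then show ?thesis by auto
qed

lemma periodic_if_inj_on_finite:
  assumes fin: "finite S" and maps: "\<And>x. x \<in> S \<Longrightarrow> g x \<in> S" and inj: "inj_on g S" and p: "p \<in> S"
  obtains n where "0 < n" "(g ^^ n) p = p"
proof -
  have S: "(g ^^ n) p \<in> S" for n using p maps by (induction n) auto
  have cancel: "(g ^^ j) ((g ^^ n) p) = (g ^^ j) p \<Longrightarrow> (g ^^ n) p = p" for j n
  proof (induction j)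
    case (Suc j)
    have "(g ^^ j) ((g ^^ n) p) = (g ^^ (j + n)) p" by (simp add: funpow_add)
    then have "(g ^^ j) ((g ^^ n) p) \<in> S" using S by metis
    then show ?case using Suc inj_onD[OF inj, of "(g ^^ j) ((g ^^ n) p)" "(g ^^ j) p"] S by simp
  qed simp
  have "\<not> inj (\<lambda>n. (g ^^ n) p)"
  proof
    assume "inj (\<lambda>n. (g ^^ n) p)"
    moreover have "finite (range (\<lambda>n. (g ^^ n) p))" using S fin by (metis finite_subset image_subsetI)
    ultimately show False using finite_imageD infinite_UNIV_nat by blast
  qed
  then obtain i j where ij: "(g ^^ i) p = (g ^^ j) p" "i \<noteq> j" by (auto simp: inj_def)
  define a d where "a = min i j" and "d = max i j - min i j"
  have d: "0 < d" "(g ^^ (a + d)) p = (g ^^ a) p"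
    using ij by (auto simp: a_def d_def min_def max_def)
  then have "(g ^^ a) ((g ^^ d) p) = (g ^^ a) p" by (simp add: funpow_add)
  then show ?thesis using that cancel d(1) by blast
qed

lemma tame_orbit_transitive:
  assumes "tame_orbit T f Z" "p \<in> local_arms T Z" "p' \<in> local_arms T Z"
  shows "\<exists>n. (local_arm_map T f ^^ n) p = p'"
proof -
  let ?g = "local_arm_map T f"
  obtain l N where l: "N > 0" "(?g ^^ N) l = l" "local_arms T Z \<subseteq> orbit_of ?g l"
    using assms(1) unfolding tame_orbit_def by blast
  obtain a b where ab: "p = (?g ^^ a) l" "p' = (?g ^^ b) l"
    using l(3) assms(2,3) unfolding orbit_of_def by blast
  \<comment> \<open>The \<open>N * a - a\<close> steps lead from \<open>p\<close> around the cycle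
    back to \<open>l\<close>.\<close>
  define n where "n = b + (N * a - a)"
  have "a \<le> N * a" using l(1) by simp
  then have "n + a = b + N * a" unfolding n_def by linarith
  then have "(?g ^^ n) p = (?g ^^ (b + N * a)) l" using ab(1) by (metis comp_apply funpow_add)
  also have "\<dots> = p'" using funpow_fixed_mult[OF l(2)] ab(2) by (simp add: funpow_add)
  finally show ?thesis by blast
qed

subsection \<open>The characteristic point of a tame orbit\<close>

locale tame_hubbard = hubbard +
  fixes z :: 'a and m :: nat
  assumes tame: "tame_branch_point T f z" and period: "exact_period f z m"
begin

definition Z :: "'a set" where
  "Z = orbit_of f z"

lemma branch_z: "branch_point T z" and tame_Z: "tame_orbit T f Z"
  using tame by (auto simp: tame_branch_point_def Z_def)

lemma m_pos: "0 < m" and f_m: "(f ^^ m) z = z"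
  using period by (auto simp: exact_period_def)

lemma iterate_in_Z: "(f ^^ n) z \<in> Z"
  by (auto simp: Z_def orbit_of_def)

lemma Z_E:
  assumes "y \<in> Z"
  obtains n where "y = (f ^^ n) z"
  using assms by (auto simp: Z_def orbit_of_def)

lemma in_Z:
  assumes "y \<in> Z"
  shows "branch_point T y" "y \<in> T - {c}" "y \<noteq> f c" "f y \<in> Z" "y \<in> T"
proof -
  obtain n where n: "y = (f ^^ n) z" using assms by (rule Z_E)
  show "branch_point T y" "y \<in> T - {c}" "y \<noteq> f c" using branch_iterate[OF branch_z] n by auto
  then show "y \<in> T" by simp
  have "f y = (f ^^ Suc n) z" using n by simp
  then show "f y \<in> Z" using iterate_in_Z by metis
qed

lemma Z_iterate:
  assumes "y \<in> Z" "w \<in> Z"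
  obtains j where "w = (f ^^ j) y"
proof -
  obtain a b where ab: "y = (f ^^ a) z" "w = (f ^^ b) z" using assms by (metis Z_E)
  have "a \<le> m * a" using m_pos by simp
  then have e: "b + (m * a - a) + a = b + m * a" by linarith
  have "(f ^^ (b + (m * a - a))) y = (f ^^ (b + (m * a - a) + a)) z" using ab by (simp add: funpow_add)
  also have "\<dots> = (f ^^ b) ((f ^^ (m * a)) z)" unfolding e by (simp add: funpow_add)
  also have "\<dots> = w" using funpow_fixed_mult[OF f_m] ab by simp
  finally show ?thesis using that by metis
qed

lemma f_m_Z: "y \<in> Z \<Longrightarrow> (f ^^ m) y = y"
proof -
  assume "y \<in> Z"
  then obtain n where n: "y = (f ^^ n) z" by (rule Z_E)
  have "(f ^^ m) y = (f ^^ n) ((f ^^ m) z)" using n by (metis add.commute comp_apply funpow_add)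
  then show ?thesis using n f_m by simp
qed

lemma exact_period_Z:
  assumes y: "y \<in> Z"
  shows "exact_period f y m"
proof -
  have "(f ^^ k) y \<noteq> y" if k: "0 < k" "k < m" for k
  proof
    assume eq: "(f ^^ k) y = y"
    obtain j where j: "z = (f ^^ j) y" using y iterate_in_Z[of 0] by (metis Z_iterate funpow_0)
    have "(f ^^ k) z = (f ^^ j) ((f ^^ k) y)" using j by (metis add.commute comp_apply funpow_add)
    then have "(f ^^ k) z = z" using eq j by simp
    then show False using period k by (auto simp: exact_period_def)
  qed
  then show ?thesis using m_pos f_m_Z[OF y] by (simp add: exact_period_def)
qed

lemma f_inj_Z:
  assumes "y \<in> Z" "w \<in> Z" "f y = f w"
  shows "y = w"
proof -
  obtain n where n: "m = Suc n" using m_pos by (cases m) auto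
  have "(f ^^ m) y = (f ^^ m) w" unfolding n funpow_Suc_right using assms by simp
  then show ?thesis using f_m_Z assms by simp
qed

lemma card_arms_Z:
  assumes "y \<in> Z"
  shows "card (arms T y) = card (arms T z)"
proof -
  have zZ: "z \<in> Z" using iterate_in_Z[of 0] by simp
  obtain n where n: "y = (f ^^ n) z" using assms by (rule Z_E)
  obtain j where j: "z = (f ^^ j) y" using assms zZ by (rule Z_iterate)
  have "card (arms T z) \<le> card (arms T y)" unfolding n by (rule branch_iterate(5)[OF branch_z])
  moreover have "card (arms T y) \<le> card (arms T ((f ^^ j) y))"
    by (rule branch_iterate(5)[OF in_Z(1)[OF assms]])
  then have "card (arms T y) \<le> card (arms T z)" using j by metis
  ultimately show ?thesis by simp
qed

lemma card_arms_ge: "y \<in> Z \<Longrightarrow> 3 \<le> card (arms T y)"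
  using in_Z(1) by (simp add: branch_point_def)

lemma finite_Z: "finite Z"
proof -
  have "Z \<subseteq> (\<lambda>n. (f ^^ n) z) ` {..<m}"
  proof
    fix y assume "y \<in> Z"
    then obtain n where n: "y = (f ^^ n) z" by (rule Z_E)
    have "(f ^^ n) z = (f ^^ (n mod m + m * (n div m))) z" by simp
    then have "(f ^^ n) z = (f ^^ (n mod m)) ((f ^^ (m * (n div m))) z)"
      unfolding funpow_add by simp
    then have "y = (f ^^ (n mod m)) z" using n funpow_fixed_mult[OF f_m] by simp
    then show "y \<in> (\<lambda>n. (f ^^ n) z) ` {..<m}" using m_pos by auto
  qed
  then show ?thesis using finite_surj by blast
qed

lemma lam_transitive:
  assumes "y \<in> Z" "A \<in> arms T y" "w \<in> Z" "B \<in> arms T w"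
  shows "\<exists>n. (lam ^^ n) (y, A) = (w, B)"
  using assms by (intro tame_orbit_transitive[OF tame_Z]) (auto simp: local_arms_def)

lemma dirs_neq_c:
  assumes "y \<in> Z"
  shows "c \<in> T - {y}" "f c \<in> T - {y}"
  using in_Z[OF assms] c_in_T f_in_T[OF c_in_T] by auto

lemma lam_dir_c:
  assumes "y \<in> Z"
  shows "lam (y, dir y c) = (f y, dir (f y) (f c))"
proof -
  have "cut y c = c" by (simp add: cut_def)
  then show ?thesis using local_arm_map_dir(1)[OF in_Z(2)[OF assms] dirs_neq_c(1)[OF assms]] by simp
qed

definition W :: "'a \<Rightarrow> 'a set set" where
  "W y = dir y ` (Z - {y})"

lemma finite_W: "finite (W y)"
  using finite_Z by (simp add: W_def)

lemma W_subset_arms: "y \<in> Z \<Longrightarrow> W y \<subseteq> arms T y"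
  using in_Z by (auto simp: W_def arms_eq)

text \<open>If the leg to another orbit point is cut, it turns into the direction of the critical
  value; otherwise it ends at another orbit point again, \<open>f\<close> being injective on the
  orbit.\<close>

lemma lam_W:
  assumes y: "y \<in> Z" and A: "A \<in> W y"
  shows "snd (lam (y, A)) \<in> insert (dir (f y) (f c)) (W (f y))"
proof -
  obtain w where w: "w \<in> Z - {y}" "A = dir y w" using A by (auto simp: W_def)
  have wT: "w \<in> T - {y}" using w in_Z(5) by auto
  have "lam (y, A) = (f y, dir (f y) (f (cut y w)))"
    using local_arm_map_dir(1)[OF in_Z(2)[OF y] wT] w(2) by simp
  moreover have "f w \<in> Z - {f y}" using w in_Z(4) f_inj_Z[OF y, of w] by auto
  ultimately show ?thesis by (auto simp: cut_def W_def)
qed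

lemma W_extremal:
  assumes "w \<in> Z" "w \<noteq> z"
  obtains e where "e \<in> Z" "card (W e) = 1"
proof -
  have zZ: "z \<in> Z" using iterate_in_Z[of 0] by simp
  have zT: "z \<in> T" using in_Z(5)[OF zZ] .
  define h where "h = (\<lambda>y. card (Z \<inter> seg z y))"
  have "Max (h ` Z) \<in> h ` Z" using finite_Z zZ by (intro Max_in) auto
  then obtain e where e: "e \<in> Z" "h e = Max (h ` Z)" by auto
  have e_max: "h y \<le> h e" if "y \<in> Z" for y
    unfolding e(2) using that finite_Z by (intro Max_ge) auto
  have eT: "e \<in> T" using in_Z(5)[OF e(1)] .
  have wT: "w \<in> T" using in_Z(5)[OF assms(1)] .
  have "e \<noteq> z"
  proof
    assume "e = z"
    then have "h e = card {z}" using zZ by (simp add: h_def)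
    moreover have "{z, w} \<subseteq> Z \<inter> seg z w" using zZ assms(1) ends_in_seg[OF zT wT] by simp
    then have "card {z, w} \<le> h w" unfolding h_def using finite_Z by (intro card_mono) auto
    ultimately show False using e_max[OF assms(1)] assms(2) by simp
  qed
  then have ze: "z \<in> T - {e}" using zT by simp
  have "dir e y = dir e z" if y: "y \<in> Z - {e}" for y
  proof (rule ccontr)
    have yT: "y \<in> T - {e}" "y \<in> T" using y in_Z(5) by auto
    assume "dir e y \<noteq> dir e z"
    then have ey: "e \<in> seg z y"
      using dir_eq_iff[OF eT yT(1) ze] seg_commute[OF zT yT(2)] by simp
    have "y \<notin> seg z e"
    proof
      assume "y \<in> seg z e"
      then have "y = e"
        using between_antisym[OF yT(2) zT, of e] ey seg_commute[OF zT yT(2)] seg_commute[OF zT eT] by simp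
      then show False using y by simp
    qed
    then have "Z \<inter> seg z e \<subset> Z \<inter> seg z y"
      using seg_mono(1)[OF zT yT(2) ey] y ends_in_seg(2)[OF zT yT(2)] by auto
    then have "h e < h y" unfolding h_def using finite_Z by (intro psubset_card_mono) auto
    then show False using e_max[of y] y by simp
  qed
  then have "W e \<subseteq> {dir e z}" unfolding W_def by (intro image_subsetI) simp
  moreover have "dir e z \<in> W e" using zZ \<open>e \<noteq> z\<close> by (simp add: W_def)
  ultimately have "W e = {dir e z}" by auto
  then show ?thesis using that e(1) by simp
qed

text \<open>Otherwise \<open>lam_W\<close> would make the arms that contain other orbit points an
  invariant set, and by tameness these would be all arms. But an extremal point has a single such
  arm and at least three arms.\<close>

lemma W_misses_critical_value:
  assumes "w \<in> Z" "w \<noteq> z"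
  obtains y where "y \<in> Z" "dir y (f c) \<notin> W y"
proof (cases "\<exists>y\<in>Z. dir y (f c) \<notin> W y")
  case True
  then show ?thesis using that by auto
next
  case False
  obtain e where e: "e \<in> Z" "card (W e) = 1" using assms by (rule W_extremal)
  then obtain A where A: "W e = {A}" using card_1_singletonE by metis
  have closed: "fst ((lam ^^ n) (e, A)) \<in> Z \<and> snd ((lam ^^ n) (e, A)) \<in> W (fst ((lam ^^ n) (e, A)))" for n
  proof (induction n)
    case (Suc n)
    let ?p = "(lam ^^ n) (e, A)"
    have p: "fst ?p \<in> Z" "snd ?p \<in> W (fst ?p)" using Suc by auto
    then have arm: "snd ?p \<in> arms T (fst ?p)" using W_subset_arms by auto
    have "lam ?p = (fst (lam ?p), snd (lam ?p))" "?p = (fst ?p, snd ?p)" by simp_all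
    moreover have "fst (lam ?p) = f (fst ?p)" using lam_arm(1)[OF in_Z(2)[OF p(1)] arm] by simp
    moreover have "snd (lam ?p) \<in> W (f (fst ?p))"
      using lam_W[OF p] False in_Z(4)[OF p(1)] by auto
    ultimately show ?case using in_Z(4)[OF p(1)] by simp
  qed (use e A in simp)
  have "arms T e \<subseteq> W e"
  proof
    fix B assume "B \<in> arms T e"
    then obtain n where "(lam ^^ n) (e, A) = (e, B)"
      using lam_transitive[OF e(1) _ e(1), of A B] W_subset_arms[OF e(1)] A by auto
    then show "B \<in> W e" using closed[of n] by simp
  qed
  then have "card (arms T e) \<le> 1" using card_mono[OF finite_W] e(2) by metis
  then show ?thesis using card_arms_ge[OF e(1)] by simp
qed

lemma dir_critical_value_eq:
  assumes y: "y \<in> Z" and w: "w \<in> Z" "w \<noteq> y" and neq: "dir y w \<noteq> dir y (f c)"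
  shows "dir w (f c) = dir w y"
proof -
  have T: "y \<in> T" "w \<in> T" "f c \<in> T" using in_Z(5) y w f_in_T[OF c_in_T] by auto
  have m: "w \<in> T - {y}" "y \<in> T - {w}" using w T by auto
  have "y \<in> seg w (f c)" using dir_eq_iff[OF T(1) m(1) dirs_neq_c(2)[OF y]] neq by simp
  then have "w \<notin> seg y (f c)" using between_antisym[OF T(2,3), of y] w by auto
  then show ?thesis using dir_eq_iff[OF T(2) m(2) dirs_neq_c(2)[OF w(1)]] by simp
qed

text \<open>Choose \<open>y\<close> with no other orbit point in the direction of the critical
  value. From all other orbit points this direction leads to \<open>y\<close>, so the arms counted
  by \<open>W\<close> are mapped injectively to such arms as long as the orbit avoids
  \<open>y\<close>. Hence \<open>y\<close> has no more of them than an extremal point, namely one.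
  It contains the critical point, which separates two orbit points at some time.\<close>

lemma characteristic_point:
  obtains y where "y \<in> Z" "dir y c \<noteq> dir y (f c)" "\<And>w. w \<in> Z \<Longrightarrow> w \<noteq> y \<Longrightarrow> dir y w = dir y c"
proof (cases "\<exists>w\<in>Z. w \<noteq> z")
  case False
  have zZ: "z \<in> Z" using iterate_in_Z[of 0] by simp
  then have "f z = z" using in_Z(4) False by auto
  \<comment> \<open>For a fixed point, equal directions would make the arm towards \<open>c\<close>
    invariant.\<close>
  have "dir z c \<noteq> dir z (f c)"
  proof
    assume eq: "dir z c = dir z (f c)"
    have fixed: "(lam ^^ n) (z, dir z c) = (z, dir z c)" for n
      using lam_dir_c[OF zZ] eq \<open>f z = z\<close> by (induction n) auto
    have "arms T z \<subseteq> {dir z c}"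
    proof
      fix B assume "B \<in> arms T z"
      then obtain n where "(lam ^^ n) (z, dir z c) = (z, B)"
        using lam_transitive[OF zZ _ zZ, of "dir z c" B] dir_in_arms[OF dirs_neq_c(1)[OF zZ]] by auto
      then show "B \<in> {dir z c}" using fixed[of n] by simp
    qed
    then have "card (arms T z) \<le> card {dir z c}" by (intro card_mono) auto
    then show False using card_arms_ge[OF zZ] by simp
  qed
  then show ?thesis using that[OF zZ] False by auto
next
  case True
  then obtain w0 where w0: "w0 \<in> Z" "w0 \<noteq> z" by auto
  obtain y where y: "y \<in> Z" "dir y (f c) \<notin> W y" using w0 by (rule W_misses_critical_value)
  have yT: "y \<in> T" using in_Z(5)[OF y(1)] .
  have other: "dir w (f c) \<in> W w" if w: "w \<in> Z" "w \<noteq> y" for w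
  proof -
    have "dir y w \<in> W y" using w by (simp add: W_def)
    then have "dir y w \<noteq> dir y (f c)" using y(2) by auto
    then have "dir w (f c) = dir w y" by (rule dir_critical_value_eq[OF y(1) w])
    then show ?thesis using y(1) w by (simp add: W_def)
  qed
  obtain e where e: "e \<in> Z" "card (W e) = 1" using w0 by (rule W_extremal)
  obtain j0 where "e = (f ^^ j0) y" using y(1) e(1) by (rule Z_iterate)
  \<comment> \<open>With the least \<open>j\<close> the orbit does not pass through \<open>y\<close>
    again, where the count could fail.\<close>
  define j where "j = (LEAST j. e = (f ^^ j) y)"
  have j: "e = (f ^^ j) y" unfolding j_def using \<open>e = (f ^^ j0) y\<close> by (rule LeastI)
  have iter_Z: "(f ^^ i) y \<in> Z" for i using y(1) in_Z(4) by (induction i) auto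
  have before: "(f ^^ i) y \<noteq> y" if i: "0 < i" "i \<le> j" for i
  proof
    assume "(f ^^ i) y = y"
    then have "(f ^^ (j - i)) y = (f ^^ (j - i)) ((f ^^ i) y)" by simp
    also have "\<dots> = (f ^^ (j - i + i)) y" by (simp add: funpow_add)
    also have "\<dots> = e" using i j by simp
    finally show False using not_less_Least[of "j - i" "\<lambda>j. e = (f ^^ j) y"] i unfolding j_def[symmetric] by auto
  qed
  have "i \<le> j \<Longrightarrow> card (W y) \<le> card (W ((f ^^ i) y))" for i
  proof (induction i)
    case (Suc i)
    let ?y = "(f ^^ i) y"
    have yi: "?y \<in> Z" "f ?y \<in> Z" "f ?y \<noteq> y" using iter_Z[of i] iter_Z[of "Suc i"] before[of "Suc i"] Suc.prems by auto
    have "(\<lambda>A. snd (lam (?y, A))) ` W ?y \<subseteq> W (f ?y)"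
    proof (rule image_subsetI)
      fix A assume "A \<in> W ?y"
      from lam_W[OF yi(1) this] show "snd (lam (?y, A)) \<in> W (f ?y)"
        using other[OF yi(2,3)] by (metis insertE)
    qed
    moreover have "inj_on (\<lambda>A. snd (lam (?y, A))) (W ?y)"
      by (rule inj_on_subset[OF lam_inj[OF in_Z(2)[OF yi(1)]] W_subset_arms[OF yi(1)]])
    ultimately have "card (W ?y) \<le> card (W (f ?y))" using card_inj_on_le[OF _ _ finite_W] by blast
    then show ?case using Suc by simp
  qed simp
  then have "card (W y) \<le> 1" using j e(2) by force
  moreover have "W y \<noteq> {}"
  proof -
    have "z \<in> Z - {y} \<or> w0 \<in> Z - {y}" using w0 iterate_in_Z[of 0] by auto
    then show ?thesis by (auto simp: W_def)
  qed
  then have "card (W y) \<noteq> 0" using finite_W[of y] by simp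
  ultimately have "card (W y) = 1" by linarith
  then obtain A where A: "W y = {A}" using card_1_singletonE by metis
  have dA: "dir y w = A" if "w \<in> Z" "w \<noteq> y" for w
  proof -
    have "dir y w \<in> W y" using that by (simp add: W_def)
    then show ?thesis using A by simp
  qed
  obtain n where n: "sy ((f ^^ n) z) \<noteq> sy ((f ^^ n) w0)"
    using itineraries_differ[of z w0] branch_z in_Z(1)[OF w0(1)] w0(2) by (auto simp: vertex_def)
  define p q where "p = (f ^^ n) z" and "q = (f ^^ n) w0"
  have p: "p \<in> Z" and q: "q \<in> Z"
  proof -
    show "p \<in> Z" using iterate_in_Z by (simp add: p_def)
    have "(f ^^ i) w0 \<in> Z" for i using w0(1) in_Z(4) by (induction i) auto
    then show "q \<in> Z" by (simp add: q_def)
  qed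
  have T: "p \<in> T" "q \<in> T" "p \<noteq> c" using in_Z(2)[OF p] in_Z(5)[OF q] by auto
  have cpq: "c \<in> seg p q" using c_between_iff[OF T(1,3,2)] n by (simp add: p_def q_def)
  have cy: "c \<noteq> y" using dirs_neq_c(1)[OF y(1)] by simp
  have "dir y c = A"
  proof (cases "p = y \<or> q = y")
    case True
    then obtain v where v: "v \<in> Z" "c \<in> seg y v"
      using cpq p q seg_commute[OF T(1,2)] by auto
    then have "dir y c = dir y v" "v \<in> T - {y}" using dir_seg[OF yT in_Z(5)[OF v(1)] v(2) cy] by auto
    then show ?thesis using dA[OF v(1)] by simp
  next
    case pq: False
    then have m: "p \<in> T - {y}" "q \<in> T - {y}" using T by auto
    have "dir y p = dir y q" using dA p q pq by simp
    then have "y \<notin> seg p q" using dir_eq_iff[OF yT m] by simp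
    then have "y \<notin> seg p c" using seg_mono(1)[OF T(1,2) cpq] by auto
    then have "dir y p = dir y c" using dir_eq_iff[OF yT m(1) dirs_neq_c(1)[OF y(1)]] by simp
    then show ?thesis using dA p pq by simp
  qed
  then show ?thesis using that[OF y(1)] y(2) A dA by simp
qed

end

section \<open>Cutting times of the legs in the tree\<close>

context hubbard
begin

text \<open>Period number \<open>Suc i * q_num \<nu> m\<close> is a common return later than the
  start of the leg in period \<open>i\<close>. The cut distinguishes the leg from the center of a
  tripod, which is never cut.\<close>

lemma leg_eventually_cut:
  assumes "address_entry_finite \<nu> m k"
  shows "\<exists>t. sy (proc (address_entry.per \<nu> m) (leg (run \<nu> (address_entry.per \<nu> m) 0 0 (i * m))) t)
    \<noteq> address_entry.per \<nu> m (Suc t)"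
proof -
  interpret address_entry_finite \<nu> m k by fact
  let ?q = "q_num \<nu> m"
  have "Suc i * 1 \<le> Suc i * ?q" using q_num_return(2) by (intro mult_le_mono2) simp
  then have "i * m < Suc i * ?q * m" using entry_pos by (intro mult_less_mono1) auto
  then have "0 < Suc i * ?q * m - i * m" by simp
  then obtain n where n: "Suc i * ?q * m - i * m = Suc n" by (cases "Suc i * ?q * m - i * m") auto
  then have e: "i * m + Suc n = 0 + Suc i * (?q * m)"
    using \<open>i * m < Suc i * ?q * m\<close> by (simp only: mult.assoc)
  have "R (i * m + Suc n) = 0" unfolding e R_periodic_mult by simp
  then have "run \<nu> per 0 (R (i * m)) (Suc n) = 0" using R_add[of i "Suc n"] by simp
  then have "\<nu> (Suc (run \<nu> per 0 (R (i * m)) n)) \<noteq> per (Suc n)" by (auto split: if_splits)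
  then show ?thesis by (auto simp: proc_leg sy_leg)
qed

lemma leg_never_both_cut:
  assumes "address_entry_finite \<nu> m k"
    and "sy (proc (address_entry.per \<nu> m) (leg (run \<nu> (address_entry.per \<nu> m) 0 0 (i * m))) t)
      \<noteq> address_entry.per \<nu> m (Suc t)"
    and "sy (proc (address_entry.per \<nu> m) (leg (run \<nu> (address_entry.per \<nu> m) 0 0 ((i + u) * m))) t)
      \<noteq> address_entry.per \<nu> m (Suc t)"
  shows "q_num \<nu> m dvd u"
proof -
  interpret address_entry_finite \<nu> m k by fact
  have zero: "R (j * m + Suc t) = 0"
    if "sy (proc per (leg (R (j * m))) t) \<noteq> per (Suc t)" for j
  proof -
    have "run \<nu> per 0 (R (j * m)) (Suc t) = 0" using that by (simp add: proc_leg sy_leg)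
    then show ?thesis using R_add[of j "Suc t"] by simp
  qed
  have "R (i * m + Suc t) = 0" by (rule zero[OF assms(2)])
  moreover have "(i + u) * m + Suc t = i * m + Suc t + u * m" by (simp add: add_mult_distrib)
  then have "R (i * m + Suc t + u * m) = 0" using zero[OF assms(3)] by metis
  ultimately show ?thesis by (rule never_both_cut)
qed

lemma tripod_center_neq_leg:
  assumes "\<And>t. sy ((f ^^ t) b) = \<tau> (Suc t)" "\<exists>t. sy (proc \<tau> x t) \<noteq> \<tau> (Suc t)"
  shows "b \<noteq> x"
  using assms proc_self[of b \<tau>] by auto

end

section \<open>First returns of the arms at the characteristic point\<close>

locale characteristic = tame_hubbard +
  fixes y :: 'a
  assumes y_Z: "y \<in> Z" and separates: "dir y c \<noteq> dir y (f c)"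
    and others: "w \<in> Z \<Longrightarrow> w \<noteq> y \<Longrightarrow> dir y w = dir y c"
begin

definition \<tau> :: "nat \<Rightarrow> symbol" where
  "\<tau> = itinerary T f c y"

lemma \<tau>_Suc: "\<tau> (Suc n) = sy ((f ^^ n) y)"
  by (simp add: \<tau>_def itinerary_Suc)

lemma iter_Z: "(f ^^ n) y \<in> Z"
  using y_Z in_Z(4) by (induction n) auto

lemma \<tau>_not_star: "\<tau> (Suc n) \<noteq> SymStar"
  using in_Z(2)[OF iter_Z[of n]] sy_eq_star_iff[of "(f ^^ n) y"] by (simp add: \<tau>_Suc)

lemma \<tau>_periodic: "1 \<le> j \<Longrightarrow> \<tau> (j + m) = \<tau> j"
proof -
  assume "1 \<le> j"
  then obtain n where n: "j = Suc n" by (cases j) auto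
  have "(f ^^ (n + m)) y = (f ^^ n) ((f ^^ m) y)" by (simp add: funpow_add)
  then have "\<tau> (Suc (n + m)) = \<tau> (Suc n)" using f_m_Z[OF y_Z] by (simp add: \<tau>_Suc)
  then show ?thesis using n by simp
qed

lemma iter_neq:
  assumes "0 < k" "k < m"
  shows "(f ^^ (a + k)) y \<noteq> (f ^^ a) y"
proof
  assume eq: "(f ^^ (a + k)) y = (f ^^ a) y"
  have "(f ^^ (a + k)) y = (f ^^ (k + a)) y" by (simp add: add.commute)
  then have "(f ^^ k) ((f ^^ a) y) = (f ^^ a) y" using eq by (simp add: funpow_add)
  then show False using exact_period_Z[OF iter_Z[of a]] assms by (simp add: exact_period_def)
qed

lemma toward_critical_value:
  assumes "w \<in> Z" "w \<noteq> y"
  shows "dir w (f c) = dir w y"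
  using dir_critical_value_eq[OF y_Z assms] others[OF assms] separates by simp

text \<open>Instead of the critical value, its direction is followed by means of \<open>y\<close>, which lies in the same
  direction from every other point of the orbit.\<close>

lemma lam_toward_critical_value:
  assumes "1 \<le> i" "i + n \<le> m"
  defines "r \<equiv> \<lambda>n. run \<tau> \<tau> i 0 n"
  shows "(lam ^^ n) ((f ^^ i) y, dir ((f ^^ i) y) (f c)) =
    ((f ^^ (i + n)) y, dir ((f ^^ (i + n)) y) (if r n = 0 then f c else (f ^^ r n) y))"
  using assms(2)
proof (induction n)
  case 0
  show ?case by (simp add: r_def)
next
  case (Suc n)
  let ?w = "(f ^^ (i + n)) y" and ?l = "(f ^^ r n) y"
  have w: "?w \<in> Z" by (rule iter_Z)
  have "?w \<noteq> y" using iter_neq[of "i + n" 0] Suc.prems assms(1) by simp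
  have "r n \<le> n" unfolding r_def using run_le[of \<tau> \<tau> i 0 n] by simp
  then have "?w \<noteq> ?l" using iter_neq[of "i + n - r n" "r n"] Suc.prems assms(1) by simp
  then have l: "?l \<in> T - {?w}" using in_Z(5)[OF iter_Z[of "r n"]] by auto
  have "dir ?w (if r n = 0 then f c else ?l) = dir ?w ?l"
    using toward_critical_value[OF w \<open>?w \<noteq> y\<close>] by simp
  then have "(lam ^^ Suc n) ((f ^^ i) y, dir ((f ^^ i) y) (f c)) = lam (?w, dir ?w ?l)"
    using Suc by simp
  also have "\<dots> = (f ?w, dir (f ?w) (f (cut ?w ?l)))" by (rule local_arm_map_dir(1)[OF in_Z(2)[OF w] l])
  also have "f (cut ?w ?l) = (if r (Suc n) = 0 then f c else (f ^^ r (Suc n)) y)"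
    using f_cut[OF in_Z(2)[OF w], of ?l] l by (simp add: \<tau>_Suc r_def)
  finally show ?case by simp
qed

abbreviation C :: "'a set" where "C \<equiv> dir y (f c)"
abbreviation H :: "'a set" where "H \<equiv> dir y c"

text \<open>All other orbit points lie in the direction \<open>H\<close> from \<open>y\<close>, so
  the arm comes back as \<open>H\<close> unless the leg is cut in the very last step.\<close>

lemma lam_return:
  assumes i: "1 \<le> i" "i \<le> m"
  shows "(lam ^^ (m - i)) ((f ^^ i) y, dir ((f ^^ i) y) (f c)) =
    (y, if run \<tau> \<tau> i 0 (m - i) = 0 then C else H)"
proof -
  let ?r = "run \<tau> \<tau> i 0 (m - i)"
  have "(lam ^^ (m - i)) ((f ^^ i) y, dir ((f ^^ i) y) (f c)) =
      ((f ^^ (i + (m - i))) y, dir ((f ^^ (i + (m - i))) y) (if ?r = 0 then f c else (f ^^ ?r) y))"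
    using i by (intro lam_toward_critical_value) simp_all
  also have "i + (m - i) = m" using i by simp
  also have "(f ^^ m) y = y" using f_m_Z y_Z by simp
  also have "dir y (if ?r = 0 then f c else (f ^^ ?r) y) = (if ?r = 0 then C else H)"
  proof (cases "?r = 0")
    case False
    have "?r < m" using run_le[of \<tau> \<tau> i 0 "m - i"] i by simp
    then have "(f ^^ ?r) y \<noteq> y" using iter_neq[of ?r 0] False by simp
    then show ?thesis using others[OF iter_Z] False by simp
  qed simp
  finally show ?thesis .
qed

lemma lam_H: "(lam ^^ m) (y, H) = (y, if run \<tau> \<tau> 1 0 (m - 1) = 0 then C else H)"
proof -
  have "(lam ^^ m) (y, H) = (lam ^^ (m - 1)) (lam (y, H))"
    using m_pos by (metis Suc_pred' comp_apply funpow_Suc_right)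
  also have "lam (y, H) = ((f ^^ 1) y, dir ((f ^^ 1) y) (f c))" using lam_dir_c[OF y_Z] by simp
  finally show ?thesis using lam_return[of 1] m_pos by simp
qed

lemma H_arm: "H \<in> arms T y" and C_arm: "C \<in> arms T y"
  using dirs_neq_c[OF y_Z] dir_in_arms by auto

text \<open>Iterates of \<open>lam\<close> that lead from an arm at \<open>y\<close> to an arm at
  \<open>y\<close> are powers of \<open>lam ^^ m\<close>, as \<open>m\<close> is the exact period.
  So tameness means that \<open>lam ^^ m\<close> is transitive on the arms at
  \<open>y\<close>.\<close>

lemma arms_subset_if_closed:
  assumes "A \<in> S" "S \<subseteq> arms T y" and closed: "\<And>B. B \<in> S \<Longrightarrow> \<exists>B'\<in>S. (lam ^^ m) (y, B) = (y, B')"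
  shows "arms T y \<subseteq> S"
proof
  fix B assume "B \<in> arms T y"
  then obtain n where n: "(lam ^^ n) (y, A) = (y, B)"
    using lam_transitive[OF y_Z _ y_Z, of A B] assms(1,2) by auto
  have "(f ^^ n) y = y"
    using lam_iterate_arm(1)[OF in_Z(1)[OF y_Z], of A n] n assms(1,2) by auto
  then have "m dvd n" by (rule exact_period_dvd[OF exact_period_Z[OF y_Z]])
  then obtain q where q: "n = m * q" by (rule dvdE)
  have "\<exists>B'\<in>S. (lam ^^ (m * q)) (y, A) = (y, B')" for q
  proof (induction q)
    case (Suc q)
    then obtain B1 where "B1 \<in> S" "(lam ^^ (m * q)) (y, A) = (y, B1)" by auto
    moreover have "(lam ^^ (m * Suc q)) (y, A) = (lam ^^ m) ((lam ^^ (m * q)) (y, A))"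
      by (simp add: funpow_add)
    ultimately show ?case using closed by simp
  qed (use assms(1) in simp)
  then obtain B' where "B' \<in> S" "(lam ^^ (m * q)) (y, A) = (y, B')" by auto
  then show "B \<in> S" using n q by simp
qed

lemma three_arms: "3 \<le> card (arms T y)"
  by (rule card_arms_ge[OF y_Z])

lemma run_returns_H: "run \<tau> \<tau> 1 0 (m - 1) = 0"
proof (rule ccontr)
  assume "run \<tau> \<tau> 1 0 (m - 1) \<noteq> 0"
  then have "arms T y \<subseteq> {H}" using lam_H H_arm by (intro arms_subset_if_closed) auto
  then have "card (arms T y) \<le> card {H}" by (intro card_mono) auto
  then show False using three_arms by simp
qed

lemma lam_C: "(lam ^^ n) (y, C) = ((f ^^ n) y, dir ((f ^^ n) y) (leg (run \<nu> \<tau> 0 0 n)))"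
  using lam_leg[of y 0 0 n] in_Z[OF y_Z] in_Z(2)[OF iter_Z] by (simp add: \<tau>_def)

lemma entry_and_number_of_arms_at_y: "m \<in> internal_address \<nu> \<and> rho \<nu> m \<noteq> \<infinity> \<and> card (arms T y) = q_num \<nu> m"
proof -
  have vy: "vertex y" using in_Z(1)[OF y_Z] by (simp add: vertex_def)
  have "y \<noteq> leg 0" using in_Z(3)[OF y_Z] by simp
  then obtain n where n: "sy ((f ^^ n) y) \<noteq> sy ((f ^^ n) (leg 0))"
    "\<forall>j<n. sy ((f ^^ j) y) = sy ((f ^^ j) (leg 0))"
    using itineraries_differ[OF vy leg_vertex] by metis
  have leg: "(f ^^ j) (leg 0) = leg j" for j by (simp add: leg_def)
  \<comment> \<open>The first index at which \<open>\<nu>\<close> differs from the itinerary of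
    \<open>y\<close>, and hence the time of the first cut of \<open>C\<close>; it will turn out to
    be \<open>rho \<nu> m\<close>.\<close>
  define k where "k = Suc n"
  have k: "\<nu> k \<noteq> \<tau> k" using n(1) leg by (simp add: k_def \<tau>_Suc sy_leg)
  have below: "\<nu> j = \<tau> j" if j: "1 \<le> j" "j < k" for j
  proof -
    obtain i where "j = Suc i" using j(1) by (cases j) auto
    then show ?thesis using n(2) j(2) leg by (simp add: k_def \<tau>_Suc sy_leg)
  qed
  have run_k: "run \<nu> \<tau> 0 0 k = 0"
  proof -
    have "run \<nu> \<tau> 0 0 n = 0 + n" using below by (intro run_agree) (simp add: k_def)
    then show ?thesis using k by (simp add: k_def)
  qed
  \<comment> \<open>After a cut within the first period, \<open>C\<close> has become the direction
    of the critical value at an orbit point, to which \<open>lam_return\<close> applies.\<close>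
  have mk: "m < k"
  proof (rule ccontr)
    assume "\<not> m < k"
    then have k1: "1 \<le> k" "k \<le> m" by (auto simp: k_def)
    have "(lam ^^ (m - k + k)) (y, C) = (lam ^^ (m - k)) ((lam ^^ k) (y, C))" by (simp add: funpow_add)
    also have "\<dots> = (lam ^^ (m - k)) ((f ^^ k) y, dir ((f ^^ k) y) (f c))" using lam_C[of k] run_k by simp
    finally have "(lam ^^ m) (y, C) = (y, if run \<tau> \<tau> k 0 (m - k) = 0 then C else H)"
      using lam_return[OF k1] k1 by simp
    then have "arms T y \<subseteq> {C, H}"
      using lam_H C_arm H_arm by (intro arms_subset_if_closed[of C]) auto
    then have "card (arms T y) \<le> card {C, H}" by (intro card_mono) auto
    also have "\<dots> \<le> 2" by (simp add: card_insert_if)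
    finally show False using three_arms by simp
  qed
  \<comment> \<open>The return of \<open>H\<close> concerns the itinerary of \<open>y\<close>, but
    reads only its first \<open>m\<close> symbols, which are those of \<open>\<nu>\<close>.\<close>
  have "run \<nu> \<nu> 1 0 (m - 1) = run \<tau> \<tau> 1 0 (m - 1)" using below mk m_pos by (intro run_cong) auto
  then have entry: "m \<in> internal_address \<nu>"
    using run_returns_H rho_orbit_iff_run[of 1 m \<nu>] m_pos unfolding internal_address_def by simp
  have rho: "rho \<nu> m = enat k"
    unfolding rho_eq_enat_iff
  proof (intro conjI allI impI)
    have shift: "\<tau> j = \<nu> (j - m)" if "m < j" "j \<le> k" for j
    proof -
      have "\<tau> (j - m + m) = \<tau> (j - m)" using that by (intro \<tau>_periodic) simp
      moreover have "\<nu> (j - m) = \<tau> (j - m)" using that m_pos by (intro below) auto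
      ultimately show ?thesis using that by simp
    qed
    show "m < k" by (rule mk)
    show "\<nu> k \<noteq> \<nu> (k - m)" using k shift[of k] mk by simp
    fix j assume j: "m < j \<and> j < k"
    then show "\<nu> j = \<nu> (j - m)" using below[of j] shift[of j] by simp
  qed
  have aef: "address_entry_finite \<nu> m k" using entry rho by unfold_locales
  interpret address_entry_finite \<nu> m k by (rule aef)
  let ?q = "q_num \<nu> m"
  have per: "per j = \<tau> j" if j: "1 \<le> j" for j
  proof -
    have red: "\<tau> (i + d * m) = \<tau> i" if "1 \<le> i" for i d
    proof (induction d)
      case (Suc d)
      have "\<tau> (i + Suc d * m) = \<tau> ((i + d * m) + m)" by (simp add: ac_simps)
      then show ?case using Suc \<tau>_periodic[of "i + d * m"] that by simp
    qed simp
    let ?i = "Suc ((j - 1) mod m)"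
    have "?i + (j - 1) div m * m = j" using j by simp
    then have "\<tau> j = \<tau> ?i" using red[of ?i "(j - 1) div m"] by simp
    moreover have "?i < k" using mk m_pos by (metis Suc_leI le_less_trans mod_less_divisor)
    ultimately show ?thesis using below[of ?i] by (simp add: per_def)
  qed
  have R: "run \<nu> \<tau> 0 0 n = R n" for n by (intro run_cong) (auto simp: per)
  \<comment> \<open>\<open>A i\<close> is the image of \<open>C\<close> after \<open>i\<close>
    periods; these arms form a cycle under \<open>lam ^^ m\<close>.\<close>
  define A where "A = (\<lambda>i. dir y (leg (R (i * m))))"
  have fim: "(f ^^ (i * m)) y = y" for i
    using funpow_fixed_mult[OF f_m_Z[OF y_Z], of i] by (simp add: mult.commute)
  have lam_A: "(lam ^^ (i * m)) (y, C) = (y, A i)" for i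
    using lam_C[of "i * m"] R fim by (simp add: A_def)
  have A_arm: "A i \<in> arms T y" for i
    using lam_iterate_arm(2)[OF in_Z(1)[OF y_Z] C_arm, of "i * m"] lam_A[of i] fim[of i] by simp
  have step: "(lam ^^ m) (y, A i) = (y, A (Suc i))" for i
  proof -
    have "(lam ^^ m) (y, A i) = (lam ^^ m) ((lam ^^ (i * m)) (y, C))" using lam_A by simp
    also have "\<dots> = (lam ^^ (Suc i * m)) (y, C)" by (simp add: funpow_add)
    finally show ?thesis using lam_A[of "Suc i"] by simp
  qed
  have A_q: "A ?q = A 0" using q_num_return(1) by (simp add: A_def)
  have "arms T y \<subseteq> A ` {..<?q}"
  proof (rule arms_subset_if_closed)
    show "A 0 \<in> A ` {..<?q}" using q_num_return(2) by auto
    show "A ` {..<?q} \<subseteq> arms T y" using A_arm by auto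
    fix B assume "B \<in> A ` {..<?q}"
    then obtain i where i: "i < ?q" "B = A i" by auto
    have "A (Suc i) \<in> A ` {..<?q}"
    proof (cases "Suc i < ?q")
      case False
      then have "Suc i = ?q" using i by simp
      then show ?thesis using A_q q_num_return(2) by auto
    qed auto
    then show "\<exists>B'\<in>A ` {..<?q}. (lam ^^ m) (y, B) = (y, B')" using step i by auto
  qed
  then have arms: "arms T y = A ` {..<?q}" using A_arm by auto
  have ne: "A i \<noteq> A (i + u)" if u: "0 < u" "i + u < ?q" for i u
  proof
    assume eq: "A i = A (i + u)"
    define p q where "p = leg (R (i * m))" and "q = leg (R ((i + u) * m))"
    have yT: "y \<in> T" using in_Z(5)[OF y_Z] .
    have pq_neq: "leg (R (j * m)) \<noteq> y" for j
    proof -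
      have "(f ^^ (0 + j * m)) y \<noteq> leg (run \<nu> (itinerary T f c y) 0 0 (j * m))"
        using lam_leg[of y 0 0 "j * m"] in_Z[OF y_Z] in_Z(2)[OF iter_Z] by simp
      then show ?thesis using fim[of j] R[of "j * m"] by (simp add: \<tau>_def)
    qed
    have pqT: "p \<in> T - {y}" "q \<in> T - {y}" using pq_neq leg_in_T by (auto simp: p_def q_def)
    have "y \<notin> seg p q" using eq dir_eq_iff[OF yT pqT] by (simp add: A_def p_def q_def)
    \<comment> \<open>The third leg \<open>y\<close> is never cut itself, so for a majority it
      suffices that the other two are not cut at the same time.\<close>
    obtain b where b: "tripod b p q y" using pqT yT by (auto intro: tripod_exists)
    have "\<not> ?q dvd u" using u by (auto dest: dvd_imp_le)
    then have "sy (proc per p t) = per (Suc t) \<or> sy (proc per q t) = per (Suc t)" for t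
      using leg_never_both_cut[OF aef, of i t u] by (auto simp: p_def q_def)
    moreover have self: "sy ((f ^^ t) y) = per (Suc t)" for t by (simp add: per \<tau>_Suc)
    then have "sy (proc per y t) = per (Suc t)" for t using proc_self[of y per t] by simp
    ultimately have itin: "sy ((f ^^ t) b) = per (Suc t)" for t
      using tripod_itinerary[OF b, of per t] \<tau>_not_star per by auto
    have "b \<noteq> p" "b \<noteq> q"
      using tripod_center_neq_leg[of b per, OF itin] leg_eventually_cut[OF aef]
      by (auto simp: p_def q_def)
    moreover have "b \<noteq> y" using b \<open>y \<notin> seg p q\<close> by (auto simp: tripod_def)
    ultimately have "branch_point T b" using tripod_branch[OF b] by simp
    then have "b = y" using branch_eq_if_itineraries_eq[OF _ in_Z(1)[OF y_Z], of b] itin self by simp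
    with \<open>b \<noteq> y\<close> show False ..
  qed
  have "inj_on A {..<?q}"
  proof (rule linorder_inj_onI')
    fix i j assume "i \<in> {..<?q}" "j \<in> {..<?q}" "i < j"
    then show "A i \<noteq> A j" using ne[of "j - i" i] by simp
  qed
  then have "card (arms T y) = ?q" using arms card_image[of A "{..<?q}"] by simp
  then show ?thesis using entry rho by simp
qed

end

context tame_hubbard
begin

lemma entry_and_number_of_arms: "m \<in> internal_address \<nu> \<and> rho \<nu> m \<noteq> \<infinity> \<and> card (arms T z) = q_num \<nu> m"
proof -
  obtain y where y: "y \<in> Z" "dir y c \<noteq> dir y (f c)" "\<And>w. w \<in> Z \<Longrightarrow> w \<noteq> y \<Longrightarrow> dir y w = dir y c"
    using characteristic_point by metis
  interpret characteristic T f c z m y by unfold_locales (use y in auto)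
  show ?thesis using entry_and_number_of_arms_at_y card_arms_Z[OF y(1)] by simp
qed

end


subsection \<open>Existence of tame branch points\<close>

context hubbard
begin

text \<open>If \<open>p\<close> is the first place of \<open>SymStar\<close>, then
  \<open>\<nu>\<close> has period \<open>p\<close>. The \<rho>-orbit of 1 cannot jump over
  \<open>p\<close>, as no earlier symbol is a star, and it stops at \<open>p\<close>, where
  \<open>rho\<close> is infinite. So an entry with finite \<open>rho\<close> comes before
  \<open>p\<close>.\<close>

lemma kneading_star_initial:
  assumes m: "m \<in> internal_address \<nu>" and rho: "rho \<nu> m \<noteq> \<infinity>" and i: "1 \<le> i" "i \<le> m"
  shows "\<nu> i \<noteq> SymStar"
proof
  assume "\<nu> i = SymStar"
  then have i_star: "1 \<le> i \<and> \<nu> i = SymStar" using i(1) by simp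
  define p where "p = (LEAST p. 1 \<le> p \<and> \<nu> p = SymStar)"
  have p: "1 \<le> p \<and> \<nu> p = SymStar" 
    unfolding p_def by (rule LeastI[of _ i]) (rule i_star)
  have p_min: "\<nu> j \<noteq> SymStar" if "1 \<le> j" "j < p" for j
    using not_less_Least[of j "\<lambda>p. 1 \<le> p \<and> \<nu> p = SymStar"] that unfolding p_def[symmetric] by simp
  have pi: "p \<le> i" unfolding p_def by (rule Least_le) (rule i_star)
  obtain p' where p': "p = Suc p'" using p by (cases p) auto
  have "leg p' = c" using p sy_leg[of p'] sy_eq_star_iff[of "leg p'"] p' by simp
  then have leg_p: "leg p = leg 0" using p' by simp
  have leg_shift: "leg (n + p) = leg n" for n
    using leg_p by (induction n) simp_all
  have period: "\<nu> l = \<nu> (l - p)" if "p < l" for l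
  proof -
    obtain n where n: "l = Suc (n + p)" using less_imp_Suc_add[OF \<open>p < l\<close>] by (auto simp: add.commute)
    have "\<nu> (Suc (n + p)) = \<nu> (Suc n)" using sy_leg[of "n + p"] sy_leg[of n] leg_shift by simp
    then show ?thesis using n by simp
  qed
  have "1 \<le> j \<and> j \<le> p" if "j \<in> rho_orbit \<nu> 1" for j
    using that
  proof induction
    case start
    then show ?case using p by simp
  next
    case (step j l)
    then have l: "j < l" "\<nu> l \<noteq> \<nu> (l - j)" "\<And>k. j < k \<Longrightarrow> k < l \<Longrightarrow> \<nu> k = \<nu> (k - j)"
      by (auto simp: rho_eq_enat_iff)
    have "j \<noteq> p"
    proof
      assume "j = p"
      then show False using l(1,2) period by simp
    qed
    then have "j < p" using step.IH by simp
    then have "\<nu> (p - j) \<noteq> SymStar" using p_min[of "p - j"] step.IH by simp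
    then have "\<nu> p \<noteq> \<nu> (p - j)" using p by simp
    then have "\<not> p < l" using l(3)[of p] \<open>j < p\<close> by auto
    then show ?case using l(1) step.IH by simp
  qed
  then have "m \<le> p" using m unfolding internal_address_def by simp
  then have "m = p" using pi i by simp
  obtain k where "rho \<nu> m = enat k" using rho by auto
  then have "m < k" "\<nu> k \<noteq> \<nu> (k - m)" by (auto simp: rho_eq_enat_iff)
  then show False using period[of k] \<open>m = p\<close> by simp
qed

text \<open>For tameness, note that every arm on the orbit of the center contains an endpoint, hence
  a point of the critical orbit. By expansivity its leg is eventually cut, and from the critical
  value it returns to the single arm \<open>l\<close>. As \<open>lam\<close> permutes the finitely
  many local arms, they all lie on the cycle of \<open>l\<close>.\<close>

lemma exists_tame_branch_point:
  assumes m: "m \<in> internal_address \<nu>" and rho: "rho \<nu> m \<noteq> \<infinity>" and q: "3 \<le> q_num \<nu> m"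
  shows "\<exists>b. tame_branch_point T f b \<and> exact_period f b m"
proof -
  obtain k where k: "rho \<nu> m = enat k" using rho by auto
  have aef: "address_entry_finite \<nu> m k" using m k by unfold_locales
  interpret address_entry_finite \<nu> m k by (rule aef)
  let ?q = "q_num \<nu> m"
  have star: "per (Suc t) \<noteq> SymStar" for t
    using kneading_star_initial[OF m rho, of "Suc (t mod m)"] entry_pos
    by (simp add: per_def Suc_le_eq)
  \<comment> \<open>The positions of the leg of the critical value after 0, 1 and 2 periods will
    span the tripod; their distances 1 and 2 are not divisible by \<open>?q\<close>.\<close>
  define x where "x = (\<lambda>i. leg (R (i * m)))"
  have xT: "x i \<in> T" for i by (simp add: x_def leg_in_T)
  obtain b where b: "tripod b (x 0) (x 1) (x 2)" using xT xT xT by (rule tripod_exists)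
  have one: "sy (proc per (x i) t) = per (Suc t) \<or> sy (proc per (x (i + u)) t) = per (Suc t)"
    if "0 < u" "u < 3" for i u t
  proof -
    have "\<not> ?q dvd u" using that q by (auto dest: dvd_imp_le)
    then show ?thesis using leg_never_both_cut[OF aef, of i t u] by (auto simp: x_def)
  qed
  have itin: "sy ((f ^^ t) b) = per (Suc t)" for t
  proof (rule tripod_itinerary[where \<tau> = per, OF b star])
    fix t
    show "sy (proc per (x 0) t) = per (Suc t) \<and> sy (proc per (x 1) t) = per (Suc t) \<or>
      sy (proc per (x 0) t) = per (Suc t) \<and> sy (proc per (x 2) t) = per (Suc t) \<or>
      sy (proc per (x 1) t) = per (Suc t) \<and> sy (proc per (x 2) t) = per (Suc t)"
      using one[of 1 0 t] one[of 2 0 t] one[of 1 1 t] by (auto simp: numeral_2_eq_2)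
  qed
  have neq: "b \<noteq> x i" for i
    using tripod_center_neq_leg[of b per, OF itin] leg_eventually_cut[OF aef]
    by (auto simp: x_def)
  then have branch: "branch_point T b" by (intro tripod_branch[OF b])
  have per_shift: "per (Suc (t + m)) = per (Suc t)" for t using per_add[of "Suc t"] by simp
  have fm: "(f ^^ m) b = b"
  proof (rule branch_eq_if_itineraries_eq[OF branch_iterate(1)[OF branch] branch])
    fix t
    have "(f ^^ t) ((f ^^ m) b) = (f ^^ (t + m)) b" by (simp add: funpow_add)
    then show "sy ((f ^^ t) ((f ^^ m) b)) = sy ((f ^^ t) b)" using itin per_shift by simp
  qed
  \<comment> \<open>So far the period of \<open>b\<close> is only known to divide \<open>m\<close>;
    a smaller one would be visible in the word, against \<open>entry_primitive\<close>.\<close>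
  define d where "d = (LEAST d. 0 < d \<and> (f ^^ d) b = b)"
  have m_period: "0 < m \<and> (f ^^ m) b = b" using entry_pos fm by simp
  have d: "0 < d \<and> (f ^^ d) b = b" unfolding d_def by (rule LeastI[of _ m]) (rule m_period)
  have "(f ^^ j) b \<noteq> b" if "0 < j" "j < d" for j
    using not_less_Least[of j "\<lambda>d. 0 < d \<and> (f ^^ d) b = b"] that unfolding d_def[symmetric] by simp
  then have ex_d: "exact_period f b d" using d unfolding exact_period_def by (intro conjI allI impI) auto
  have dvd: "d dvd m" by (rule exact_period_dvd[OF ex_d fm])
  have per_d: "\<nu> j = \<nu> (j - d)" if j: "d < j" "j \<le> m" for j
  proof -
    obtain n where n: "j = Suc (n + d)" using less_imp_Suc_add[OF j(1)] by (auto simp: add.commute)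
    have "(f ^^ (n + d)) b = (f ^^ n) b" using d by (simp add: funpow_add)
    then have "per (Suc (n + d)) = per (Suc n)" using itin by metis
    then show ?thesis using per_initial[of "Suc (n + d)"] per_initial[of "Suc n"] n j by simp
  qed
  have "0 < d" using d by simp
  then have "d = m" using dvd per_d by (rule entry_primitive)
  then have period: "exact_period f b m" using ex_d by simp
  define \<tau> where "\<tau> = itinerary T f c b"
  have \<tau>: "\<tau> j = per j" if "1 \<le> j" for j
  proof -
    obtain n where "j = Suc n" using \<open>1 \<le> j\<close> by (cases j) auto
    then show ?thesis using itin by (simp add: \<tau>_def itinerary_Suc)
  qed
  have run: "run \<nu> \<tau> t y n = run \<nu> per t y n" for t y n
    by (rule run_cong) (auto simp: \<tau>)
  have lam_run: "(lam ^^ n) ((f ^^ t) b, dir ((f ^^ t) b) (leg y)) =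
      ((f ^^ (t + n)) b, dir ((f ^^ (t + n)) b) (leg (run \<nu> per t y n)))"
    if "(f ^^ t) b \<noteq> leg y" for t y n
    using lam_leg[of b t y n] that branch_iterate(2)[OF branch, of 0] branch_iterate(2)[OF branch] run
    by (simp add: \<tau>_def)
  have fmult: "(f ^^ (m * i)) b = b" for i by (rule funpow_fixed_mult[OF fm])
  define l where "l = (b, dir b (f c))"
  have l_period: "(lam ^^ (?q * m)) l = l"
    using lam_run[of 0 0 "?q * m"] leg_neq_branch_0[OF branch, of 0] q_num_return(1) fmult[of ?q]
    by (simp add: l_def mult.commute)
  have from_c1: "\<exists>n. (lam ^^ n) ((f ^^ t) b, dir ((f ^^ t) b) (f c)) = l" for t
  proof -
    \<comment> \<open>\<open>run_returns\<close> expects a phase in 1, ..., \<open>m\<close>, so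
      multiples of \<open>m\<close> are represented by \<open>m\<close> itself.\<close>
    define i where "i = (if t mod m = 0 then m else t mod m)"
    have i: "1 \<le> i" "i \<le> m" using entry_pos by (auto simp: i_def)
    have "\<exists>a. i + a * m = t + m"
    proof (cases "t mod m = 0")
      case True
      then have "m + (t div m) * m = t + m" by (metis add.commute add.right_neutral div_mult_mod_eq)
      then show ?thesis using True by (auto simp: i_def)
    next
      case False
      have "t mod m + (t div m + 1) * m = t + m" by (simp add: add_mult_distrib)
      then show ?thesis using False unfolding i_def by metis
    qed
    then obtain a where a: "i + a * m = t + m" by auto
    have shift: "run \<nu> per t 0 n = run \<nu> per i 0 n" for n
      using run_per_shift[of t 1 0 n] run_per_shift[of i a 0 n] a by simp
    obtain e where e: "run \<nu> per i 0 (m - i + e * m) = 0"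
    proof (cases "run \<nu> per i 0 (m - i) = 0")
      case True
      then show ?thesis using that[of 0] by simp
    next
      case False
      then show ?thesis using run_returns[OF i] that[of 1] by simp
    qed
    define n where "n = m - i + e * m"
    have "t + n + m = m * (a + e + 1)"
      using a i by (simp add: n_def algebra_simps)
    then have "(f ^^ (t + n + m)) b = b" using fmult by metis
    then have "(f ^^ (t + n)) b = b" using fm by (simp add: funpow_add)
    then have "(lam ^^ n) ((f ^^ t) b, dir ((f ^^ t) b) (leg 0)) = (b, dir b (leg 0))"
      using lam_run[of t 0 n] leg_neq_branch_0[OF branch, of t] shift[of n] e by (simp add: n_def)
    then show ?thesis by (auto simp: l_def)
  qed
  let ?Z = "orbit_of f b"
  have Z: "\<exists>t. y = (f ^^ t) b" if "y \<in> ?Z" for y using that by (auto simp: orbit_of_def)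
  have reach: "\<exists>n. (lam ^^ n) p = l" if p: "p \<in> local_arms T ?Z" for p
  proof -
    obtain y A where yA: "p = (y, A)" "y \<in> ?Z" "A \<in> arms T y" using p by (auto simp: local_arms_def)
    obtain t where t: "y = (f ^^ t) b" using Z yA(2) by auto
    have y: "y \<in> T - {c}" "vertex y" "y \<in> T" using branch_iterate[OF branch, of t] t by auto
    obtain w where w: "w \<in> T - {y}" "A = dir y w" using yA(3) unfolding arms_eq by auto
    obtain e where e: "tree_endpoint T e" "e \<in> dir y w" using y(3) w(1) by (rule endpoint_in_arm)
    have e': "e \<in> T - {y}" "A = dir y e" using in_dir_iff[OF y(3) w(1), of e] e(2) w(2) by auto
    have "e \<in> orbit_of f c" by (rule endpoint_in_orbit[OF e(1)])
    then obtain j where j: "e = (f ^^ j) c" by (auto simp: orbit_of_def)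
    have "\<exists>n. (lam ^^ n) p = ((f ^^ (t + n)) b, dir ((f ^^ (t + n)) b) (f c))"
    proof (cases j)
      \<comment> \<open>The critical point is not encoded as a leg, but its direction turns into
        that of the critical value in one step.\<close>
      case 0
      then have "e = c" using j by simp
      moreover have "cut y c = c" by (simp add: cut_def)
      ultimately have "lam p = (f y, dir (f y) (f c))"
        using local_arm_map_dir(1)[OF y(1) e'(1)] e'(2) yA(1) by simp
      then show ?thesis using t by (intro exI[of _ 1]) simp
    next
      case (Suc i)
      then have e_leg: "e = leg i" using j unfolding leg_def by (simp only: funpow_Suc_right comp_apply)
      have "y \<noteq> leg i" using e'(1) e_leg by auto
      then obtain n where n: "sy ((f ^^ n) y) \<noteq> sy ((f ^^ n) (leg i))"
        "\<forall>s<n. sy ((f ^^ s) y) = sy ((f ^^ s) (leg i))"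
        using itineraries_differ[OF y(2) leg_vertex, of i] by metis
      have leg: "(f ^^ s) (leg i) = leg (i + s)" for s
        unfolding leg_def by (metis add.commute comp_apply funpow_add)
      have ft: "(f ^^ s) y = (f ^^ (t + s)) b" for s
        unfolding t by (metis add.commute comp_apply funpow_add)
      have agree: "\<nu> (i + s) = per (t + s)" if s: "0 < s" "s \<le> n" for s
      proof -
        obtain s' where s': "s = Suc s'" using s(1) by (cases s) auto
        then have "sy ((f ^^ s') y) = sy ((f ^^ s') (leg i))" using n(2) s(2) by simp
        then show ?thesis using leg ft itin sy_leg s' by simp
      qed
      have "run \<nu> per t i n = i + n" using agree by (rule run_agree)
      moreover have "\<nu> (Suc (i + n)) \<noteq> per (Suc (t + n))" using n(1) leg ft itin sy_leg by simp
      ultimately have "run \<nu> per t i (Suc n) = 0" by simp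
      then have "(lam ^^ Suc n) p = ((f ^^ (t + Suc n)) b, dir ((f ^^ (t + Suc n)) b) (leg 0))"
        using lam_run[of t i "Suc n"] \<open>y \<noteq> leg i\<close> t yA(1) e' e_leg by (simp del: run.simps funpow.simps)
      then show ?thesis unfolding leg_0 by (rule exI)
    qed
    then obtain n where n: "(lam ^^ n) p = ((f ^^ (t + n)) b, dir ((f ^^ (t + n)) b) (f c))" by auto
    obtain n' where "(lam ^^ n') ((f ^^ (t + n)) b, dir ((f ^^ (t + n)) b) (f c)) = l" using from_c1 by auto
    then have "(lam ^^ (n' + n)) p = l" using n by (simp add: funpow_add)
    then show ?thesis by auto
  qed
  have Z_fin: "?Z \<subseteq> (\<lambda>n. (f ^^ n) b) ` {..<m}"
  proof
    fix y assume "y \<in> ?Z"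
    then obtain n where n: "y = (f ^^ n) b" using Z by auto
    have "(f ^^ n) b = (f ^^ (n mod m + m * (n div m))) b" by simp
    then have "y = (f ^^ (n mod m)) b" unfolding funpow_add using n fmult by simp
    then show "y \<in> (\<lambda>n. (f ^^ n) b) ` {..<m}" using entry_pos by auto
  qed
  have Z_facts: "y \<in> T - {c}" "f y \<in> ?Z" "(f ^^ m) y = y" if y: "y \<in> ?Z" for y
  proof -
    obtain t where t: "y = (f ^^ t) b" using Z y by auto
    show "y \<in> T - {c}" using branch_iterate(2)[OF branch] t by simp
    have "f y = (f ^^ Suc t) b" using t by simp
    then show "f y \<in> ?Z" unfolding orbit_of_def by blast
    have "(f ^^ m) y = (f ^^ t) ((f ^^ m) b)" unfolding t by (metis add.commute comp_apply funpow_add)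
    then show "(f ^^ m) y = y" using fm t by simp
  qed
  have fin: "finite (local_arms T ?Z)"
    unfolding local_arms_def
  proof (rule finite_SigmaI)
    show "finite ?Z" using Z_fin finite_surj by blast
    show "finite (arms T y)" if "y \<in> ?Z" for y using Z_facts(1)[OF that] by (intro finite_arms) simp
  qed
  have maps: "lam p \<in> local_arms T ?Z" if p: "p \<in> local_arms T ?Z" for p
  proof -
    obtain y A where yA: "p = (y, A)" "y \<in> ?Z" "A \<in> arms T y" using p by (auto simp: local_arms_def)
    have "lam p = (fst (lam (y, A)), snd (lam (y, A)))" using yA(1) by simp
    then show ?thesis
      using lam_arm[OF Z_facts(1)[OF yA(2)] yA(3)] Z_facts(2)[OF yA(2)] by (simp add: local_arms_def)
  qed
  have inj: "inj_on lam (local_arms T ?Z)"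
  proof (rule inj_onI)
    fix p p' assume p: "p \<in> local_arms T ?Z" "p' \<in> local_arms T ?Z" "lam p = lam p'"
    obtain y A where yA: "p = (y, A)" "y \<in> ?Z" "A \<in> arms T y" using p(1) by (auto simp: local_arms_def)
    obtain w B where wB: "p' = (w, B)" "w \<in> ?Z" "B \<in> arms T w" using p(2) by (auto simp: local_arms_def)
    have "f y = f w"
      using lam_arm(1)[OF Z_facts(1)[OF yA(2)] yA(3)] lam_arm(1)[OF Z_facts(1)[OF wB(2)] wB(3)] p(3) yA wB by simp
    moreover obtain m' where m': "m = Suc m'" using entry_pos by (cases m) auto
    ultimately have "(f ^^ m) y = (f ^^ m) w" unfolding m' funpow_Suc_right by simp
    then have "y = w" using Z_facts(3) yA(2) wB(2) by simp
    moreover from this have "A = B"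
      using inj_onD[OF lam_inj[OF Z_facts(1)[OF yA(2)]], of A B] p(3) yA wB by simp
    ultimately show "p = p'" using yA wB by simp
  qed
  have "local_arms T ?Z \<subseteq> orbit_of lam l"
  proof
    fix p assume p: "p \<in> local_arms T ?Z"
    obtain n where n: "(lam ^^ n) p = l" using reach[OF p] by auto
    obtain N where N: "0 < N" "(lam ^^ N) p = p"
      using fin maps inj p by (rule periodic_if_inj_on_finite)
    \<comment> \<open>The \<open>N * n - n\<close> steps that complete the cycle of \<open>p\<close>
      lead back from \<open>l\<close> to \<open>p\<close>.\<close>
    have "n \<le> N * n" using N(1) by simp
    then have e: "(N * n - n) + n = N * n" by simp
    have "(lam ^^ (N * n - n)) l = (lam ^^ ((N * n - n) + n)) p" using n by (simp add: funpow_add)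
    also have "\<dots> = p" unfolding e by (rule funpow_fixed_mult[OF N(2)])
    finally have "p = (lam ^^ (N * n - n)) l" by simp
    then show "p \<in> orbit_of lam l" unfolding orbit_of_def by blast
  qed
  moreover have "l \<in> local_arms T ?Z"
  proof -
    have "b = (f ^^ 0) b" by simp
    then have "b \<in> ?Z" unfolding orbit_of_def by blast
    moreover have "f c \<in> T - {b}"
      using leg_neq_branch_0[OF branch, of 0] f_in_T[OF c_in_T] by auto
    ultimately show ?thesis using dir_in_arms by (simp add: l_def local_arms_def)
  qed
  moreover have "0 < ?q * m" using q_num_return(2) entry_pos by simp
  ultimately have "tame_orbit T f ?Z" unfolding tame_orbit_def using l_period by blast
  moreover have "\<exists>n>0. (f ^^ n) b = b" using fm entry_pos by (intro exI[of _ m]) simp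
  ultimately have "tame_branch_point T f b" using branch by (simp add: tame_branch_point_def)
  then show ?thesis using period by auto
qed

end

theorem proposition4p19:
  fixes T :: "'a::t2_space set" and f :: "'a \<Rightarrow> 'a" and c :: 'a and \<nu> :: "nat \<Rightarrow> symbol"
  assumes "hubbard_tree T f c"
    and "\<nu> = kneading_sequence T f c"
  shows "(\<forall>z m. tame_branch_point T f z \<and> exact_period f z m \<longrightarrow>
            m \<in> internal_address \<nu> \<and> rho \<nu> m \<noteq> \<infinity> \<and> card (arms T z) = q_num \<nu> m) \<and>
         (\<forall>m\<in>internal_address \<nu>.
            rho \<nu> m \<noteq> \<infinity> \<and> q_num \<nu> m \<ge> 3 \<and> \<not> exact_period f c m \<longrightarrow>
            (\<exists>z. tame_branch_point T f z \<and> exact_period f z m \<and> card (arms T z) = q_num \<nu> m))"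
proof -
  interpret H: hubbard T f c
    using assms(1) by unfold_locales (simp_all add: hubbard_tree_def)
  have \<nu>: "H.\<nu> = \<nu>" using assms(2) by (simp add: H.\<nu>_def)
  have A: "m \<in> internal_address \<nu> \<and> rho \<nu> m \<noteq> \<infinity> \<and> card (arms T z) = q_num \<nu> m"
    if z: "tame_branch_point T f z" "exact_period f z m" for z m
  proof -
    interpret tame_hubbard T f c z m using z by unfold_locales
    show ?thesis using entry_and_number_of_arms \<nu> by simp
  qed
  \<comment> \<open>The number of arms in the second half comes from the first half, applied to the
    branch point found.\<close>
  show ?thesis using A H.exists_tame_branch_point[unfolded \<nu>] by blast
qed

end
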